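(* Let $G_1$ be an additive abelian group and let $\Upsilon_1$ be a maximal nontrivial critical trio in $G_1$. Then there exist an integer $m \ge 1$, subgroups $G_1 > G_2 > \cdots > G_m$ (each a proper subgroup of the previous one), and trios $\Upsilon_1, \Upsilon_2, \ldots, \Upsilon_m$, with $\Upsilon_i$ a trio in $G_i$, such that (1) for every $1 \le i \le m-1$, $\Upsilon_i$ is (as a trio in the group $G_i$) an impure beat or an impure chord relative to $G_{i+1}$, with continuation $\Upsilon_{i+1}$; and (2) $\Upsilon_m$ is (as a trio in the group $G_m$) either a pure beat or a pure chord.
   Context: Let $G$ be an additive abelian group. $H<G$ means that $H$ is a proper subgroup of $G$. For $A,B\subseteq G$: $A+B=\{a+b : a\in A, b\in B\}$, $\overline{A}=G\setminus A$, $-A=\{-a: a\in A\}$, and $G_A=\{g\in G : g+A=A\}$ is the stabilizer of $A$. For $H\le G$, $A$ is $H$-stable if $A+H=A$ (the empty set is $H$-stable). For a nonempty set $A\subseteq G$ there is a unique minimal subgroup $H$ such that $A$ is contained in an $H$-coset; this $H$-coset is denoted $[A]$ and called the closure of $A$. Trios. A triple $(A,B,C)$ of subsets of $G$ is a trio (in $G$) if $0\notin A+B+C$ and each of $A,B,C$ is finite or cofinite in $G$. If $n$ is the size of the complement of the largest of $A,B,C$ and $\ell,m$ are the sizes of the other two sets, the deficiency is $\delta(A,B,C)=\ell+m-n$ (if $G$ is finite, $\delta(A,B,C)=|A|+|B|+|C|-|G|$). If $G$ is infinite and all three sets are finite, then $n$ is infinite and the trio is not critical. The trio is critical if $\delta(A,B,C)>0$,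 and trivial if one of $A,B,C$ is empty (nontrivial otherwise). A trio $(A^*,B^*,C^* )$ is a supertrio of $(A,B,C)$ if $A\subseteq A^*$, $B\subseteq B^*$, $C\subseteq C^*$; a trio is maximal if its only supertrio is itself. Two trios are similar if one can be obtained from the other by a sequence of operations of the following kinds: permuting the three sets, and replacing $(A,B,C)$ by $(A+g,B-g,C)$ for some $g\in G$. $R$-sequences. Let $H<G$ be finite and let $R\in G/H$ generate $G/H$ (so $G/H$ is cyclic). An $R$-sequence is a set that is a union $\bigcup_{i=0}^{k}(Q+iR)$ with $Q\in G/H$ and $k\ge 0$, where $Q+iR$ is computed in $G/H$; $Q$ is its head, $Q+kR$ its tail, and $k+1$ its length. It is basic if its head is $H$, and nontrivial if its length is at least $2$. Pure beat. Let $H<G$ be finite. A trio $\Upsilon$ is a pure beat relative to $H$ if it is similar to a trio $(A,B,C)$ with $A=H$, $G_B=H$, and $C=\overline{-(A+B)}\ne\emptyset$. Pure chord. Let $H<G$ be finite with $G/H$ cyclic. A trio $\Upsilon$ is a pure chord relative to $H$ if there exist $R\in G/H$ generating $G/H$ and a trio $(A,B,C)$ similar to $\Upsilon$ such that $A$ and $B$ are nontrivial $R$-sequences, and $C=\overline{-(A+B)}$ is not contained in a single $H$-coset. Impure beat. Let $H<G$ (possibly infinite). A trio $\Upsilon$ is an impure beat relative to $H$ if there is a trio $(A,B,C)$ similar to $\Upsilon$ such that $[A]=H$; $B\setminus H$ is $H$-stable; $C\setminus H=\overline{-(A+B)}\setminus H$; and $B\cap H\ne\emptyset$, $C\cap H\neq\emptyset$.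 Then $(A,B\cap H,C\cap H)$ is a trio in $H$, called a continuation of $\Upsilon$. Impure chord. Let $H<G$ be finite with $G/H$ cyclic. A trio $\Upsilon$ is an impure chord relative to $H$ if there exist $R\in G/H$ generating $G/H$ and a trio $(A,B,C)$ similar to $\Upsilon$ such that $H\cup A$ and $H\cup B$ are nontrivial basic $R$-sequences; $C\setminus H=\overline{-(A+B)}\setminus H\ne\emptyset$; and $A\cap H$, $B\cap H$, $C\cap H$ are all nonempty. Then $(A\cap H,B\cap H,C\cap H)$ is a trio in $H$, called a continuation of $\Upsilon$. A trio in $G$ is called a pure beat if it is a pure beat relative to some finite proper subgroup $H<G$, and a pure chord if it is a pure chord relative to some finite proper subgroup $H<G$ with $G/H$ cyclic. *)

theory Defs
  imports "HOL-Library.Set_Algebras" "HOL-Library.Extended_Real"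
begin

text \<open>
  Groups are subgroups of an arbitrary type of class \<^class>\<open>ab_group_add\<close>, given by their
  carrier sets. Every notion below that depends on the ambient group (complement, coset,
  stabilizer, closure, trio, ...) takes this group \<open>G\<close> as its first argument, so that it can be
  used relative to each member of a chain of subgroups. Sums of sets and the translates
  \<open>g +o A\<close> are those of \<^theory>\<open>HOL-Library.Set_Algebras\<close>.
\<close>

type_synonym 'a trio = "'a set \<times> 'a set \<times> 'a set"

definition add_subgroup :: "'a::ab_group_add set \<Rightarrow> bool" where
  "add_subgroup H \<longleftrightarrow>
     0 \<in> H \<and> (\<forall>x\<in>H. \<forall>y\<in>H. x + y \<in> H) \<and> (\<forall>x\<in>H. - x \<in> H)"

definition subgroup_of :: "'a::ab_group_add set \<Rightarrow> 'a set \<Rightarrow> bool" where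
  "subgroup_of H G \<longleftrightarrow> add_subgroup G \<and> add_subgroup H \<and> H \<subseteq> G"

definition proper_subgroup_of :: "'a::ab_group_add set \<Rightarrow> 'a set \<Rightarrow> bool" where
  "proper_subgroup_of H G \<longleftrightarrow> add_subgroup G \<and> add_subgroup H \<and> H \<subset> G"

text \<open>The set \<open>G/H\<close>. Addition of cosets is addition of sets, the neutral element is \<open>H\<close>.\<close>

definition cosets :: "'a::ab_group_add set \<Rightarrow> 'a set \<Rightarrow> 'a set set" where
  "cosets G H = {g +o H | g. g \<in> G}"

definition stabilizer :: "'a::ab_group_add set \<Rightarrow> 'a set \<Rightarrow> 'a set" where
  "stabilizer G A = {g \<in> G. g +o A = A}"

definition stable :: "'a::ab_group_add set \<Rightarrow> 'a set \<Rightarrow> bool" where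
  "stable H A \<longleftrightarrow> A + H = A"

text \<open>\<open>is_closure G A Q\<close> means \<open>Q = [A]\<close>. The subgroups having a coset that contains a given
  nonempty set are closed under intersection, so the unique minimal one is the least one.\<close>

definition is_closure :: "'a::ab_group_add set \<Rightarrow> 'a set \<Rightarrow> 'a set \<Rightarrow> bool" where
  "is_closure G A Q \<longleftrightarrow> A \<noteq> {} \<and> A \<subseteq> Q \<and>
     (\<exists>H. subgroup_of H G \<and> Q \<in> cosets G H \<and>
          (\<forall>K. subgroup_of K G \<and> (\<exists>P\<in>cosets G K. A \<subseteq> P) \<longrightarrow> H \<subseteq> K))"

definition neg_sum_compl :: "'a::ab_group_add set \<Rightarrow> 'a set \<Rightarrow> 'a set \<Rightarrow> 'a set" where
  "neg_sum_compl G A B = G - uminus ` (A + B)"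

fun trio :: "'a::ab_group_add set \<Rightarrow> 'a trio \<Rightarrow> bool" where
  "trio G (A, B, C) \<longleftrightarrow> A \<subseteq> G \<and> B \<subseteq> G \<and> C \<subseteq> G \<and> 0 \<notin> A + B + C \<and>
     (\<forall>X\<in>{A, B, C}. finite X \<or> finite (G - X))"

definition ecard :: "'a set \<Rightarrow> ereal" where
  "ecard A = (if finite A then ereal (real (card A)) else \<infinity>)"

text \<open>For a trio, ties for the largest set do not affect the value: if \<open>G\<close> is finite it is always
  \<open>|A| + |B| + |C| - |G|\<close>, and if two of the sets are infinite (hence cofinite) it is \<open>\<infinity>\<close>.
  If \<open>G\<close> is infinite and all three sets are finite, it is \<open>-\<infinity>\<close>.\<close>

fun deficiency :: "'a::ab_group_add set \<Rightarrow> 'a trio \<Rightarrow> ereal" where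
  "deficiency G (A, B, C) =
     (if ecard B \<le> ecard A \<and> ecard C \<le> ecard A then ecard B + ecard C - ecard (G - A)
      else if ecard A \<le> ecard B \<and> ecard C \<le> ecard B then ecard A + ecard C - ecard (G - B)
      else ecard A + ecard B - ecard (G - C))"

definition critical :: "'a::ab_group_add set \<Rightarrow> 'a trio \<Rightarrow> bool" where
  "critical G T \<longleftrightarrow> deficiency G T > 0"

fun nontrivial :: "'a trio \<Rightarrow> bool" where
  "nontrivial (A, B, C) \<longleftrightarrow> A \<noteq> {} \<and> B \<noteq> {} \<and> C \<noteq> {}"

fun supertrio :: "'a trio \<Rightarrow> 'a trio \<Rightarrow> bool" where
  "supertrio (A', B', C') (A, B, C) \<longleftrightarrow> A \<subseteq> A' \<and> B \<subseteq> B' \<and> C \<subseteq> C'"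

definition maximal_trio :: "'a::ab_group_add set \<Rightarrow> 'a trio \<Rightarrow> bool" where
  "maximal_trio G T \<longleftrightarrow> trio G T \<and> (\<forall>T'. trio G T' \<and> supertrio T' T \<longrightarrow> T' = T)"

inductive similar :: "'a::ab_group_add set \<Rightarrow> 'a trio \<Rightarrow> 'a trio \<Rightarrow> bool"
  for G :: "'a::ab_group_add set" and T :: "'a trio" where
  refl: "similar G T T"
| swap12: "similar G T (A, B, C) \<Longrightarrow> similar G T (B, A, C)"
| swap23: "similar G T (A, B, C) \<Longrightarrow> similar G T (A, C, B)"
| shift: "similar G T (A, B, C) \<Longrightarrow> g \<in> G \<Longrightarrow> similar G T (g +o A, (- g) +o B, C)"

text \<open>\<open>add_coset R i Q\<close> is \<open>Q + iR\<close>, computed in \<open>G/H\<close>; in particular \<open>add_coset R i H\<close> is \<open>iR\<close>.\<close>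

definition add_coset :: "'a::ab_group_add set \<Rightarrow> nat \<Rightarrow> 'a set \<Rightarrow> 'a set" where
  "add_coset R i Q = ((+) R ^^ i) Q"

text \<open>Every element of \<open>G/H\<close> is an integer multiple of \<open>R\<close>.\<close>

definition generates_quotient ::
    "'a::ab_group_add set \<Rightarrow> 'a set \<Rightarrow> 'a set \<Rightarrow> bool" where
  "generates_quotient G H R \<longleftrightarrow> R \<in> cosets G H \<and>
     (\<forall>Q\<in>cosets G H. \<exists>n. Q = add_coset R n H \<or> Q = uminus ` add_coset R n H)"

text \<open>\<open>S\<close> is an \<open>R\<close>-sequence with head \<open>Q\<close> and length \<open>k + 1\<close>.\<close>

definition R_sequence_from ::
    "'a::ab_group_add set \<Rightarrow> 'a set \<Rightarrow> 'a set \<Rightarrow> 'a set \<Rightarrow> nat \<Rightarrow> 'a set \<Rightarrow> bool" where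
  "R_sequence_from G H R Q k S \<longleftrightarrow> Q \<in> cosets G H \<and> S = (\<Union>i\<in>{0..k}. add_coset R i Q)"

definition nontrivial_R_sequence ::
    "'a::ab_group_add set \<Rightarrow> 'a set \<Rightarrow> 'a set \<Rightarrow> 'a set \<Rightarrow> bool" where
  "nontrivial_R_sequence G H R S \<longleftrightarrow> (\<exists>Q k. R_sequence_from G H R Q k S \<and> k + 1 \<ge> 2)"

definition nontrivial_basic_R_sequence ::
    "'a::ab_group_add set \<Rightarrow> 'a set \<Rightarrow> 'a set \<Rightarrow> 'a set \<Rightarrow> bool" where
  "nontrivial_basic_R_sequence G H R S \<longleftrightarrow> (\<exists>k. R_sequence_from G H R H k S \<and> k + 1 \<ge> 2)"

definition pure_beat_rel :: "'a::ab_group_add set \<Rightarrow> 'a set \<Rightarrow> 'a trio \<Rightarrow> bool" where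
  "pure_beat_rel G H T \<longleftrightarrow> proper_subgroup_of H G \<and> finite H \<and> trio G T \<and>
     (\<exists>A B C. similar G T (A, B, C) \<and> A = H \<and> stabilizer G B = H \<and>
        C = neg_sum_compl G A B \<and> C \<noteq> {})"

definition pure_chord_rel :: "'a::ab_group_add set \<Rightarrow> 'a set \<Rightarrow> 'a trio \<Rightarrow> bool" where
  "pure_chord_rel G H T \<longleftrightarrow> proper_subgroup_of H G \<and> finite H \<and> trio G T \<and>
     (\<exists>R A B C. generates_quotient G H R \<and> similar G T (A, B, C) \<and>
        nontrivial_R_sequence G H R A \<and> nontrivial_R_sequence G H R B \<and>
        C = neg_sum_compl G A B \<and> \<not> (\<exists>Q\<in>cosets G H. C \<subseteq> Q))"

definition pure_beat :: "'a::ab_group_add set \<Rightarrow> 'a trio \<Rightarrow> bool" where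
  "pure_beat G T \<longleftrightarrow> (\<exists>H. pure_beat_rel G H T)"

definition pure_chord :: "'a::ab_group_add set \<Rightarrow> 'a trio \<Rightarrow> bool" where
  "pure_chord G T \<longleftrightarrow> (\<exists>H. pure_chord_rel G H T)"

text \<open>\<open>impure_beat G H T T'\<close> means that \<open>T\<close>, a trio in \<open>G\<close>, is an impure beat relative to \<open>H\<close>
  and \<open>T'\<close> is a continuation of it; likewise for \<open>impure_chord\<close>. In the former, \<open>H\<close> may be
  infinite.\<close>

definition impure_beat ::
    "'a::ab_group_add set \<Rightarrow> 'a set \<Rightarrow> 'a trio \<Rightarrow> 'a trio \<Rightarrow> bool" where
  "impure_beat G H T T' \<longleftrightarrow> proper_subgroup_of H G \<and> trio G T \<and>
     (\<exists>A B C. similar G T (A, B, C) \<and> is_closure G A H \<and> stable H (B - H) \<and>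
        C - H = neg_sum_compl G A B - H \<and> B \<inter> H \<noteq> {} \<and> C \<inter> H \<noteq> {} \<and>
        T' = (A, B \<inter> H, C \<inter> H))"

definition impure_chord ::
    "'a::ab_group_add set \<Rightarrow> 'a set \<Rightarrow> 'a trio \<Rightarrow> 'a trio \<Rightarrow> bool" where
  "impure_chord G H T T' \<longleftrightarrow> proper_subgroup_of H G \<and> finite H \<and> trio G T \<and>
     (\<exists>R A B C. generates_quotient G H R \<and> similar G T (A, B, C) \<and>
        nontrivial_basic_R_sequence G H R (H \<union> A) \<and>
        nontrivial_basic_R_sequence G H R (H \<union> B) \<and>
        C - H = neg_sum_compl G A B - H \<and> C - H \<noteq> {} \<and>
        A \<inter> H \<noteq> {} \<and> B \<inter> H \<noteq> {} \<and> C \<inter> H \<noteq> {} \<and>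
        T' = (A \<inter> H, B \<inter> H, C \<inter> H))"

end

theory Submission
  imports Defs
begin

text \<open>
  Passing to a similar trio, \<open>A\<close> and \<open>B\<close> are finite and \<open>C\<close> is the complement of \<open>-D\<close>, where
  \<open>D = A + B\<close>. Kneser's theorem shows that \<open>|A| + |B| = |D| + |H|\<close> for the common stabilizer \<open>H\<close> of
  \<open>A\<close>, \<open>B\<close> and \<open>D\<close>. If one of the three sets lies in a proper coset, then at most one coset of its
  closure meets the other sets partially, since two of them would cost too much in Kneser's
  inequality; this is a beat. Otherwise fix \<open>D\<close> and replace \<open>(A, B)\<close> by Dyson transforms
  \<open>(A \<union> (e + B), B \<inter> (A - e))\<close>. If such a transform has a larger stabilizer \<open>K\<close>, then \<open>D\<close> is
  \<open>K\<close>-periodic outside a single \<open>K\<close>-coset; if none has, the argument of Vosper reduces \<open>B\<close> to two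
  \<open>H\<close>-cosets, so that all three sets are progressions of cosets, a pure chord. In the periodic case
  take \<open>K\<close> as large as possible. Then \<open>A\<close>, \<open>B\<close> and \<open>D\<close> are \<open>K\<close>-periodic outside one coset each, and
  by maximality of \<open>K\<close> the sets \<open>A + K\<close> and \<open>B + K\<close> are progressions. The exceptional coset of
  \<open>D + K\<close> has a unique representation as a sum, so it is the sum of two ends: an impure chord.
\<close>

section \<open>Subgroups, cosets and periods\<close>

text \<open>The symmetric deficiency of a trio is traded for a pair of finite sets.
  \<open>critical_pair\<close> mentions no ambient group and amounts to equality in Kneser's
  theorem, so it can be carried through translations, transforms, filling by a subgroup and
  restriction to a coset. Two obstacles shape the proof. A Dyson transform controls
  \<open>A + B\<close> but destroys the summands; so structure is first found for the sum, as
  \<open>A' \<union> (d +o A')\<close>, and brought back to \<open>A\<close> and \<open>B\<close> by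
  another use of Kneser's theorem. And filling the exceptional coset of the sum may push its
  complement into a proper coset, where the chord argument breaks down; this case gets its own
  treatment, in which the complement turns out to be a single coset. The recursion cannot rest on
  the group alone: the closure in a beat may be infinite. In infinite groups the sizes of
  \<open>A\<close> and \<open>B\<close> decrease, supplemented by a count of non-generating sets.
  Rotating the third set into the pair may enlarge the sizes, but it happens only in finite groups,
  where the order of the group decreases.\<close>

lemma in_translate: "y \<in> x +o S \<longleftrightarrow> y - x \<in> (S::'a::ab_group_add set)"
  by (auto simp: elt_set_plus_def intro: bexI[of _ "y - x"])

lemma card_translate [simp]: "card (x +o S) = card (S::'a::ab_group_add set)"
proof -
  have "x +o S = (+) x ` S" by (auto simp: elt_set_plus_def)
  then show ?thesis by (simp add: card_image)
qed

lemma finite_translate [simp]: "finite (x +o S) \<longleftrightarrow> finite (S::'a::ab_group_add set)"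
proof -
  have "x +o S = (+) x ` S" by (auto simp: elt_set_plus_def)
  then show ?thesis by (simp add: finite_image_iff)
qed

lemma subgroupD:
  assumes "add_subgroup H"
  shows "0 \<in> H" "x \<in> H \<Longrightarrow> y \<in> H \<Longrightarrow> x + y \<in> H" "x \<in> H \<Longrightarrow> - x \<in> H"
    "x \<in> H \<Longrightarrow> y \<in> H \<Longrightarrow> x - y \<in> H"
proof -
  show "0 \<in> H" and p: "\<And>x y. x \<in> H \<Longrightarrow> y \<in> H \<Longrightarrow> x + y \<in> H"
    and n: "\<And>x. x \<in> H \<Longrightarrow> - x \<in> H"
    using assms unfolding add_subgroup_def by auto
  show "x \<in> H \<Longrightarrow> y \<in> H \<Longrightarrow> x - y \<in> H" using p[of x "- y"] n[of y] by simp
qed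

lemma subgroup_diff_comm:
  assumes "add_subgroup H"
  shows "x - y \<in> H \<longleftrightarrow> y - x \<in> H"
  using subgroupD(3)[OF assms, of "x - y"] subgroupD(3)[OF assms, of "y - x"] by auto

lemma subgroup_diff_trans:
  assumes "add_subgroup H" "x - y \<in> H" "y - z \<in> H"
  shows "x - z \<in> H"
  using subgroupD(2)[OF assms] by simp

lemma subgroup_add_iff:
  assumes "add_subgroup H" "y \<in> H"
  shows "x + y \<in> H \<longleftrightarrow> x \<in> H" "y + x \<in> H \<longleftrightarrow> x \<in> H"
proof -
  show "x + y \<in> H \<longleftrightarrow> x \<in> H"
    using subgroupD(2)[OF assms(1), of x y] subgroupD(4)[OF assms(1), of "x + y" y] assms(2) by auto
  then show "y + x \<in> H \<longleftrightarrow> x \<in> H" by (simp add: add.commute)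
qed

definition periodic :: "'a::ab_group_add set \<Rightarrow> 'a set \<Rightarrow> bool" where
  "periodic K S \<longleftrightarrow> (\<forall>x\<in>S. \<forall>k\<in>K. x + k \<in> S)"

text \<open>Unlike \<open>stabilizer\<close>, taken in the whole type, so that it does not change
  with the ambient group.\<close>

definition stab :: "'a::ab_group_add set \<Rightarrow> 'a set" where
  "stab S = {g. g +o S = S}"

lemma coset_eq_iff:
  assumes "add_subgroup K"
  shows "x +o K = y +o K \<longleftrightarrow> x - y \<in> K"
proof
  assume "x +o K = y +o K"
  moreover have "x \<in> x +o K" using subgroupD(1)[OF assms] by (simp add: in_translate)
  ultimately show "x - y \<in> K" by (simp add: in_translate)
next
  assume *: "x - y \<in> K"
  have "z - x \<in> K \<longleftrightarrow> z - y \<in> K" for z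
    using subgroup_diff_trans[OF assms, of z x y] subgroup_diff_trans[OF assms, of z y x] * 
      subgroup_diff_comm[OF assms, of x y] by auto
  then show "x +o K = y +o K" by (auto simp: in_translate)
qed

lemma coset_disjoint:
  assumes "add_subgroup K" "x - y \<notin> K"
  shows "(x +o K) \<inter> (y +o K) = {}"
proof -
  have False if "z - x \<in> K" "z - y \<in> K" for z
    using subgroup_diff_trans[OF assms(1), of x z y] subgroup_diff_comm[OF assms(1), of z x] that assms(2)
    by simp
  then show ?thesis by (auto simp: in_translate)
qed

lemma translate_uminus [simp]: "- x +o (x +o S) = S" "x +o (- x +o S) = (S::'a::ab_group_add set)"
  by (simp_all add: set_plus_rearrange2)

lemma translate_eq_iff [simp]: "x +o U = x +o V \<longleftrightarrow> U = (V::'a::ab_group_add set)"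
  by (metis translate_uminus(1))

lemma add_subgroup_stab: "add_subgroup (stab S)"
  unfolding add_subgroup_def
proof (intro conjI ballI)
  show "0 \<in> stab S" by (simp add: stab_def)
  show "- x \<in> stab S" if "x \<in> stab S" for x
    using that translate_uminus(1)[of x S] by (simp add: stab_def)
  show "x + y \<in> stab S" if "x \<in> stab S" "y \<in> stab S" for x y
    using that set_plus_rearrange2[of x y S] by (simp add: stab_def)
qed

lemma periodic_stab: "periodic (stab S) S"
  unfolding periodic_def stab_def
proof (intro ballI)
  fix x k assume "x \<in> S" "k \<in> {g. g +o S = S}"
  then have "k + x \<in> S" by blast
  then show "x + k \<in> S" by (simp add: add.commute)
qed

text \<open>A translate of a finite set has the same size, so inclusion already gives
  equality.\<close>

lemma in_stab_iff:
  assumes "finite S"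
  shows "g \<in> stab S \<longleftrightarrow> (\<forall>x\<in>S. x + g \<in> S)"
proof
  assume "g \<in> stab S"
  then show "\<forall>x\<in>S. x + g \<in> S" using periodic_stab[of S] by (auto simp: periodic_def)
next
  assume *: "\<forall>x\<in>S. x + g \<in> S"
  have "g +o S \<subseteq> S"
  proof
    fix y assume "y \<in> g +o S"
    then have "y - g \<in> S" by (simp add: in_translate)
    then have "(y - g) + g \<in> S" using * by blast
    then show "y \<in> S" by simp
  qed
  then have "g +o S = S" using card_subset_eq[OF assms] by simp
  then show "g \<in> stab S" by (simp add: stab_def)
qed

lemma periodic_imp_subset_stab:
  "finite S \<Longrightarrow> periodic K S \<Longrightarrow> K \<subseteq> stab S"
  by (auto simp: in_stab_iff periodic_def)

lemma stab_translate [simp]: "stab (x +o S) = stab S"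
proof -
  have "g +o (x +o S) = x +o (g +o S)" for g
    by (simp add: set_plus_rearrange2 add.commute)
  then show ?thesis by (simp add: stab_def)
qed

text \<open>A period of \<open>S\<close> is a difference of two elements of \<open>S\<close>, and
  such differences lie in \<open>K\<close>.\<close>

lemma stab_subset_coset:
  assumes "add_subgroup K" "S \<subseteq> x +o K" "S \<noteq> {}"
  shows "stab S \<subseteq> K"
proof
  fix g assume "g \<in> stab S"
  obtain y where "y \<in> S" using assms(3) by auto
  then have "y + g \<in> S" using \<open>g \<in> stab S\<close> periodic_stab by (auto simp: periodic_def)
  then have "y + g - x \<in> K" "y - x \<in> K" using \<open>y \<in> S\<close> assms(2) by (auto simp: in_translate)
  then have "(y + g - x) - (y - x) \<in> K" using subgroupD(4)[OF assms(1)] by blast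
  then show "g \<in> K" by simp
qed

lemma periodic_coset_subset:
  assumes "periodic K S" "y \<in> S"
  shows "y +o K \<subseteq> S"
proof
  fix z assume "z \<in> y +o K"
  then have "z - y \<in> K" by (simp add: in_translate)
  then have "y + (z - y) \<in> S" using assms unfolding periodic_def by blast
  then show "z \<in> S" by simp
qed

lemma finite_stab:
  assumes "finite S" "S \<noteq> {}"
  shows "finite (stab S)"
proof -
  obtain y where "y \<in> S" using assms(2) by auto
  then have "y +o stab S \<subseteq> S" by (intro periodic_coset_subset[OF periodic_stab])
  then have "finite (y +o stab S)" using assms(1) by (rule finite_subset)
  then show ?thesis by simp
qed

lemma card_le_periodic:
  assumes "periodic K S" "S \<noteq> {}" "finite S"
  shows "card K \<le> card S" "finite K"
proof -
  obtain y where "y \<in> S" using assms by auto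
  then have *: "y +o K \<subseteq> S" using periodic_coset_subset[OF assms(1)] by auto
  show "card K \<le> card S" using card_mono[OF assms(3) *] by simp
  show "finite K" using finite_subset[OF * assms(3)] by simp
qed

lemma card_dvd_periodic:
  assumes "add_subgroup K" "periodic K S" "finite S"
  shows "card K dvd card S"
proof (cases "S = {}")
  case False
  let ?C = "(\<lambda>x. x +o K) ` S"
  have "x \<in> x +o K" for x using subgroupD(1)[OF assms(1)] by (simp add: in_translate)
  then have U: "\<Union> ?C = S"
    using periodic_coset_subset[OF assms(2)] by blast
  have "card K * card ?C = card (\<Union> ?C)"
  proof (rule card_partition)
    show "finite ?C" "finite (\<Union> ?C)" using assms(3) U by auto
    show "c \<in> ?C \<Longrightarrow> card c = card K" for c by auto
    fix c1 c2 assume "c1 \<in> ?C" "c2 \<in> ?C" and ne: "c1 \<noteq> c2"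
    then obtain x y where xy: "c1 = x +o K" "c2 = y +o K" by blast
    with ne have "x - y \<notin> K" using coset_eq_iff[OF assms(1)] by simp
    with xy show "c1 \<inter> c2 = {}" using coset_disjoint[OF assms(1)] by simp
  qed
  then show ?thesis by (metis U dvd_triv_left)
qed simp

lemma subset_plus_subgroup: "add_subgroup K \<Longrightarrow> A \<subseteq> A + K"
  using set_zero_plus2[of K A] subgroupD(1)[of K] by (simp add: add.commute)

lemma periodic_subgroup: "add_subgroup K \<Longrightarrow> periodic K K"
  by (simp add: periodic_def subgroupD)

lemma plus_subgroup_eq: "add_subgroup K \<Longrightarrow> periodic K A \<Longrightarrow> A + K = A"
  using subset_plus_subgroup[of K A] by (auto simp: periodic_def elim!: set_plus_elim)

lemma periodic_plus: "periodic K B \<Longrightarrow> periodic K (A + B)"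
  unfolding periodic_def
proof (intro ballI)
  fix x k assume *: "\<forall>x\<in>B. \<forall>k\<in>K. x + k \<in> B" and "x \<in> A + B" "k \<in> K"
  then obtain a b where "a \<in> A" "b \<in> B" "x = a + b" by (auto elim: set_plus_elim)
  with * \<open>k \<in> K\<close> show "x + k \<in> A + B" by (auto simp: add.assoc)
qed

lemma periodic_plus_left: "periodic K A \<Longrightarrow> periodic K (A + B)"
  using periodic_plus[of K A B] by (simp add: add.commute)

lemma periodic_plus_subgroup: "add_subgroup K \<Longrightarrow> periodic K (A + K)"
  by (rule periodic_plus[OF periodic_subgroup])

lemma finite_sumset: "finite A \<Longrightarrow> finite B \<Longrightarrow> finite (A + (B::'a::ab_group_add set))"
  by (rule finite_set_plus)

lemma card_le_sumset_left:
  assumes "finite A" "finite (B::'a::ab_group_add set)" "B \<noteq> {}"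
  shows "card A \<le> card (A + B)"
proof -
  obtain b where "b \<in> B" using assms by auto
  then have "b +o A \<subseteq> A + B" by (rule set_plus_mono4)
  from card_mono[OF finite_sumset[OF assms(1,2)] this] show ?thesis by simp
qed

lemma card_le_sumset_right:
  assumes "finite A" "finite (B::'a::ab_group_add set)" "A \<noteq> {}"
  shows "card B \<le> card (A + B)"
  using card_le_sumset_left[of B A] assms by (simp add: add.commute)

section \<open>Kneser's theorem\<close>

lemma periodicD: "s \<in> C \<Longrightarrow> g \<in> K \<Longrightarrow> periodic K C \<Longrightarrow> s + g \<in> C"
  unfolding periodic_def by blast

lemma periodicD_rev:
  assumes "s + g \<in> C" "g \<in> K" "periodic K C" "add_subgroup K"
  shows "s \<in> C"
  using periodicD[OF assms(1) subgroupD(3)[OF assms(4,2)] assms(3)] by simp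

text \<open>If \<open>u + v = u' + v'\<close>, then \<open>u - u' = v' - v\<close> lies in
  \<open>H1 \<inter> H2\<close>. So each fibre of addition on \<open>U \<times> V\<close> has at
  most \<open>card (H1 \<inter> H2)\<close> members.\<close>

lemma card_sumset_transversal:
  assumes "add_subgroup H1" "add_subgroup H2" "finite H1" "finite H2" "U \<subseteq> H2" "V \<subseteq> H1"
  shows "card U * card V \<le> card (U + V) * card (H1 \<inter> H2)"
proof -
  \<comment> \<open>A fixed first summand for each sum; \<open>f\<close> records the sum and the
    offset from this choice.\<close>
  define r where "r s = (SOME u. u \<in> U \<and> s - u \<in> V)" for s
  have r: "r (u + v) \<in> U \<and> (u + v) - r (u + v) \<in> V" if "u \<in> U" "v \<in> V" for u v
    unfolding r_def by (rule someI[of _ u]) (use that in auto)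
  define f where "f = (\<lambda>(u, v). (u + v, u - r (u + v)))"
  have fin: "finite U" "finite V" using assms finite_subset by blast+
  have "inj_on f (U \<times> V)"
    by (auto simp: inj_on_def f_def)
  moreover have "f ` (U \<times> V) \<subseteq> (U + V) \<times> (H1 \<inter> H2)"
  proof clarify
    fix s w u v assume *: "(s, w) = f (u, v)" "u \<in> U" "v \<in> V"
    then have s: "s = u + v" and w: "w = u - r (u + v)" by (auto simp: f_def)
    have "w \<in> H2" using subgroupD(4)[OF assms(2)] r[OF *(2,3)] * assms(5) w by blast
    moreover have "w \<in> H1"
    proof -
      have "w = ((u + v) - r (u + v)) - v" using w by simp
      then show ?thesis using subgroupD(4)[OF assms(1)] r[OF *(2,3)] *(3) assms(6) by blast
    qed
    ultimately show "s \<in> U + V \<and> w \<in> H1 \<inter> H2" using s * by auto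
  qed
  moreover have "finite ((U + V) \<times> (H1 \<inter> H2))" using fin finite_sumset assms(3) by blast
  ultimately have "card (U \<times> V) \<le> card ((U + V) \<times> (H1 \<inter> H2))" by (rule card_inj_on_le)
  then show ?thesis by (simp add: card_cartesian_product)
qed

text \<open>For \<open>y \<in> H2\<close> and \<open>z \<in> H1\<close>, membership of
  \<open>x + y + z\<close> in \<open>C1\<close> depends only on \<open>y\<close>, and in
  \<open>C2\<close> only on \<open>z\<close>: near \<open>x\<close> the two sets are unions of rows
  and of columns of a grid. The differences \<open>C2 - C1\<close> and \<open>C1 - C2\<close>
  contain rectangles, whose sizes are bounded below by the previous lemma. The asymmetric conclusion
  is made to be applied in both orders, where it becomes a contradiction.\<close>

lemma two_period_grid:
  assumes H: "add_subgroup H1" "add_subgroup H2" "finite H1" "finite H2"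
    and per: "periodic H1 C1" "periodic H2 C2"
    and fin: "finite C1" "finite C2"
    and x: "x \<in> C2" "x \<notin> C1"
    and c21: "card (C2 - C1) + card (H1 \<inter> H2) < card H1"
    and c12: "card (C1 - C2) + card (H1 \<inter> H2) < card H2"
  shows "card H2 < card H1"
proof -
  define Y where "Y = {y \<in> H2. x + y \<notin> C1}"
  define Z where "Z = {z \<in> H1. x + z \<notin> C2}"
  let ?I = "H1 \<inter> H2"
  have I: "0 \<in> ?I" using subgroupD(1) H by auto
  have finI: "finite ?I" using H by auto
  note fwd = periodicD and rev = periodicD_rev
  have "x +o (Y + (H1 - Z)) \<subseteq> C2 - C1"
  proof
    fix w assume "w \<in> x +o (Y + (H1 - Z))"
    then obtain y z where w: "w = x + (y + z)" "y \<in> Y" "z \<in> H1 - Z"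
      by (auto simp: elt_set_plus_def elim!: set_plus_elim)
    have "x + z + y \<in> C2" using w fwd[of "x + z" C2 y H2] per by (auto simp: Y_def Z_def)
    moreover have "x + y + z \<notin> C1" using w rev[of "x + y" z C1 H1] per H by (auto simp: Y_def Z_def)
    ultimately show "w \<in> C2 - C1" using w(1) by (simp add: ac_simps)
  qed
  from card_mono[OF _ this] have P1: "card (Y + (H1 - Z)) \<le> card (C2 - C1)" using fin by simp
  have "x +o ((H2 - Y) + Z) \<subseteq> C1 - C2"
  proof
    fix w assume "w \<in> x +o ((H2 - Y) + Z)"
    then obtain y z where w: "w = x + (y + z)" "y \<in> H2 - Y" "z \<in> Z"
      by (auto simp: elt_set_plus_def elim!: set_plus_elim)
    have "x + y + z \<in> C1" using w fwd[of "x + y" C1 z H1] per by (auto simp: Y_def Z_def)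
    moreover have "x + z + y \<notin> C2" using w rev[of "x + z" y C2 H2] per H by (auto simp: Y_def Z_def)
    ultimately show "w \<in> C1 - C2" using w(1) by (simp add: ac_simps)
  qed
  from card_mono[OF _ this] have P2: "card ((H2 - Y) + Z) \<le> card (C1 - C2)" using fin by simp
  have finYZ: "finite Y" "finite Z" "Y \<subseteq> H2" "Z \<subseteq> H1" using H by (auto simp: Y_def Z_def)
  define h a c r b where "h = card ?I" and "a = card Y" and "c = card (H1 - Z)"
    and "r = card (H2 - Y)" and "b = card Z"
  have h: "h \<ge> 1" using card_gt_0_iff[of ?I] I finI unfolding h_def by force
  have "?I \<subseteq> Y" using rev[OF _ _ per(1) H(1), of x] x by (auto simp: Y_def)
  then have a: "h \<le> a" unfolding h_def a_def using card_mono finYZ(1) by blast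
  have "?I \<subseteq> H1 - Z" using fwd[OF _ _ per(2), of x] x by (auto simp: Z_def)
  then have c: "h \<le> c" unfolding h_def c_def using card_mono H(3) by blast
  have r: "h \<le> r" if "r \<noteq> 0"
  proof -
    from that have "H2 - Y \<noteq> {}" unfolding r_def by force
    then obtain y where y: "y \<in> H2 - Y" by blast
    have "y +o ?I \<subseteq> H2 - Y"
    proof
      fix w assume "w \<in> y +o ?I"
      then obtain i where i: "w = y + i" "i \<in> H1" "i \<in> H2" by (auto simp: elt_set_plus_def)
      have "x + y + i \<in> C1" using fwd[OF _ i(2) per(1)] y by (auto simp: Y_def)
      then show "w \<in> H2 - Y" using i y subgroupD(2)[OF H(2)] by (auto simp: Y_def ac_simps)
    qed
    from card_mono[OF _ this] show ?thesis using H(4) by (simp add: h_def r_def)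
  qed
  have e1: "card H1 = b + c" unfolding b_def c_def using finYZ H(3) card_Diff_subset[of Z H1]
    card_mono[of H1 Z] by linarith
  have e2: "card H2 = a + r" unfolding a_def r_def using finYZ H(4) card_Diff_subset[of Y H2]
    card_mono[of H2 Y] by linarith
  have "a * c \<le> card (Y + (H1 - Z)) * h"
    unfolding a_def c_def h_def by (rule card_sumset_transversal[OF H]) (use finYZ in auto)
  also have "\<dots> \<le> card (C2 - C1) * h" using P1 by simp
  finally have p1: "a * c \<le> card (C2 - C1) * h" .
  have "r * b \<le> card ((H2 - Y) + Z) * h"
    unfolding r_def b_def h_def by (rule card_sumset_transversal[OF H]) (use finYZ in auto)
  also have "\<dots> \<le> card (C1 - C2) * h" using P2 by simp
  finally have p2: "r * b \<le> card (C1 - C2) * h" .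
  show ?thesis
  proof (cases "r = 0")
    case True
    \<comment> \<open>Here \<open>C1\<close> misses all of \<open>x +o H2\<close>, so
      \<open>a\<close> is the size of \<open>H2\<close>.\<close>
    have "a * h \<le> card (C2 - C1) * h" using p1 mult_le_mono2[OF c, of a] by linarith
    then have "a \<le> card (C2 - C1)" using h by simp
    then show ?thesis using True e2 c21 by simp
  next
    case False
    \<comment> \<open>Integers allow the subtractions. The two bounds contradict each other: with
      \<open>C \<ge> N\<close> the first forces \<open>A < B\<close>, and with
      \<open>R \<ge> N\<close> the second then forces \<open>B < A\<close>.\<close>
    define A B C R N where "A = int a" and "B = int b" and "C = int c" and "R = int r" and "N = int h"
    have q1: "A * C < (C + B - N) * N"
    proof -
      have "int (card (C2 - C1)) < C + B - N" using c21 e1 by (simp add: C_def B_def N_def h_def)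
      then have "int (card (C2 - C1)) * N < (C + B - N) * N" using h by (simp add: N_def)
      moreover have "A * C \<le> int (card (C2 - C1)) * N" using p1
        by (metis A_def C_def N_def of_nat_mult of_nat_le_iff)
      ultimately show ?thesis by linarith
    qed
    have q2: "R * B < (R + A - N) * N"
    proof -
      have "int (card (C1 - C2)) < R + A - N" using c12 e2 by (simp add: R_def A_def N_def h_def)
      then have "int (card (C1 - C2)) * N < (R + A - N) * N" using h by (simp add: N_def)
      moreover have "R * B \<le> int (card (C1 - C2)) * N" using p2
        by (metis R_def B_def N_def of_nat_mult of_nat_le_iff)
      ultimately show ?thesis by linarith
    qed
    have n: "N > 0" "A \<ge> N" "C \<ge> N" "R \<ge> N" using h a c r False by (auto simp: N_def A_def C_def R_def)
    have "C * (A - N) < N * (B - N)" using q1 by (simp add: algebra_simps)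
    moreover have "N * (A - N) \<le> C * (A - N)" using n by (intro mult_right_mono) auto
    ultimately have "N * (A - N) < N * (B - N)" by linarith
    then have AB: "A < B" using n by simp
    have "R * (B - N) < N * (A - N)" using q2 by (simp add: algebra_simps)
    moreover have "N * (B - N) \<le> R * (B - N)" using n AB by (intro mult_right_mono) auto
    ultimately have "N * (B - N) < N * (A - N)" by linarith
    then have "B < A" using n by simp
    with AB show ?thesis by simp
  qed
qed

text \<open>If the bound failed for the union, both differences \<open>C2 - C1\<close> and
  \<open>C1 - C2\<close> would be small compared with the stabilizers, and the grid argument would
  make each stabilizer smaller than the other.\<close>

lemma card_stab_Un:
  assumes fin: "finite C1" "finite C2" and ne: "C1 \<noteq> {}" "C2 \<noteq> {}"
    and n: "n \<le> card C1 + card (stab C1)" "n \<le> card C2 + card (stab C2)"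
  shows "n \<le> card (C1 \<union> C2) + card (stab (C1 \<union> C2))"
proof (rule ccontr)
  assume neg: "\<not> ?thesis"
  let ?C = "C1 \<union> C2" and ?H1 = "stab C1" and ?H2 = "stab C2"
  have sub: "\<not> C1 \<subseteq> C2" "\<not> C2 \<subseteq> C1"
    using neg n Un_absorb1[of C1 C2] Un_absorb2[of C2 C1] by auto
  have H: "add_subgroup ?H1" "add_subgroup ?H2" "finite ?H1" "finite ?H2"
    using fin ne by (auto simp: add_subgroup_stab finite_stab)
  have "?H1 \<inter> ?H2 \<subseteq> stab ?C" using fin by (auto simp: in_stab_iff)
  then have i: "card (?H1 \<inter> ?H2) \<le> card (stab ?C)"
    using fin ne by (intro card_mono finite_stab) auto
  have "card ?C = card C1 + card (C2 - C1)"
    using fin card_Un_disjoint[of C1 "C2 - C1"] by simp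
  then have c21: "card (C2 - C1) + card (?H1 \<inter> ?H2) < card ?H1" using neg n i by linarith
  have "card ?C = card C2 + card (C1 - C2)"
    using fin card_Un_disjoint[of C2 "C1 - C2"] by (simp add: Un_commute)
  then have c12: "card (C1 - C2) + card (?H1 \<inter> ?H2) < card ?H2" using neg n i by linarith
  obtain x y where "x \<in> C2" "x \<notin> C1" "y \<in> C1" "y \<notin> C2" using sub by auto
  then have "card ?H2 < card ?H1" "card ?H1 < card ?H2"
    using two_period_grid[OF H periodic_stab periodic_stab fin _ _ c21 c12, of x]
      two_period_grid[OF H(2,1,4,3) periodic_stab periodic_stab fin(2,1), of y] c12 c21
    by (auto simp: Int_commute)
  then show False by simp
qed

lemma card_stab_UNION:
  assumes "finite I" "I \<noteq> {}" "\<And>i. i \<in> I \<Longrightarrow> finite (S i) \<and> S i \<noteq> {}"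
    and "\<And>i. i \<in> I \<Longrightarrow> n \<le> card (S i) + card (stab (S i))"
  shows "n \<le> card (\<Union>i\<in>I. S i) + card (stab (\<Union>i\<in>I. S i))"
  using assms
proof (induction I rule: finite_ne_induct)
  case (insert i I)
  have "n \<le> card (S i \<union> (\<Union>j\<in>I. S j)) + card (stab (S i \<union> (\<Union>j\<in>I. S j)))"
    using insert by (intro card_stab_Un) auto
  then show ?case by simp
qed auto

text \<open>Only the one representation \<open>a + b\<close> has to survive. A Dyson transform with
  shift \<open>a' - b\<close> keeps \<open>a\<close> and \<open>b\<close>, preserves
  \<open>card A + card B\<close> and does not enlarge the sum, so it may be used as long as it
  shrinks \<open>B\<close>. When none does, every translate \<open>(a' - b) +o B\<close> lies in
  \<open>A\<close>; then \<open>- b +o B\<close> consists of periods of \<open>A\<close>, and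
  \<open>b +o A\<close> serves as \<open>C\<close>.\<close>

lemma kneser_pointwise:
  assumes "finite A" "finite B" "a \<in> A" "b \<in> B"
  shows "\<exists>C. C \<subseteq> A + B \<and> a + b \<in> C \<and> card A + card B \<le> card C + card (stab C)"
  using assms
proof (induction "card B" arbitrary: A B rule: less_induct)
  case less
  show ?case
  proof (cases "\<exists>a'\<in>A. \<not> (a' - b) +o B \<subseteq> A")
    case False
    then have *: "a' - b + y \<in> A" if "a' \<in> A" "y \<in> B" for a' y using that by blast
    have "- b +o B \<subseteq> stab (b +o A)"
    proof
      fix z assume "z \<in> - b +o B"
      then have "z + b \<in> B" by (simp add: in_translate)
      then have "x + z \<in> A" if "x \<in> A" for x using *[OF that, of "z + b"] by (simp add: algebra_simps)
      then show "z \<in> stab (b +o A)" using less.prems(1) by (simp add: in_stab_iff[of A])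
    qed
    moreover have "finite (stab (b +o A))" using less.prems by (intro finite_stab) auto
    ultimately have "card (- b +o B) \<le> card (stab (b +o A))" by (intro card_mono)
    then have "card B \<le> card (stab (b +o A))" by simp
    moreover have "b +o A \<subseteq> A + B" using less.prems(4) by (rule set_plus_mono4)
    ultimately show ?thesis using less.prems(3)
      by (intro exI[of _ "b +o A"]) (auto simp: in_translate)
  next
    case True
    then obtain a' where a': "a' \<in> A" "\<not> (a' - b) +o B \<subseteq> A" by blast
    define e where "e = a' - b"
    define A' where "A' = A \<union> (e +o B)"
    define B' where "B' = B \<inter> (- e +o A)"
    have bB': "b \<in> B'" using less.prems a' by (simp add: B'_def in_translate e_def)
    have "B' \<subset> B"
    proof -
      obtain y where "y \<in> B" "e + y \<notin> A" using a'(2) by (auto simp: e_def elt_set_plus_def)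
      then have "y \<in> B - B'" by (simp add: B'_def in_translate add.commute)
      moreover have "B' \<subseteq> B" by (simp add: B'_def)
      ultimately show ?thesis by blast
    qed
    then have lt: "card B' < card B" using less.prems(2) psubset_card_mono by blast
    have fin: "finite A'" "finite B'" using less.prems by (auto simp: A'_def B'_def)
    obtain C where C: "C \<subseteq> A' + B'" "a + b \<in> C" "card A' + card B' \<le> card C + card (stab C)"
      using less.hyps[OF lt fin _ bB'] less.prems(3) by (auto simp: A'_def)
    have "A' + B' \<subseteq> A + B"
    proof
      fix w assume "w \<in> A' + B'"
      then obtain x y where xy: "w = x + y" "x \<in> A'" "y \<in> B'" by (auto elim: set_plus_elim)
      have y: "y \<in> B" "y + e \<in> A" using xy(3) by (simp_all add: B'_def in_translate)
      show "w \<in> A + B"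
      proof (cases "x \<in> A")
        case False
        then have "x - e \<in> B" using xy(2) by (simp add: A'_def in_translate)
        with y(2) have "(y + e) + (x - e) \<in> A + B" by (rule set_plus_intro)
        then show ?thesis using xy by (simp add: algebra_simps)
      qed (use xy y set_plus_intro in auto)
    qed
    moreover have "card A' + card B' = card A + card B"
    proof -
      have "card B' = card (A \<inter> (e +o B))"
      proof -
        have "z \<in> e +o B' \<longleftrightarrow> z \<in> A \<inter> (e +o B)" for z by (auto simp: B'_def in_translate)
        then have "e +o B' = A \<inter> (e +o B)" by (rule set_eqI)
        then show ?thesis by (metis card_translate)
      qed
      then show ?thesis using card_Un_Int[of A "e +o B"] less.prems by (simp add: A'_def)
    qed
    ultimately show ?thesis using C by (intro exI[of _ C]) auto
  qed
qed

text \<open>The pointwise sets cover \<open>A + B\<close>, and their union inherits the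
  bound.\<close>

theorem kneser:
  assumes "finite A" "finite B" "A \<noteq> {}" "B \<noteq> {}"
  shows "card A + card B \<le> card (A + B) + card (stab (A + B))"
proof -
  have "\<forall>w. \<exists>C. w \<in> A + B \<longrightarrow> C \<subseteq> A + B \<and> w \<in> C \<and> card A + card B \<le> card C + card (stab C)"
  proof
    fix w
    show "\<exists>C. w \<in> A + B \<longrightarrow> C \<subseteq> A + B \<and> w \<in> C \<and> card A + card B \<le> card C + card (stab C)"
    proof (cases "w \<in> A + B")
      case True
      then obtain a b where "w = a + b" "a \<in> A" "b \<in> B" by (auto elim: set_plus_elim)
      then show ?thesis using kneser_pointwise[OF assms(1,2)] by auto
    qed auto
  qed
  then obtain S where S: "\<And>w. w \<in> A + B \<Longrightarrow> S w \<subseteq> A + B \<and> w \<in> S w \<and> card A + card B \<le> card (S w) + card (stab (S w))"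
    by metis
  have fin: "finite (A + B)" using assms finite_sumset by blast
  have "(\<Union>w\<in>A+B. S w) = A + B" using S by blast
  moreover have "A + B \<noteq> {}" using assms by auto
  ultimately show ?thesis
    using card_stab_UNION[OF fin, of S "card A + card B"] S fin finite_subset by (metis empty_iff)
qed

text \<open>Filling a summand by the periods of the sum does not change the sum, so Kneser's bound
  holds for the larger summand too.\<close>

lemma kneser_plus:
  assumes "finite A" "finite B" "A \<noteq> {}" "B \<noteq> {}" "L = stab (A + B)"
  shows "card (A + L) + card B \<le> card (A + B) + card L"
proof -
  have L: "add_subgroup L" "finite L" "L \<noteq> {}" 
    using assms add_subgroup_stab finite_stab[OF finite_sumset[of A B]] subgroupD(1) by auto
  have "periodic L (A + B)" using assms(5) periodic_stab by simp
  then have "(A + L) + B = A + B" using plus_subgroup_eq[OF L(1), of "A + B"]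
    by (simp add: add.assoc add.commute[of L])
  moreover have "finite (A + L)" "A + L \<noteq> {}" using finite_sumset assms L by auto
  ultimately show ?thesis using kneser[of "A + L" B] assms by simp
qed

lemma kneser_plus2:
  assumes "finite A" "finite B" "A \<noteq> {}" "B \<noteq> {}" "L = stab (A + B)"
  shows "card (A + L) + card (B + L) \<le> card (A + B) + card L"
proof -
  have L: "add_subgroup L" "finite L" "L \<noteq> {}" 
    using assms add_subgroup_stab finite_stab[OF finite_sumset[of A B]] subgroupD(1) by auto
  have "periodic L (A + B)" using assms(5) periodic_stab by simp
  then have *: "A + (B + L) = A + B" using plus_subgroup_eq[OF L(1), of "A + B"]
    by (simp add: add.assoc)
  moreover have "finite (B + L)" "B + L \<noteq> {}" using finite_sumset assms L by auto
  ultimately show ?thesis using kneser_plus[of A "B + L" L] assms by simp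
qed

section \<open>Critical pairs\<close>

text \<open>
  Exactly for these pairs, \<open>(A, B, C)\<close> with \<open>C = G - (- (A + B))\<close> is a maximal nontrivial critical
  trio in every group \<open>G\<close> with \<open>A, B \<subseteq> G\<close> and \<open>A + B \<noteq> G\<close>; no ambient group is needed.
\<close>

definition critical_pair :: "'a::ab_group_add set \<Rightarrow> 'a set \<Rightarrow> bool" where
  "critical_pair A B \<longleftrightarrow> finite A \<and> finite B \<and> A \<noteq> {} \<and> B \<noteq> {} \<and> card (A + B) < card A + card B \<and>
     (\<forall>x. x +o B \<subseteq> A + B \<longrightarrow> x \<in> A) \<and> (\<forall>x. x +o A \<subseteq> A + B \<longrightarrow> x \<in> B)"

text \<open>For nonempty \<open>A \<subseteq> G\<close> this says that the closure \<open>[A]\<close> is \<open>G\<close>.\<close>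

definition generating :: "'a::ab_group_add set \<Rightarrow> 'a set \<Rightarrow> bool" where
  "generating G A \<longleftrightarrow> (\<forall>K g. add_subgroup K \<longrightarrow> K \<subset> G \<longrightarrow> \<not> A \<subseteq> g +o K)"

lemma translate_subset_iff: "x +o S \<subseteq> T \<longleftrightarrow> (\<forall>s\<in>S. x + s \<in> (T::'a::ab_group_add set))"
  by (auto simp: elt_set_plus_def)

lemma translate_mono_iff [simp]: "x +o S \<subseteq> x +o T \<longleftrightarrow> S \<subseteq> (T::'a::ab_group_add set)"
  by (auto simp: translate_subset_iff in_translate)

lemma critical_pairD:
  assumes "critical_pair A B"
  shows "finite A" "finite B" "A \<noteq> {}" "B \<noteq> {}" "card (A + B) < card A + card B" "finite (A + B)" "A + B \<noteq> {}"
  using assms finite_sumset[of A B] by (auto simp: critical_pair_def)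

lemma critical_pair_max1: "critical_pair A B \<Longrightarrow> (\<And>b. b \<in> B \<Longrightarrow> x + b \<in> A + B) \<Longrightarrow> x \<in> A"
  by (auto simp: critical_pair_def translate_subset_iff)

lemma critical_pair_max2: "critical_pair A B \<Longrightarrow> (\<And>a. a \<in> A \<Longrightarrow> a + x \<in> A + B) \<Longrightarrow> x \<in> B"
  by (auto simp: critical_pair_def translate_subset_iff add.commute)

lemma critical_pair_commute: "critical_pair A B \<Longrightarrow> critical_pair B A"
  unfolding critical_pair_def by (simp add: add.commute[of A B])

lemma translate_plus: "(g +o A) + (h +o B) = (g + h) +o (A + (B::'a::ab_group_add set))"
  by (rule set_plus_rearrange)

lemma critical_pair_translate:
  assumes "critical_pair A B"
  shows "critical_pair (g +o A) (h +o B)"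
proof -
  have "x \<in> g +o A" if "x +o (h +o B) \<subseteq> (g + h) +o (A + B)" for x
  proof -
    have "(x - g) +o B \<subseteq> A + B"
    proof -
      have "- (g + h) +o (x +o (h +o B)) \<subseteq> - (g + h) +o ((g + h) +o (A + B))" using that by blast
      then show ?thesis by (simp add: set_plus_rearrange2 algebra_simps)
    qed
    then show ?thesis using assms by (simp add: critical_pair_def in_translate)
  qed
  moreover have "x \<in> h +o B" if "x +o (g +o A) \<subseteq> (g + h) +o (A + B)" for x
  proof -
    have "(x - h) +o A \<subseteq> A + B"
    proof -
      have "- (g + h) +o (x +o (g +o A)) \<subseteq> - (g + h) +o ((g + h) +o (A + B))" using that by blast
      then show ?thesis by (simp add: set_plus_rearrange2 algebra_simps)
    qed
    then show ?thesis using assms by (simp add: critical_pair_def in_translate)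
  qed
  moreover have "g +o A \<noteq> {}" "h +o B \<noteq> {}" using critical_pairD[OF assms] by (auto simp: elt_set_plus_def)
  ultimately show ?thesis using critical_pairD[OF assms] 
    unfolding critical_pair_def translate_plus by simp
qed

text \<open>Maximality turns every period of the sum into a period of both summands. So
  \<open>card A + card B - card (A + B)\<close> is a positive multiple of \<open>card H\<close>,
  while Kneser's theorem bounds it by \<open>card H\<close>.\<close>

lemma critical_pair_stab:
  assumes "critical_pair A B" and H: "H = stab (A + B)"
  shows "add_subgroup H" "finite H" "periodic H A" "periodic H B" "periodic H (A + B)"
    "card A + card B = card (A + B) + card H" "stab A = H" "stab B = H" "card H > 0"
proof -
  note c = critical_pairD[OF assms(1)]
  show sub: "add_subgroup H" and fin: "finite H" and per: "periodic H (A + B)"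
    using c H by (auto simp: add_subgroup_stab finite_stab periodic_stab)
  show pos: "card H > 0" using subgroupD(1)[OF sub] fin card_gt_0_iff by blast
  show pA: "periodic H A" unfolding periodic_def
  proof (intro ballI)
    fix x h assume "x \<in> A" "h \<in> H"
    show "x + h \<in> A"
    proof (rule critical_pair_max1[OF assms(1)])
      fix b assume "b \<in> B"
      then have "(x + b) + h \<in> A + B" using \<open>x \<in> A\<close> \<open>h \<in> H\<close> by (intro periodicD[OF _ _ per] set_plus_intro)
      then show "x + h + b \<in> A + B" by (simp add: ac_simps)
    qed
  qed
  show pB: "periodic H B" unfolding periodic_def
  proof (intro ballI)
    fix x h assume "x \<in> B" "h \<in> H"
    show "x + h \<in> B"
    proof (rule critical_pair_max2[OF assms(1)])
      fix b assume "b \<in> A"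
      then have "(b + x) + h \<in> A + B" using \<open>x \<in> B\<close> \<open>h \<in> H\<close> by (intro periodicD[OF _ _ per] set_plus_intro)
      then show "b + (x + h) \<in> A + B" by (simp add: ac_simps)
    qed
  qed
  have "card H dvd card A + card B - card (A + B)"
    using card_dvd_periodic[OF sub] pA pB per c by (simp add: dvd_diff_nat)
  moreover have "card A + card B - card (A + B) > 0" using c by simp
  ultimately have "card H \<le> card A + card B - card (A + B)" using dvd_imp_le by blast
  moreover have "card A + card B \<le> card (A + B) + card H" using kneser[of A B] c H by simp
  ultimately show "card A + card B = card (A + B) + card H" using c(5) by linarith
  show "stab A = H" using periodic_imp_subset_stab[OF c(1) pA] periodic_plus_left[OF periodic_stab, of A B]
      periodic_imp_subset_stab[OF c(6)] H by blast
  show "stab B = H" using periodic_imp_subset_stab[OF c(2) pB] periodic_plus[OF periodic_stab, of B A]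
      periodic_imp_subset_stab[OF c(6)] H by blast
qed

text \<open>An element that could be added to a summand without enlarging the sum would violate
  Kneser's theorem, whose bound is already attained.\<close>

lemma critical_pair_if_card_eq:
  assumes fin: "finite A" "finite B" "A \<noteq> {}" "B \<noteq> {}"
    and eq: "card A + card B = card (A + B) + card (stab (A + B))"
  shows "critical_pair A B"
proof -
  have max: "x \<in> A" if "finite A" "finite B" "A \<noteq> {}" "B \<noteq> {}" 
    "card A + card B = card (A + B) + card (stab (A + B))" "x +o B \<subseteq> A + B" for x and A B :: "'a set"
  proof (rule ccontr)
    assume "x \<notin> A"
    have "insert x A + B = A + B" using that(6)
      by (auto elim!: set_plus_elim simp: translate_subset_iff)
    then have "card (insert x A) + card B \<le> card (A + B) + card (stab (A + B))"
      using kneser[of "insert x A" B] that by simp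
    then show False using that \<open>x \<notin> A\<close> by simp
  qed
  have f: "finite (A + B)" "A + B \<noteq> {}" using finite_sumset fin by auto
  have "card (stab (A + B)) > 0"
    using subgroupD(1)[OF add_subgroup_stab] finite_stab[OF f] card_gt_0_iff by blast
  then show ?thesis using max[of A B] max[of B A] fin eq
    unfolding critical_pair_def by (simp add: add.commute[of B A])
qed

lemma generating_mono: "generating G A \<Longrightarrow> A \<subseteq> B \<Longrightarrow> generating G B"
  unfolding generating_def by blast

lemma generating_translate [simp]: "generating G (x +o A) \<longleftrightarrow> generating G A"
proof -
  have "x +o A \<subseteq> g +o K \<longleftrightarrow> A \<subseteq> (g - x) +o K" for g K
    using translate_mono_iff[of "x" A "(g - x) +o K"] by (simp add: set_plus_rearrange2)
  then show ?thesis unfolding generating_def by (metis diff_add_cancel add_diff_cancel)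
qed

text \<open>Anchored at \<open>a\<close>, a coset of \<open>L\<close> that contains \<open>A\<close>
  is \<open>a +o L\<close>, so the intersection of all such \<open>L\<close> is the least
  one.\<close>

lemma closure_exists:
  assumes "add_subgroup G" "A \<subseteq> G" "a \<in> A"
  obtains K where "add_subgroup K" "K \<subseteq> G" "A \<subseteq> a +o K"
    "\<And>L z. add_subgroup L \<Longrightarrow> A \<subseteq> z +o L \<Longrightarrow> K \<subseteq> L"
proof
  let ?F = "{L. add_subgroup L \<and> A \<subseteq> a +o L}"
  let ?K = "\<Inter> ?F"
  show "add_subgroup ?K" by (auto simp: add_subgroup_def)
  have "A \<subseteq> a +o G"
  proof
    fix x assume "x \<in> A"
    then have "x - a \<in> G" using assms subgroupD(4)[OF assms(1)] by blast
    then show "x \<in> a +o G" by (simp add: in_translate)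
  qed
  then show "?K \<subseteq> G" using assms(1) by blast
  show "A \<subseteq> a +o ?K" by (simp add: subset_iff in_translate)
  fix L z assume *: "add_subgroup L" "A \<subseteq> z +o L"
  then have "a - z \<in> L" using assms(3) by (auto simp: in_translate)
  then have "z +o L = a +o L" using coset_eq_iff[OF *(1)] subgroup_diff_comm[OF *(1)] by blast
  then show "?K \<subseteq> L" using * by blast
qed

lemma two_cosets_card:
  assumes "add_subgroup L" "periodic L S" "finite S" "x \<in> S" "y \<in> S" "x - y \<notin> L"
  shows "2 * card L \<le> card S"
proof -
  have fin: "finite L" using card_le_periodic[OF assms(2) _ assms(3)] assms(4) by blast
  have "card ((x +o L) \<union> (y +o L)) = 2 * card L"
    using coset_disjoint[OF assms(1,6)] fin by (simp add: card_Un_disjoint)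
  moreover have "(x +o L) \<union> (y +o L) \<subseteq> S" using periodic_coset_subset[OF assms(2)] assms(4,5) by blast
  ultimately show ?thesis using card_mono[OF assms(3)] by metis
qed

section \<open>Beats: a summand in a proper coset\<close>

lemma coset_add_mem:
  assumes "add_subgroup K" "a \<in> x +o K" "b \<in> y +o K"
  shows "a + b \<in> (x + y) +o K"
proof -
  have "(a - x) + (b - y) \<in> K" using assms subgroupD(2) by (auto simp: in_translate)
  then show ?thesis by (simp add: in_translate algebra_simps)
qed

text \<open>A coset that the sum meets but does not fill costs half of \<open>A\<close>: the
  stabilizer \<open>L\<close> of the sum is a proper subgroup of \<open>K\<close>, so the generating
  set \<open>A\<close> meets two cosets of \<open>L\<close>, and the term \<open>card L\<close> in
  Kneser's bound is at most half of \<open>card (A + L)\<close>.\<close>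

lemma coset_partial_cost:
  assumes fin: "finite A" "finite B" "A \<noteq> {}" "B \<noteq> {}"
    and K: "add_subgroup K" "A \<subseteq> K" "generating K A" "B \<subseteq> y +o K" "\<not> y +o K \<subseteq> A + B"
  shows "card A + 2 * card B \<le> 2 * card (A + B)"
proof -
  define L where "L = stab (A + B)"
  have f: "finite (A + B)" "A + B \<noteq> {}" using finite_sumset fin by auto
  have sub: "add_subgroup L" by (simp add: L_def add_subgroup_stab)
  have inc: "A + B \<subseteq> y +o K"
    using coset_add_mem[OF K(1), of _ 0 _ y] K(2,4) by (fastforce elim!: set_plus_elim)
  have LK: "L \<subseteq> K" unfolding L_def by (rule stab_subset_coset[OF K(1) inc f(2)])
  have "L \<noteq> K"
  proof
    assume "L = K"
    then have per: "periodic K (A + B)" using periodic_stab L_def by metis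
    obtain d where d: "d \<in> A + B" using f by blast
    then have "d +o K \<subseteq> A + B" using periodic_coset_subset[OF per] by blast
    moreover have "d +o K = y +o K" using d inc coset_eq_iff[OF K(1)] by (auto simp: in_translate)
    ultimately show False using K(5) by simp
  qed
  with LK have "L \<subset> K" by blast
  obtain a where a: "a \<in> A" using fin by blast
  have "\<not> A \<subseteq> a +o L" using K(3) sub \<open>L \<subset> K\<close> unfolding generating_def by blast
  then obtain a' where a': "a' \<in> A" "a' - a \<notin> L" unfolding subset_iff in_translate by blast
  have AL: "A \<subseteq> A + L" "periodic L (A + L)" using subset_plus_subgroup periodic_plus_subgroup sub by blast+
  have fL: "finite L" using f L_def finite_stab by blast
  then have fAL: "finite (A + L)" using finite_sumset fin by blast
  have "2 * card L \<le> card (A + L)" using two_cosets_card[OF sub AL(2) fAL, of a' a] a a' AL by blast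
  moreover have "card A \<le> card (A + L)" using card_mono[OF fAL AL(1)] .
  moreover have "card (A + L) + card B \<le> card (A + B) + card L"
    using kneser_plus[OF fin L_def] .
  ultimately show ?thesis by linarith
qed

text \<open>Two partially filled cosets would cost half of \<open>A\<close> each, against
  \<open>card (A + B) < card A + card B\<close>. If there were none, \<open>A + B\<close> and hence
  \<open>A\<close> would be periodic under \<open>K\<close>, so that \<open>A = K\<close>.\<close>

lemma subgroup_beat:
  assumes cr: "critical_pair A B" and K: "add_subgroup K" "A \<subseteq> K" "generating K A" "A \<noteq> K"
  obtains y where "y \<in> B" "periodic K (B - (y +o K))" "\<not> y +o K \<subseteq> A + B" "critical_pair A (B \<inter> (y +o K))"
proof -
  note c = critical_pairD[OF cr]
  have "\<exists>y\<in>B. \<not> y +o K \<subseteq> A + B"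
  proof (rule ccontr)
    assume "\<not> ?thesis"
    then have *: "y +o K \<subseteq> A + B" if "y \<in> B" for y using that by blast
    have "periodic K (A + B)" unfolding periodic_def
    proof (intro ballI)
      fix d k assume "d \<in> A + B" "k \<in> K"
      then obtain a b where ab: "d = a + b" "a \<in> A" "b \<in> B" by (auto elim: set_plus_elim)
      have "a + k \<in> K" using ab K(2) \<open>k \<in> K\<close> subgroupD(2)[OF K(1)] by blast
      then have "d + k \<in> b +o K" using ab by (simp add: in_translate algebra_simps)
      then show "d + k \<in> A + B" using *[OF ab(3)] by blast
    qed
    then have "K \<subseteq> stab (A + B)" using c(6) periodic_imp_subset_stab by blast
    then have "periodic K A" using critical_pair_stab(3)[OF cr HOL.refl] unfolding periodic_def by blast
    moreover obtain a where "a \<in> A" using c by blast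
    ultimately have "a +o K \<subseteq> A" using periodic_coset_subset by blast
    moreover have "a +o K = 0 +o K" using \<open>a \<in> A\<close> K(2) coset_eq_iff[OF K(1), of a 0] by auto
    ultimately show False using K by auto
  qed
  then obtain y where y: "y \<in> B" "\<not> y +o K \<subseteq> A + B" by blast
  define Bc where "Bc z = B \<inter> (z +o K)" for z
  have self: "z \<in> z +o K" for z using subgroupD(1)[OF K(1)] by (simp add: in_translate)
  have inc: "A + S \<subseteq> z +o K" if "S \<subseteq> z +o K" for z S
    using coset_add_mem[OF K(1), of _ 0 _ z] K(2) that by (fastforce elim!: set_plus_elim)
  have cost: "card A + 2 * card (Bc z) \<le> 2 * card (A + Bc z)" if "z \<in> B" "\<not> z +o K \<subseteq> A + B" for z
  proof (rule coset_partial_cost[OF c(1) _ c(3) _ K(1-3)])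
    show "finite (Bc z)" "Bc z \<subseteq> z +o K" using c by (auto simp: Bc_def)
    show "Bc z \<noteq> {}" using that(1) self by (auto simp: Bc_def)
    show "\<not> z +o K \<subseteq> A + Bc z" using that(2) set_plus_mono2[of A A "Bc z" B] by (auto simp: Bc_def)
  qed
  have uniq: "z +o K \<subseteq> A + B" if z: "z \<in> B" "z - y \<notin> K" for z
  proof (rule ccontr)
    assume nz: "\<not> z +o K \<subseteq> A + B"
    define R where "R = B - (y +o K) - (z +o K)"
    have disj: "(z +o K) \<inter> (y +o K) = {}" using coset_disjoint[OF K(1) z(2)] .
    have B: "B = Bc y \<union> Bc z \<union> R" by (auto simp: Bc_def R_def)
    have fin: "finite (Bc y)" "finite (Bc z)" "finite R" using c by (auto simp: Bc_def R_def)
    have cB: "card B = card (Bc y) + card (Bc z) + card R"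
    proof -
      have "card (Bc y \<union> Bc z) = card (Bc y) + card (Bc z)"
        using disj fin by (intro card_Un_disjoint) (auto simp: Bc_def)
      moreover have "card (Bc y \<union> Bc z \<union> R) = card (Bc y \<union> Bc z) + card R"
        using fin by (intro card_Un_disjoint) (auto simp: Bc_def R_def)
      ultimately show ?thesis using B by simp
    qed
    have Rout: "A + R \<subseteq> - (y +o K) - (z +o K)"
    proof
      fix w assume "w \<in> A + R"
      then obtain a b where ab: "w = a + b" "a \<in> A" "b \<in> R" by (auto elim: set_plus_elim)
      have "w \<in> v +o K \<longleftrightarrow> b \<in> v +o K" for v
        using ab K(2) subgroup_add_iff(2)[OF K(1), of a "b - v"] by (auto simp: in_translate algebra_simps)
      then show "w \<in> - (y +o K) - (z +o K)" using ab by (auto simp: R_def)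
    qed
    have i1: "A + Bc y \<subseteq> y +o K" "A + Bc z \<subseteq> z +o K" by (auto intro!: inc simp del: set_plus_intro simp: Bc_def)
    have fins: "finite (A + Bc y)" "finite (A + Bc z)" "finite (A + R)" using fin c finite_sumset by auto
    have "card (A + Bc y) + card (A + Bc z) + card (A + R) = card ((A + Bc y) \<union> (A + Bc z) \<union> (A + R))"
    proof -
      have "card ((A + Bc y) \<union> (A + Bc z)) = card (A + Bc y) + card (A + Bc z)"
        using disj i1 fins by (intro card_Un_disjoint) blast+
      moreover have "card ((A + Bc y) \<union> (A + Bc z) \<union> (A + R)) = card ((A + Bc y) \<union> (A + Bc z)) + card (A + R)"
        using Rout i1 fins by (intro card_Un_disjoint) blast+
      ultimately show ?thesis by simp
    qed
    also have "(A + Bc y) \<union> (A + Bc z) \<union> (A + R) = A + B"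
      using arg_cong[OF B, of "(+) A"] by (simp only: set_plus_Un)
    finally have "card (A + Bc y) + card (A + Bc z) + card (A + R) = card (A + B)" .
    moreover have "card R \<le> card (A + R)" using card_le_sumset_right[of A R] fin c by auto
    ultimately show False using cost[OF y] cost[OF z(1) nz] cB c(5) by linarith
  qed
  have per: "periodic K (B - (y +o K))" unfolding periodic_def
  proof (intro ballI)
    fix z k assume z: "z \<in> B - (y +o K)" and k: "k \<in> K"
    have zy: "z - y \<notin> K" using z by (simp add: in_translate)
    have "z + k \<in> B"
    proof (rule critical_pair_max2[OF cr])
      fix a assume "a \<in> A"
      then have "a + k \<in> K" using K(2) k subgroupD(2)[OF K(1)] by blast
      then have "a + (z + k) \<in> z +o K" by (simp add: in_translate algebra_simps)
      then show "a + (z + k) \<in> A + B" using uniq[of z] z zy by blast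
    qed
    moreover have "z + k \<notin> y +o K"
      using subgroup_add_iff(1)[OF K(1) k, of "z - y"] zy by (simp add: in_translate algebra_simps)
    ultimately show "z + k \<in> B - (y +o K)" by blast
  qed
  let ?R = "B - (y +o K)"
  have ARout: "A + ?R \<subseteq> - (y +o K)"
  proof
    fix w assume "w \<in> A + ?R"
    then obtain a b where ab: "w = a + b" "a \<in> A" "b \<in> ?R" by (auto elim: set_plus_elim)
    then show "w \<in> - (y +o K)"
        using K(2) subgroup_add_iff(2)[OF K(1), of a "b - y"] by (auto simp: in_translate algebra_simps)
  qed
  have i1: "A + Bc y \<subseteq> y +o K" by (rule inc) (auto simp: Bc_def)
  have BB: "B = Bc y \<union> ?R" by (auto simp: Bc_def)
  then have D: "A + B = (A + Bc y) \<union> (A + ?R)" by (metis set_plus_Un)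
  have fins: "finite (Bc y)" "finite ?R" "finite (A + Bc y)" "finite (A + ?R)" using c finite_sumset by (auto simp: Bc_def)
  have "card (A + B) = card (A + Bc y) + card (A + ?R)"
    unfolding D using ARout i1 fins by (intro card_Un_disjoint) blast+
  moreover have "card B = card (Bc y) + card ?R"
    by (subst BB, rule card_Un_disjoint) (use fins in \<open>auto simp: Bc_def\<close>)
  moreover have "card ?R \<le> card (A + ?R)" using card_le_sumset_right[of A ?R] fins c by auto
  \<comment> \<open>Outside \<open>y +o K\<close> the sum has at least as many elements as
    \<open>B\<close>, so the saving of the pair occurs inside this coset.\<close>
  ultimately have lt: "card (A + Bc y) < card A + card (Bc y)" using c(5) by linarith
  have "critical_pair A (Bc y)" unfolding critical_pair_def
  proof (intro conjI allI impI)
    show "finite A" "finite (Bc y)" "A \<noteq> {}" "Bc y \<noteq> {}" using c fins y self by (auto simp: Bc_def)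
    show "card (A + Bc y) < card A + card (Bc y)" by fact
    fix x
    {
      assume x: "x +o Bc y \<subseteq> A + Bc y"
      have "y \<in> Bc y" using y self by (simp add: Bc_def)
      then have "x + y \<in> y +o K" using x i1 by (auto simp: translate_subset_iff)
      then have xK: "x \<in> K" by (simp add: in_translate)
      show "x \<in> A"
      proof (rule critical_pair_max1[OF cr])
        fix b assume "b \<in> B"
        then consider "b \<in> Bc y" | "b \<in> ?R" using BB by blast
        then show "x + b \<in> A + B"
        proof cases
          case 1
          then show ?thesis using x D by (auto simp: translate_subset_iff)
        next
          case 2
          \<comment> \<open>Since \<open>x + b = a + (b + (x - a))\<close>, the difference
            \<open>x - a\<close> in \<open>K\<close> is absorbed by the periodic part of
            \<open>B\<close>.\<close>
          obtain a where a: "a \<in> A" using c by blast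
          then have "x - a \<in> K" using xK K(2) subgroupD(4)[OF K(1)] by blast
          then have "b + (x - a) \<in> ?R" using per 2 unfolding periodic_def by blast
          then have "a + (b + (x - a)) \<in> A + B" using a by blast
          then show ?thesis by (simp add: algebra_simps)
        qed
      qed
    next
      assume x: "x +o A \<subseteq> A + Bc y"
      have "x \<in> B"
        by (rule critical_pair_max2[OF cr]) (use x D in \<open>auto simp: translate_subset_iff add.commute\<close>)
      moreover have "x \<in> y +o K"
      proof -
        obtain a where a: "a \<in> A" using c by blast
        then have "x + a \<in> y +o K" using x i1 by (auto simp: translate_subset_iff)
        then show ?thesis using subgroup_add_iff(1)[OF K(1), of a "x - y"] a K(2) 
          by (auto simp: in_translate algebra_simps)
      qed
      ultimately show "x \<in> Bc y" by (simp add: Bc_def)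
    }
  qed
  then show ?thesis using that[OF y(1) per y(2)] by (simp add: Bc_def)
qed

section \<open>Dyson transforms and quasi-periodicity\<close>

text \<open>The exceptional coset is met but not filled, so \<open>K\<close> never consists of
  periods of \<open>D\<close>, and in particular is not the trivial group.\<close>

definition quasi_periodic :: "'a::ab_group_add set \<Rightarrow> 'a \<Rightarrow> 'a set \<Rightarrow> bool" where
  "quasi_periodic K p D \<longleftrightarrow> add_subgroup K \<and> finite K \<and> periodic K (D - (p +o K)) \<and>
     D \<inter> (p +o K) \<noteq> {} \<and> \<not> p +o K \<subseteq> D"

lemma periodic_translate [simp]: "periodic K (g +o S) \<longleftrightarrow> periodic K S"
proof -
  have "periodic K (g +o S)" if "periodic K S" for g and S :: "'a set"
    unfolding periodic_def in_translate
  proof (intro ballI)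
    fix x k assume "x \<in> g +o S" "k \<in> K"
    then have "(x - g) + k \<in> S" using that unfolding periodic_def in_translate by blast
    then show "x + k - g \<in> S" by (simp add: algebra_simps)
  qed
  from this[of S g] this[of "g +o S" "- g"] show ?thesis by auto
qed

lemma quasi_periodic_translate:
  assumes "quasi_periodic K p D"
  shows "quasi_periodic K (g + p) (g +o D)"
proof -
  have e: "(g + p) +o K = g +o (p +o K)" by (simp add: set_plus_rearrange2)
  have i: "x \<in> (g +o D) \<inter> (g +o (p +o K)) \<longleftrightarrow> x \<in> g +o (D \<inter> (p +o K))"
    "x \<in> (g +o D) - (g +o (p +o K)) \<longleftrightarrow> x \<in> g +o (D - (p +o K))" for x
    by (auto simp: in_translate)
  have n: "g +o S \<noteq> {}" if "S \<noteq> {}" for S using that by (auto simp: elt_set_plus_def)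
  show ?thesis using assms n[of "D \<inter> (p +o K)"] set_eqI[OF i(1)] set_eqI[OF i(2)]
    unfolding quasi_periodic_def e by simp
qed

text \<open>A translation has made the shift of the Dyson transform \<open>0\<close>. Equality in
  Kneser's theorem for \<open>(A, B)\<close> and the bound for
  \<open>(A \<union> B, A \<inter> B)\<close> leave so few holes of \<open>A \<union> B\<close> in
  its \<open>K\<close>-cosets that the lost part \<open>E\<close> of the sum fits into one coset of
  \<open>K\<close>.\<close>

lemma dyson_quasi_periodic:
  assumes cr: "critical_pair A B" and ne: "A \<inter> B \<noteq> {}"
    and K: "K = stab ((A \<union> B) + (A \<inter> B))" and KH: "K \<noteq> stab (A + B)"
  shows "\<exists>p. quasi_periodic K p (A + B)"
proof -
  define H D A' B' D' where "H = stab (A + B)" and "D = A + B" and "A' = A \<union> B" and "B' = A \<inter> B"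
    and "D' = A' + B'"
  note c = critical_pairD[OF cr]
  note s = critical_pair_stab[OF cr H_def]
  have fin0: "finite A'" "finite B'" using c by (simp_all add: A'_def B'_def)
  have fin: "finite A'" "finite B'" "finite D'" "finite D" 
    using fin0 finite_sumset[OF fin0] c(6) by (simp_all only: D'_def D_def)
  have nes0: "A' \<noteq> {}" "B' \<noteq> {}" using ne by (auto simp: A'_def B'_def)
  have nes: "A' \<noteq> {}" "B' \<noteq> {}" "D' \<noteq> {}" using nes0 by (auto simp: D'_def)
  have KD': "K = stab D'" using K by (simp add: D'_def A'_def B'_def)
  have sub: "add_subgroup K" and finK: "finite K" and perD': "periodic K D'"
    using KD' add_subgroup_stab finite_stab[OF fin(3) nes(3)] periodic_stab by auto
  have D'D: "D' \<subseteq> D"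
  proof
    fix w assume "w \<in> D'"
    then obtain x y where xy: "w = x + y" "x \<in> A'" "y \<in> B'" by (auto simp: D'_def elim: set_plus_elim)
    show "w \<in> D"
    proof (cases "x \<in> A")
      case True
      then show ?thesis using xy set_plus_intro[of x A y B] by (simp add: D_def B'_def)
    next
      case False
      then show ?thesis using xy set_plus_intro[of y A x B] by (simp add: D_def B'_def A'_def add.commute)
    qed
  qed
  have inD': "x + y \<in> D'" "y + x \<in> D'" if "x \<in> A'" "y \<in> B'" for x y
    using that set_plus_intro[of x A' y B'] by (simp_all add: D'_def add.commute)
  have perB': "periodic K B'" unfolding periodic_def
  proof (intro ballI)
    fix y k assume y: "y \<in> B'" and k: "k \<in> K"
    have "x + y + k \<in> D" if "x \<in> A'" for x
      using periodicD[OF inD'(1)[OF that y] k perD'] D'D by blast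
    then have "y + k \<in> A" "y + k \<in> B"
      by (auto intro!: critical_pair_max1[OF cr] critical_pair_max2[OF cr] simp: A'_def D_def ac_simps)
    then show "y + k \<in> B'" by (simp add: B'_def)
  qed
  have "card (A' + K) + card B' \<le> card D' + card K"
    using kneser_plus[OF fin(1,2) nes(1,2), of K] KD' by (simp add: D'_def)
  moreover have "card A' + card B' = card A + card B"
    using card_Un_Int[of A B] c by (simp add: A'_def B'_def)
  moreover define E where "E = D - D'"
  moreover have "card E = card D - card D'" "card D' \<le> card D"
    using card_Diff_subset[OF fin(3) D'D] card_mono[OF fin(4) D'D] by (auto simp: E_def)
  \<comment> \<open>The two Kneser counts combined: the elements of \<open>A' + K\<close> outside
    \<open>A'\<close>, together with \<open>E\<close> and a copy of \<open>H\<close>, number at most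
    \<open>card K\<close>.\<close>
  ultimately have main: "card E + card (A' + K) + card H \<le> card K + card A'"
    using s(6) by (simp add: D_def)
  have finAK: "finite (A' + K)" using fin finK finite_sumset by blast
  have A'AK: "A' \<subseteq> A' + K" using subset_plus_subgroup[OF sub] .
  have "E \<noteq> {}" using D'D KD' KH by (auto simp: E_def D_def)
  have finE: "finite E" using fin by (simp add: E_def)
  have self: "z \<in> z +o K" for z using subgroupD(1)[OF sub] by (simp add: in_translate)
  have big: "card E + card H \<le> card (A' \<inter> (x +o K))" if "x \<in> A'" for x
  proof -
    have "x +o K \<subseteq> A' + K" using that by (rule set_plus_mono3)
    then have "card ((x +o K) - A') \<le> card ((A' + K) - A')"
      using finAK by (intro card_mono) auto
    moreover have "card ((A' + K) - A') = card (A' + K) - card A'"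
      using card_Diff_subset[OF fin(1) A'AK] .
    moreover have "card K = card (A' \<inter> (x +o K)) + card ((x +o K) - A')"
      using card_Int_Diff[of "x +o K" A'] finK by (simp add: Int_commute)
    ultimately show ?thesis using main card_mono[OF finAK A'AK] by linarith
  qed
  have notD': "w \<notin> D'" if "w \<in> p +o K" "p \<in> E" for w p
  proof
    assume "w \<in> D'"
    moreover have "p - w \<in> K" using that(1) subgroup_diff_comm[OF sub] by (auto simp: in_translate)
    ultimately have "w + (p - w) \<in> D'" by (intro periodicD[OF _ _ perD'])
    then show False using that(2) by (simp add: E_def)
  qed
  have small: "card S \<le> card (E \<inter> (p +o K))" if "p \<in> E" "\<And>w. w \<in> S \<Longrightarrow> z + w \<in> D \<and> z + w \<in> p +o K" for S z p
  proof -
    have "z +o S \<subseteq> E \<inter> (p +o K)" using that notD' by (auto simp: translate_subset_iff E_def)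
    from card_mono[OF _ this] show ?thesis using finE by simp
  qed
  \<comment> \<open>Choose among two cosets of \<open>E\<close> the one with the smaller share,
    through \<open>p1 = x + y\<close>. A translate of \<open>A \<inter> (x +o K)\<close> lies in
    this share, which is less than \<open>big\<close> demands of \<open>A'\<close>; so
    \<open>B\<close> meets \<open>x +o K\<close> as well. Its elements there show up in the share of
    \<open>E\<close> in some coset of \<open>p3\<close>, and the two shares together are still at
    most \<open>card E\<close>.\<close>
  have no2: False if p: "p1 \<in> E" "p2 \<in> E" "p2 - p1 \<notin> K" 
    and le: "card (E \<inter> (p1 +o K)) \<le> card (E \<inter> (p2 +o K))" for p1 p2
  proof -
    have add2: "card (E \<inter> (p1 +o K)) + card (E \<inter> (p +o K)) \<le> card E" if "p - p1 \<notin> K" for p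
    proof -
      have "card (E \<inter> (p1 +o K)) + card (E \<inter> (p +o K)) = card ((E \<inter> (p1 +o K)) \<union> (E \<inter> (p +o K)))"
        using coset_disjoint[OF sub that] finE by (intro card_Un_disjoint[symmetric]) auto
      also have "\<dots> \<le> card E" using finE by (intro card_mono) auto
      finally show ?thesis .
    qed
    obtain x y where xy: "p1 = x + y" "x \<in> A" "y \<in> B" using p(1) 
      by (auto simp: E_def D_def elim: set_plus_elim)
    have f: "card (A \<inter> (x +o K)) \<le> card (E \<inter> (p1 +o K))"
      using xy by (intro small[OF p(1), of _ y]) (auto simp: in_translate D_def add.commute[of y])
    have b: "card E + card H \<le> card (A' \<inter> (x +o K))" using big xy by (simp add: A'_def)
    show False
    proof (cases "B \<inter> (x +o K) = {}")
      case True
      then have "A' \<inter> (x +o K) = A \<inter> (x +o K)" by (auto simp: A'_def)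
      then show False using b f add2[OF p(3)] s(9) by simp
    next
      case False
      then obtain b where b': "b \<in> B" "b - x \<in> K" by (auto simp: in_translate)
      \<comment> \<open>If all sums with \<open>b\<close> were in \<open>D'\<close>, then so would
        be all sums with \<open>x\<close>, because \<open>x - b\<close> is a period of
        \<open>D'\<close>. Maximality would put \<open>x\<close> into \<open>B\<close>, and
        \<open>p1\<close> into \<open>D'\<close>.\<close>
      have "\<exists>a\<in>A. a + b \<notin> D'"
      proof (rule ccontr)
        assume "\<not> ?thesis"
        then have *: "a + b \<in> D'" if "a \<in> A" for a using that by blast
        have "x \<in> B"
        proof (rule critical_pair_max2[OF cr])
          fix a assume "a \<in> A"
          have "(a + b) + (x - b) \<in> D'"
            using periodicD[OF *[OF \<open>a \<in> A\<close>] _ perD'] b'(2) subgroup_diff_comm[OF sub] by blast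
          then show "a + x \<in> A + B" using D'D by (auto simp: D_def)
        qed
        then have "p1 \<in> D'" using xy inD'(2)[of y x] by (simp add: A'_def B'_def)
        then show False using p(1) by (simp add: E_def)
      qed
      then obtain a where a: "a \<in> A" "a + b \<notin> D'" by blast
      define p3 where "p3 = a + b"
      have p3: "p3 \<in> E" using a b' set_plus_intro[of a A b B] by (simp add: p3_def E_def D_def)
      have g: "card (B \<inter> (x +o K)) \<le> card (E \<inter> (p3 +o K))"
      proof (rule small[OF p3, of _ a], clarify)
        fix w assume w: "w \<in> B" "w \<in> x +o K"
        then have "w - b \<in> K" using subgroup_diff_trans[OF sub, of w x b] b'(2) subgroup_diff_comm[OF sub]
          by (auto simp: in_translate)
        then show "a + w \<in> D \<and> a + w \<in> p3 +o K" using a w set_plus_intro[of a A w B]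
          by (simp add: D_def in_translate p3_def)
      qed
      have "A' \<inter> (x +o K) = (A \<inter> (x +o K)) \<union> (B \<inter> (x +o K))" by (auto simp: A'_def)
      then have u: "card (A' \<inter> (x +o K)) \<le> card (A \<inter> (x +o K)) + card (B \<inter> (x +o K))"
        by (metis card_Un_le)
      show False
      proof (cases "p3 - p1 \<in> K")
        case True
        then have "p3 +o K = p1 +o K" using coset_eq_iff[OF sub] by blast
        then show False using b f g u le add2[OF p(3)] s(9) by simp
      next
        case False
        then show False using b f g u add2[OF False] s(9) by simp
      qed
    qed
  qed
  obtain p where p: "p \<in> E" using \<open>E \<noteq> {}\<close> by blast
  have all: "q - p \<in> K" if "q \<in> E" for q
    using no2[of p q] no2[of q p] p that subgroup_diff_comm[OF sub, of p q] by (meson nle_le)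
  have "D - (p +o K) = D'"
    using all notD'[OF _ p] D'D unfolding E_def set_eq_iff in_translate Diff_iff by blast
  moreover have "\<not> p +o K \<subseteq> D"
  proof
    assume "p +o K \<subseteq> D"
    then have "p +o K \<subseteq> E" using notD'[OF _ p] by (auto simp: E_def)
    then have "card K \<le> card E" using card_mono[OF finE] by (metis card_translate)
    then show False using main card_mono[OF finAK A'AK] s(9) by simp
  qed
  moreover have "p \<in> D" using p by (simp add: E_def)
  ultimately show ?thesis using sub finK perD' self[of p] unfolding quasi_periodic_def D_def by auto
qed

section \<open>The argument of Vosper\<close>

lemma generating_cosetD:
  "generating G A \<Longrightarrow> add_subgroup K \<Longrightarrow> K \<subseteq> G \<Longrightarrow> A \<subseteq> x +o K \<Longrightarrow> K = G"
  unfolding generating_def by blast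

lemma stab_subset_subgroup:
  "add_subgroup G \<Longrightarrow> S \<subseteq> G \<Longrightarrow> S \<noteq> {} \<Longrightarrow> stab S \<subseteq> G"
  using stab_subset_coset[of G S 0] by simp

lemma sumset_subset_subgroup:
  "add_subgroup G \<Longrightarrow> A \<subseteq> G \<Longrightarrow> B \<subseteq> G \<Longrightarrow> A + B \<subseteq> G"
  using subgroupD(2)[of G] by (auto elim!: set_plus_elim)

lemma periodic_full:
  assumes "add_subgroup G" "periodic G S" "S \<subseteq> G" "S \<noteq> {}"
  shows "S = G"
proof -
  obtain s where s: "s \<in> S" using assms by blast
  have "s +o G = 0 +o G" using coset_eq_iff[OF assms(1), of s 0] s assms(3) by auto
  then show ?thesis using periodic_coset_subset[OF assms(2) s] assms(3) by simp
qed

lemma periodic_subset_eq_coset: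
  assumes "periodic K S" "finite S" "x \<in> S" "card S \<le> card K"
  shows "S = x +o K"
  using card_subset_eq[OF assms(2) periodic_coset_subset[OF assms(1,3)]]
    card_mono[OF assms(2) periodic_coset_subset[OF assms(1,3)]] assms(4) by simp

lemma periodic_Diff:
  assumes "add_subgroup K" "periodic K S" "periodic K T"
  shows "periodic K (S - T)"
  unfolding periodic_def
proof (intro ballI)
  fix x k assume "x \<in> S - T" "k \<in> K"
  then show "x + k \<in> S - T" 
    using periodicD[OF _ _ assms(2)] periodicD_rev[OF _ _ assms(3,1)] by blast
qed

lemma periodic_mono: "periodic K S \<Longrightarrow> H \<subseteq> K \<Longrightarrow> periodic H S"
  unfolding periodic_def by blast

lemma periodic_coset: "add_subgroup K \<Longrightarrow> periodic K (x +o K)"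
  by (simp add: periodic_subgroup)

lemma coset_self: "add_subgroup K \<Longrightarrow> x \<in> x +o K"
  using subgroupD(1)[of K] by (simp add: in_translate)

lemma coset_eqI: "add_subgroup K \<Longrightarrow> y \<in> x +o K \<Longrightarrow> x +o K = y +o K"
  using coset_eq_iff[of K y x] by (simp add: in_translate)

text \<open>
  Let \<open>X\<close> be the set of \<open>a \<in> A\<close> for which \<open>a - b0 + B\<close> leaves \<open>A\<close>. The translates of
  \<open>B - (b0 + H)\<close> by \<open>X - b0\<close> avoid \<open>A\<close> but lie in \<open>A + B - b0\<close>, so there is only room for one translate
  and \<open>X\<close> lies in a coset of the stabilizer of \<open>B - (b0 + H)\<close>.
\<close>

lemma vosper_step:
  assumes cr: "critical_pair A B" and H: "H = stab (A + B)" and G: "add_subgroup G" "A \<subseteq> G" "B \<subseteq> G"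
    and generating: "generating G A" "generating G B" and DG: "A + B \<noteq> G"
    and dich: "\<And>e. B \<inter> (- e +o A) = {} \<or> (\<exists>b. B \<inter> (- e +o A) = b +o H) \<or> B \<subseteq> - e +o A"
    and b0: "b0 \<in> B" and nc: "B \<noteq> b0 +o H"
  shows "\<exists>J x. add_subgroup J \<and> finite J \<and> B - (b0 +o H) = x +o J"
proof -
  note c = critical_pairD[OF cr]
  note s = critical_pair_stab[OF cr H]
  define Bs where "Bs = B - (b0 +o H)"
  have b0H: "b0 +o H \<subseteq> B" using periodic_coset_subset[OF s(4) b0] .
  have Bs: "Bs \<noteq> {}" "finite Bs" "Bs \<subseteq> B" "b0 \<notin> Bs" using nc b0H c coset_self[OF s(1)] by (auto simp: Bs_def)
  have cBs: "card B = card Bs + card H"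
    unfolding Bs_def using card_Diff_subset[OF _ b0H] card_mono[OF c(2) b0H] s(2) by simp
  define X where "X = {a \<in> A. \<not> (a - b0) +o B \<subseteq> A}"
  have Xout: "a - b0 + b \<notin> A" if "a \<in> X" "b \<in> Bs" for a b
  proof
    assume *: "a - b0 + b \<in> A"
    define e where "e = a - b0"
    define S where "S = B \<inter> (- e +o A)"
    have aA: "a \<in> A" and nsub: "\<not> e +o B \<subseteq> A" using that by (auto simp: X_def e_def)
    \<comment> \<open>\<open>S\<close> contains \<open>b0\<close> and is not all of
      \<open>B\<close>, so the trichotomy leaves only \<open>S = b0 +o H\<close>, which excludes
      \<open>b\<close>.\<close>
    have "b0 \<in> S" using b0 aA by (simp add: S_def in_translate e_def)
    moreover have "\<not> B \<subseteq> - e +o A" using nsub translate_mono_iff[of e B "- e +o A"] by simp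
    ultimately obtain z where "S = z +o H" using dich[of e] S_def by auto
    then have "S = b0 +o H" using coset_eqI[OF s(1), of b0 z] \<open>b0 \<in> S\<close> by simp
    moreover have "b \<in> S" using * that(2) Bs(3) by (auto simp: S_def in_translate e_def diff_conv_add_uminus add.commute simp del: add_uminus_conv_diff)
    ultimately show False using that by (simp add: Bs_def)
  qed
  \<comment> \<open>Otherwise all differences \<open>b - b0\<close> would be periods of
    \<open>A\<close>, and \<open>B\<close> would be a single coset of \<open>H\<close>.\<close>
  have "X \<noteq> {}"
  proof
    assume "X = {}"
    then have *: "a - b0 + b \<in> A" if "a \<in> A" "b \<in> B" for a b
      using that by (auto simp: X_def translate_subset_iff)
    have "B \<subseteq> b0 +o H"
    proof
      fix b assume "b \<in> B"
      have "a + (b - b0) \<in> A" if "a \<in> A" for a using *[OF that \<open>b \<in> B\<close>] by (simp add: algebra_simps)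
      then have "b - b0 \<in> stab A" using c(1) by (simp add: in_stab_iff)
      then show "b \<in> b0 +o H" using s(7) by (simp add: in_translate)
    qed
    then show False using nc b0H by blast
  qed
  then obtain x0 where x0: "x0 \<in> X" by blast
  have finX: "finite X" "X \<subseteq> A" using c by (auto simp: X_def)
  have finXB: "finite (X + Bs)" using finite_sumset finX Bs by blast
  have "card (X + Bs) \<le> card Bs"
  proof -
    have "(X + Bs) \<inter> (b0 +o A) = {}"
    proof (rule ccontr)
      assume "\<not> ?thesis"
      then obtain w where "w \<in> X + Bs" "w \<in> b0 +o A" by blast
      then obtain a b where "a \<in> X" "b \<in> Bs" "a + b \<in> b0 +o A" by (auto elim: set_plus_elim)
      then show False using Xout[of a b] by (simp add: in_translate algebra_simps)
    qed
    moreover have "X + Bs \<subseteq> A + B" using finX Bs by (intro set_plus_mono2)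
    moreover have "b0 +o A \<subseteq> A + B" using b0 by (rule set_plus_mono4)
    ultimately have "card (X + Bs) + card (b0 +o A) \<le> card (A + B)"
      using card_Un_disjoint[OF finXB, of "b0 +o A"] card_mono[OF c(6), of "(X + Bs) \<union> (b0 +o A)"] c by simp
    then show ?thesis using s(6) cBs by simp
  qed
  moreover have "x0 +o Bs \<subseteq> X + Bs" using x0 by (rule set_plus_mono3)
  ultimately have XB: "x0 +o Bs = X + Bs"
    using card_subset_eq[OF finXB, of "x0 +o Bs"] card_mono[OF finXB, of "x0 +o Bs"] by simp
  define J where "J = stab Bs"
  have J: "add_subgroup J" "finite J" "periodic J Bs" 
    using Bs by (auto simp: J_def add_subgroup_stab finite_stab periodic_stab)
  have XJ: "X \<subseteq> x0 +o J"
  proof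
    fix x assume "x \<in> X"
    have "b + (x - x0) \<in> Bs" if "b \<in> Bs" for b
    proof -
      have "x + b \<in> x0 +o Bs" unfolding XB using \<open>x \<in> X\<close> that by (rule set_plus_intro)
      then show ?thesis by (simp add: in_translate algebra_simps)
    qed
    then have "x - x0 \<in> J" using Bs(2) by (simp add: J_def in_stab_iff)
    then show "x \<in> x0 +o J" by (simp add: in_translate)
  qed
  have BsG: "Bs \<subseteq> G" using Bs G by blast
  have JG: "J \<subseteq> G" unfolding J_def using stab_subset_subgroup[OF G(1) BsG Bs(1)] .
  \<comment> \<open>The rest of \<open>A\<close> can be shifted by all of \<open>B\<close> inside
    \<open>b0 +o A\<close>. Since \<open>B\<close> meets two cosets of the stabilizer
    \<open>M\<close> of \<open>Y + B\<close>, Kneser's theorem gives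
    \<open>card B \<le> 2 * card X\<close>, and \<open>X\<close> fits into a coset of
    \<open>J\<close>. So the multiple \<open>card Bs\<close> of \<open>card J\<close> is less than
    \<open>2 * card J\<close>.\<close>
  define Y where "Y = A - X"
  have "Y \<noteq> {}"
  proof
    assume "Y = {}"
    then have "A \<subseteq> x0 +o J" using XJ by (auto simp: Y_def)
    then have "J = G" using generating_cosetD[OF generating(1) J(1) JG] by blast
    then have "Bs = G" using periodic_full[OF G(1) _ BsG Bs(1)] J(3) by simp
    then show False using Bs(4) b0 G by blast
  qed
  have finY: "finite Y" "Y \<subseteq> A" using c by (auto simp: Y_def)
  have YB: "Y + B \<subseteq> b0 +o A"
  proof
    fix w assume "w \<in> Y + B"
    then obtain a b where "w = a + b" "a \<in> Y" "b \<in> B" by (auto elim: set_plus_elim)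
    then have "a - b0 + b \<in> A" by (auto simp: Y_def X_def translate_subset_iff)
    then show "w \<in> b0 +o A" using \<open>w = a + b\<close> by (simp add: in_translate algebra_simps)
  qed
  have finYB: "finite (Y + B)" "Y + B \<noteq> {}" using finite_sumset finY c \<open>Y \<noteq> {}\<close> by auto
  define M where "M = stab (Y + B)"
  have M: "add_subgroup M" "finite M" using finYB by (auto simp: M_def add_subgroup_stab finite_stab)
  have YBG: "Y + B \<subseteq> G" using sumset_subset_subgroup[OF G(1)] finY G by blast
  have MG: "M \<subseteq> G" unfolding M_def using stab_subset_subgroup[OF G(1) YBG finYB(2)] .
  have "\<not> B \<subseteq> b0 +o M"
  proof
    assume "B \<subseteq> b0 +o M"
    then have "M = G" using generating_cosetD[OF generating(2) M(1) MG] by blast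
    then have "Y + B = G" using periodic_full[OF G(1) _ YBG finYB(2)] periodic_stab[of "Y + B"] by (simp add: M_def)
    then have "card G \<le> card A" using card_mono[OF _ YB] c by simp
    moreover have "A + B \<subseteq> G" using sumset_subset_subgroup[OF G] .
    moreover have "card A \<le> card (A + B)" using card_le_sumset_left c by blast
    moreover have "finite G" using \<open>Y + B = G\<close> finYB by simp
    ultimately have "A + B = G" by (metis card_seteq le_trans)
    then show False using DG by simp
  qed
  then obtain b1 where b1: "b1 \<in> B" "b1 - b0 \<notin> M" unfolding subset_iff in_translate by blast
  have BM: "B \<subseteq> B + M" "periodic M (B + M)" using subset_plus_subgroup periodic_plus_subgroup M by blast+
  have fBM: "finite (B + M)" using finite_sumset c M by blast
  have "2 * card M \<le> card (B + M)" using two_cosets_card[OF M(1) BM(2) fBM, of b1 b0] b1 b0 BM by blast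
  moreover have "card (Y + M) + card (B + M) \<le> card (Y + B) + card M"
    using kneser_plus2[OF finY(1) c(2) \<open>Y \<noteq> {}\<close> c(4) M_def] .
  moreover have "card Y \<le> card (Y + M)" using card_mono[OF _ subset_plus_subgroup[OF M(1)]] finite_sumset finY M by blast
  moreover have "card (Y + B) \<le> card A" using card_mono[OF _ YB] c by simp
  moreover have "card A = card X + card Y" using finX c card_Diff_subset[of X A] card_mono[of A X] by (simp add: Y_def)
  moreover have "card B \<le> card (B + M)" using card_mono[OF fBM BM(1)] .
  moreover have "card X \<le> card J" using card_mono[OF _ XJ] J by simp
  ultimately have "card B \<le> 2 * card J" by linarith
  moreover have "card Bs < card B" using cBs s(9) by simp
  moreover have "card J dvd card Bs" using card_dvd_periodic[OF J(1,3) Bs(2)] .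
  ultimately have "card Bs \<le> card J"
  proof -
    obtain k where k: "card Bs = card J * k" using \<open>card J dvd card Bs\<close> by blast
    then have "card J * k < card J * 2" using \<open>card B \<le> 2 * card J\<close> \<open>card Bs < card B\<close> by linarith
    then have "k \<le> 1" using mult_less_cancel1[of "card J" k 2] by simp
    then have "card J * k \<le> card J * 1" by (intro mult_le_mono2)
    then show ?thesis using k by simp
  qed
  moreover obtain z where "z \<in> Bs" using Bs by blast
  ultimately have "Bs = z +o J" using periodic_subset_eq_coset[OF J(3) Bs(2)] by blast
  then show ?thesis using J by (auto simp: Bs_def)
qed

text \<open>With three cosets in \<open>B\<close>, removing either of two of them leaves a coset of
  a group containing \<open>H\<close>. Counting then makes \<open>B\<close> three of at most four
  \<open>H\<close>-cosets of \<open>G\<close>, like three elements of the Klein four-group, and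
  \<open>A\<close> a single \<open>H\<close>-coset, too small to generate.\<close>

lemma vosper_two_cosets:
  assumes cr: "critical_pair A B" and H: "H = stab (A + B)" and G: "add_subgroup G" "A \<subseteq> G" "B \<subseteq> G"
    and generating: "generating G A" "generating G B" and DG: "A + B \<noteq> G"
    and dich: "\<And>e. B \<inter> (- e +o A) = {} \<or> (\<exists>b. B \<inter> (- e +o A) = b +o H) \<or> B \<subseteq> - e +o A"
    and nc: "\<And>b. B \<noteq> b +o H"
  shows "\<exists>b0 b1. B = (b0 +o H) \<union> (b1 +o H) \<and> (b0 +o H) \<inter> (b1 +o H) = {}"
proof (rule ccontr)
  assume neg: "\<not> ?thesis"
  note c = critical_pairD[OF cr]
  note s = critical_pair_stab[OF cr H]
  note step = vosper_step[OF cr H G generating DG dich _ nc]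
  have per: "x +o H \<subseteq> B" if "x \<in> B" for x using periodic_coset_subset[OF s(4) that] .
  have disj: "(x +o H) \<inter> (y +o H) = {}" if "x \<notin> y +o H" for x y
    using coset_disjoint[OF s(1), of x y] that by (simp add: in_translate)
  obtain b0 where b0: "b0 \<in> B" using c by blast
  have "B - (b0 +o H) \<noteq> {}" using nc[of b0] per[OF b0] by blast
  then obtain b1 where b1: "b1 \<in> B" "b1 \<notin> b0 +o H" by blast
  have "B \<noteq> (b1 +o H) \<union> (b0 +o H)" using neg disj[OF b1(2)] by blast
  then obtain b2 where b2: "b2 \<in> B" "b2 \<notin> b0 +o H" "b2 \<notin> b1 +o H" using per b0 b1 by blast
  obtain J0 where J0: "add_subgroup J0" "finite J0" "B - (b0 +o H) = b2 +o J0"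
    using step[OF b0] coset_eqI[of _ b2] b2 by (metis DiffI)
  obtain J1 where J1: "add_subgroup J1" "finite J1" "B - (b1 +o H) = b2 +o J1"
    using step[OF b1(1)] coset_eqI[of _ b2] b2 by (metis DiffI)
  define I where "I = J0 \<inter> J1"
  have I: "add_subgroup I" "finite I" using J0 J1 by (auto simp: I_def add_subgroup_def)
  have perB0: "periodic H (B - (x +o H))" for x
    by (rule periodic_Diff[OF s(1) s(4)]) (rule periodic_coset[OF s(1)])
  have HJ: "H \<subseteq> J" if "B - (x +o H) = b2 +o J" "b2 \<notin> x +o H" for x J
  proof
    fix h assume "h \<in> H"
    have "b2 \<in> B - (x +o H)" using b2(1) that(2) by blast
    from periodicD[OF this \<open>h \<in> H\<close> perB0] have "b2 + h \<in> b2 +o J" unfolding that(1) .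
    then show "h \<in> J" by (simp add: in_translate)
  qed
  have HI: "H \<subseteq> I" using HJ[OF J0(3) b2(2)] HJ[OF J1(3) b2(3)] by (simp add: I_def)
  have card_minus: "card B = card J + card H" if "B - (x +o H) = b2 +o J" "x \<in> B" for x J
    using card_Diff_subset[OF _ per[OF that(2)]] card_mono[OF c(2) per[OF that(2)]] s(2) that
      card_translate[of b2 J] by simp
  have cJ: "card J0 = card J1" using card_minus[OF J0(3) b0] card_minus[OF J1(3) b1(1)] by simp
  have b1J: "b1 +o H \<subseteq> b2 +o J0"
    using per[OF b1(1)] disj[OF b1(2)] J0(3) by blast
  have "b2 +o I = (b2 +o J0) - (b1 +o H)"
  proof -
    have "z \<in> b2 +o I \<longleftrightarrow> z \<in> (b2 +o J0) \<inter> (b2 +o J1)" for z by (simp add: I_def in_translate)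
    then have "b2 +o I = (b2 +o J0) \<inter> (b2 +o J1)" by blast
    then show ?thesis using J0(3) J1(3) by blast
  qed
  then have cI: "card J0 = card I + card H"
    using card_Diff_subset[OF _ b1J] card_mono[OF _ b1J] J0(2) s(2) card_translate[of b2 I] by simp
  have "periodic I J0" using periodic_subgroup[OF J0(1)] by (rule periodic_mono) (simp add: I_def)
  then have "card I dvd card J0" using card_dvd_periodic[OF I(1)] J0(2) by blast
  \<comment> \<open>Up to translation \<open>I\<close> is \<open>J0\<close> without one
    \<open>H\<close>-coset, so divisibility of \<open>card J0 = card I + card H\<close> by
    \<open>card I\<close> leaves room for little more than \<open>H\<close> itself.\<close>
  then have "card I dvd card H" using cI by (simp add: dvd_add_right_iff)
  then have "card I \<le> card H" using dvd_imp_le s(9) by blast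
  then have cJ1: "card J1 \<le> 2 * card H" using cI cJ by simp
  have cB: "card B = card J1 + card H" using card_minus[OF J1(3) b1(1)] .
  define V where "V = J0 + J1"
  have V: "add_subgroup V" unfolding add_subgroup_def
  proof (intro conjI ballI)
    show "0 \<in> V" using set_plus_intro[OF subgroupD(1)[OF J0(1)] subgroupD(1)[OF J1(1)]] by (simp add: V_def)
    fix x assume "x \<in> V"
    then obtain u v where x: "x = u + v" "u \<in> J0" "v \<in> J1" by (auto simp: V_def elim: set_plus_elim)
    show "- x \<in> V" using set_plus_intro[OF subgroupD(3)[OF J0(1) x(2)] subgroupD(3)[OF J1(1) x(3)]] x(1)
      by (simp add: V_def)
    fix y assume "y \<in> V"
    then obtain u' v' where y: "y = u' + v'" "u' \<in> J0" "v' \<in> J1" by (auto simp: V_def elim: set_plus_elim)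
    show "x + y \<in> V" 
      using set_plus_intro[OF subgroupD(2)[OF J0(1) x(2) y(2)] subgroupD(2)[OF J1(1) x(3) y(3)]] x(1) y(1)
      by (simp add: V_def ac_simps)
  qed
  have sub_G: "J \<subseteq> G" if "b2 +o J \<subseteq> B" for J
  proof
    fix z assume "z \<in> J"
    then have "b2 + z \<in> G" using that G(3) by (auto simp: translate_subset_iff)
    then show "z \<in> G" using subgroupD(4)[OF G(1), of "b2 + z" b2] b2(1) G(3) by auto
  qed
  have VG: "V \<subseteq> G" unfolding V_def 
    using sub_G[of J0] sub_G[of J1] J0(3) J1(3) by (intro sumset_subset_subgroup[OF G(1)]) blast+
  have JV: "J0 \<subseteq> V" "J1 \<subseteq> V"
    using subset_plus_subgroup[OF J1(1), of J0] subset_plus_subgroup[OF J0(1), of J1]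
    by (simp_all add: V_def add.commute)
  have "B \<subseteq> b2 +o V"
  proof
    fix b assume b: "b \<in> B"
    have "b \<in> b2 +o J0 \<or> b \<in> b2 +o J1" using b J0(3) J1(3) disj[OF b1(2)] by blast
    then show "b \<in> b2 +o V" using JV by (auto simp: in_translate)
  qed
  then have "V = G" using generating_cosetD[OF generating(2) V VG] by blast
  \<comment> \<open>For \<open>u \<in> J0\<close>, the element \<open>b2 + u\<close> of
    \<open>B\<close> is either in \<open>b2 +o J1\<close> or in the removed coset
    \<open>b1 +o H\<close>; so \<open>V\<close> consists of at most two cosets of
    \<open>J1\<close>.\<close>
  have "V \<subseteq> J1 \<union> ((b1 - b2) +o J1)"
  proof
    fix w assume "w \<in> V"
    then obtain u v where w: "w = u + v" "u \<in> J0" "v \<in> J1" by (auto simp: V_def elim: set_plus_elim)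
    have u: "b2 + u \<in> B" using w(2) J0(3) by auto
    show "w \<in> J1 \<union> ((b1 - b2) +o J1)"
    proof (cases "b2 + u \<in> b1 +o H")
      case True
      then have "u - (b1 - b2) \<in> J1" using HI by (auto simp: in_translate I_def algebra_simps)
      then have "(u - (b1 - b2)) + v \<in> J1" using w subgroupD(2)[OF J1(1)] by blast
      then show ?thesis using w(1) by (simp add: in_translate algebra_simps)
    next
      case False
      then have "b2 + u \<in> b2 +o J1" using u J1(3) by blast
      then have "u \<in> J1" by (simp add: in_translate)
      then show ?thesis using w subgroupD(2)[OF J1(1)] by blast
    qed
  qed
  then have "card G \<le> card (J1 \<union> ((b1 - b2) +o J1))" "finite G"
    using J1(2) \<open>V = G\<close> finite_subset[of V "J1 \<union> ((b1 - b2) +o J1)"] card_mono[of "J1 \<union> ((b1 - b2) +o J1)" V] by auto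
  moreover have "card (J1 \<union> ((b1 - b2) +o J1)) \<le> 2 * card J1" using card_Un_le[of J1 "(b1 - b2) +o J1"] by simp
  ultimately have cG: "card G \<le> 4 * card H" using cJ1 by linarith
  have DinG: "A + B \<subseteq> G" using sumset_subset_subgroup[OF G] .
  have HG: "H \<subseteq> G" unfolding H using stab_subset_subgroup[OF G(1) DinG c(7)] .
  have "periodic H (G - (A + B))"
    by (rule periodic_Diff[OF s(1) periodic_mono[OF periodic_subgroup[OF G(1)] HG] s(5)])
  then have "card H \<le> card (G - (A + B))"
    using card_le_periodic(1)[of H "G - (A + B)"] DG DinG \<open>finite G\<close> by blast
  then have "card (A + B) + card H \<le> card G"
    using card_Diff_subset[OF c(6) DinG] card_mono[OF \<open>finite G\<close> DinG] by simp
  then have "card A \<le> card H" using s(6) cG cB cI cJ HI card_mono[OF I(2) HI] by linarith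
  obtain a where a: "a \<in> A" using c by blast
  have "A = a +o H" using periodic_subset_eq_coset[OF s(3) c(1) a \<open>card A \<le> card H\<close>] .
  then have "H = G" using generating_cosetD[OF generating(1) s(1) HG] by blast
  then show False using periodic_full[OF G(1) _ DinG c(7)] s(5) DG by simp
qed

lemma dyson_subset: "(A \<union> B) + (A \<inter> B) \<subseteq> A + (B::'a::ab_group_add set)"
proof
  fix w assume "w \<in> (A \<union> B) + (A \<inter> B)"
  then obtain x y where xy: "w = x + y" "x \<in> A \<union> B" "y \<in> A \<inter> B" by (auto elim: set_plus_elim)
  show "w \<in> A + B"
  proof (cases "x \<in> A")
    case False
    then show ?thesis using xy set_plus_intro[of y A x B] by (simp add: add.commute)
  qed (use xy set_plus_intro[of x A y B] in simp)
qed

lemma periodic_sum_Diff: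
  assumes K: "add_subgroup K" and "A \<subseteq> K" "periodic K (B - (y +o K))"
  shows "periodic K ((A + B) - (y +o K))"
proof -
  have "(A + B) - (y +o K) = A + (B - (y +o K))"
  proof -
    have "a + b \<in> y +o K \<longleftrightarrow> b \<in> y +o K" if "a \<in> A" for a b
      using that assms(2) subgroup_add_iff(2)[OF K, of a "b - y"] by (auto simp: in_translate algebra_simps)
    then show ?thesis by (fastforce elim!: set_plus_elim)
  qed
  then show ?thesis using assms(3) periodic_plus by metis
qed

text \<open>A beat relative to the closure \<open>K\<close> of \<open>B\<close>. The generating set
  \<open>A\<close> leaves its one exceptional coset, and the nonempty periodic rest makes
  \<open>K\<close> finite.\<close>

lemma nongenerating_quasi_periodic:
  assumes cr: "critical_pair A B" and G: "add_subgroup G" "A \<subseteq> G" "B \<subseteq> G"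
    and generating: "generating G A" "\<not> generating G B" and nc: "\<And>b. B \<noteq> b +o stab (A + B)"
  shows "\<exists>K p. quasi_periodic K p (A + B) \<and> K \<subset> G"
proof -
  note c = critical_pairD[OF cr]
  note s = critical_pair_stab[OF cr HOL.refl]
  let ?H = "stab (A + B)"
  obtain b where b: "b \<in> B" using c by blast
  obtain K where K: "add_subgroup K" "K \<subseteq> G" "B \<subseteq> b +o K"
    and least: "\<And>L z. add_subgroup L \<Longrightarrow> B \<subseteq> z +o L \<Longrightarrow> K \<subseteq> L"
    using closure_exists[OF G(1,3) b] by metis
  have KG: "K \<subset> G" using generating(2) least K(2) unfolding generating_def by blast
  define B0 where "B0 = - b +o B"
  have B0K: "B0 \<subseteq> K" using translate_mono_iff[of b B0 K] K(3) by (simp add: B0_def)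
  have genB0: "generating K B0" unfolding B0_def generating_translate using least unfolding generating_def by blast
  have sumeq: "B0 + A = - b +o (A + B)"
    using translate_plus[of "- b" B 0 A] by (simp add: B0_def add.commute[of B])
  have cr0: "critical_pair B0 A" using critical_pair_translate[OF critical_pair_commute[OF cr], of "- b" 0] by (simp add: B0_def)
  have "B0 \<noteq> K"
  proof
    assume "B0 = K"
    then have B: "B = b +o K" by (metis B0_def translate_uminus(2))
    then have "periodic K B" using K(1) by (simp add: periodic_subgroup)
    then have "K \<subseteq> ?H" using periodic_imp_subset_stab[OF c(2)] s(8) by simp
    moreover have "?H \<subseteq> K" using stab_subset_coset[OF K(1,3) c(4)] s(8) by simp
    ultimately show False using nc[of b] B by simp
  qed
  then obtain y where y: "y \<in> A" "periodic K (A - (y +o K))" "\<not> y +o K \<subseteq> B0 + A"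
    using subgroup_beat[OF cr0 K(1) B0K genB0] by metis
  have "A - (y +o K) \<noteq> {}" using generating(1) K(1) KG unfolding generating_def by blast
  then have "finite K" using card_le_periodic(2)[OF y(2)] c by blast
  moreover have "y \<in> (B0 + A) \<inter> (y +o K)"
    using set_plus_intro[of 0 B0 y A] y(1) b coset_self[OF K(1)] by (simp add: B0_def in_translate)
  ultimately have "quasi_periodic K y (- b +o (A + B))"
    unfolding quasi_periodic_def using K(1) y(3) periodic_sum_Diff[OF K(1) B0K y(2)] sumeq by auto
  from quasi_periodic_translate[OF this, of b] show ?thesis using KG by auto
qed

text \<open>The sum is the invariant of the Dyson transforms, up to translation, which is why the
  second alternative speaks of \<open>A + B\<close> only. With \<open>B\<close> generating, the
  descent on \<open>card B\<close> stops when no transform leaves a proper part of \<open>B\<close>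
  with more than one \<open>H\<close>-coset; then \<open>B\<close> has just two
  \<open>H\<close>-cosets, whose difference is \<open>d\<close>, and \<open>A'\<close> is a
  translate of the current \<open>A\<close>. The set \<open>A\<close> only grows and so keeps
  generating \<open>G\<close>.\<close>

lemma quasi_periodic_or_progression:
  assumes G: "add_subgroup G" "A \<subseteq> G" "B \<subseteq> G" and cr: "critical_pair A B" and H: "H = stab (A + B)"
    and DG: "A + B \<noteq> G" and generating: "generating G A" and nc: "\<And>b. B \<noteq> b +o H"
  shows "(\<exists>K p. quasi_periodic K p (A + B) \<and> K \<subset> G) \<or>
    (\<exists>A' d. A + B = A' \<union> (d +o A') \<and> card (A + B) = card A' + card H \<and> d \<in> G \<and>
       (\<forall>K. add_subgroup K \<longrightarrow> K \<subseteq> G \<longrightarrow> H \<subseteq> K \<longrightarrow> d \<in> K \<longrightarrow> K = G))"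
    (is "?Q (A + B) \<or> ?P (A + B)")
  using G(2,3) cr H DG generating nc
proof (induction "card B" arbitrary: A B rule: less_induct)
  case less
  note cr = less.prems(3) and H = less.prems(4) and DG = less.prems(5)
  note c = critical_pairD[OF cr]
  note s = critical_pair_stab[OF cr H]
  have DinG: "A + B \<subseteq> G" using sumset_subset_subgroup[OF G(1)] less.prems by blast
  show ?case
  proof (cases "generating G B")
    case False
    then show ?thesis
      using nongenerating_quasi_periodic[OF cr G(1) less.prems(1,2,6)] less.prems(7) H by blast
  next
    case gB: True
    show ?thesis
    proof (cases "\<forall>e. B \<inter> (- e +o A) = {} \<or> (\<exists>b. B \<inter> (- e +o A) = b +o H) \<or> B \<subseteq> - e +o A")
      case True
      obtain b0 b1 where B: "B = (b0 +o H) \<union> (b1 +o H)" "(b0 +o H) \<inter> (b1 +o H) = {}"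
        using vosper_two_cosets[OF cr H G(1) less.prems(1,2,6) gB DG] True less.prems(7) by blast
      define d where "d = b1 - b0"
      define A' where "A' = b0 +o A"
      have b: "b0 \<in> B" "b1 \<in> B" using B coset_self[OF s(1)] by blast+
      have "card B = 2 * card H" using B s(2) by (simp add: card_Un_disjoint)
      then have "card (A + B) = card A' + card H" using s(6) by (simp add: A'_def)
      moreover have "A + B = A' \<union> (d +o A')"
      proof -
        have "A + (x +o H) = x +o A" for x
          using plus_subgroup_eq[OF s(1,3)] by (simp add: set_plus_rearrange4)
        moreover have "d +o A' = b1 +o A" by (simp add: A'_def d_def set_plus_rearrange2)
        ultimately show ?thesis using B(1) by (simp add: set_plus_Un A'_def)
      qed
      moreover have "d \<in> G" using b less.prems(2) subgroupD(4)[OF G(1)] by (auto simp: d_def)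
      moreover have "K = G" if K: "add_subgroup K" "K \<subseteq> G" "H \<subseteq> K" "d \<in> K" for K
      proof (rule generating_cosetD[OF gB K(1,2)])
        have "b0 +o H \<subseteq> b0 +o K" using K(3) by simp
        moreover have "b1 +o H \<subseteq> b1 +o K" using K(3) by simp
        moreover have "b1 +o K = b0 +o K" using coset_eq_iff[OF K(1)] K(4) by (simp add: d_def)
        ultimately show "B \<subseteq> b0 +o K" using B(1) by blast
      qed
      ultimately show ?thesis by blast
    next
      case False
      then obtain e where e: "B \<inter> (- e +o A) \<noteq> {}" "\<And>b. B \<inter> (- e +o A) \<noteq> b +o H" "\<not> B \<subseteq> - e +o A"
        by blast
      define S B2 where "S = B \<inter> (- e +o A)" and "B2 = e +o B"
      have S: "e +o S = A \<inter> B2"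
      proof (rule set_eqI)
        show "z \<in> e +o S \<longleftrightarrow> z \<in> A \<inter> B2" for z by (auto simp: S_def B2_def in_translate)
      qed
      obtain b where b: "b \<in> B" "e + b \<in> A" using e(1) by (auto simp: in_translate add.commute)
      have eG: "e \<in> G" using subgroupD(4)[OF G(1), of "e + b" b] b less.prems(1,2) by auto
      have cr2: "critical_pair A B2" using critical_pair_translate[OF cr, of 0 e] by (simp add: B2_def)
      have AB2: "A + B2 = e +o (A + B)" using translate_plus[of 0 A e B] by (simp add: B2_def)
      have ne: "A \<inter> B2 \<noteq> {}" using b by (auto simp: B2_def in_translate)
      define D' where "D' = (A \<union> B2) + (A \<inter> B2)"
      have D': "D' \<subseteq> e +o (A + B)" using dyson_subset[of A B2] AB2 by (simp add: D'_def)
      have finD': "finite D'" using finite_subset[OF D'] c by simp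
      have neD': "D' \<noteq> {}" using ne by (auto simp: D'_def)
      have D'G: "D' \<subseteq> G" 
      proof -
        have "e +o (A + B) \<subseteq> G" using DinG eG subgroupD(2)[OF G(1)] by (auto simp: translate_subset_iff)
        then show ?thesis using D' by blast
      qed
      show ?thesis
      proof (cases "stab D' = H")
        case False
        then have "stab D' \<noteq> stab (A + B2)" using H by (simp add: AB2)
        then obtain p where "quasi_periodic (stab D') p (e +o (A + B))"
          using dyson_quasi_periodic[OF cr2 ne, of "stab D'"] unfolding AB2 by (auto simp: D'_def)
        from quasi_periodic_translate[OF this, of "- e"]
        have q: "quasi_periodic (stab D') (- e + p) (A + B)" by simp
        have "stab D' \<noteq> G"
        proof
          assume "stab D' = G"
          then have "D' = G" using periodic_full[OF G(1) _ D'G neD'] periodic_stab[of D'] by simp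
          then have "card G \<le> card (A + B)" "finite G" using card_mono[OF _ D'] c finD' by simp_all
          then show False using DG DinG card_seteq by blast
        qed
        then show ?thesis using q stab_subset_subgroup[OF G(1) D'G neD'] by blast
      next
        case True
        have finS: "finite S" "S \<noteq> {}" using c e by (auto simp: S_def)
        have fA': "finite (A \<union> B2)" "A \<union> B2 \<noteq> {}" "finite (A \<inter> B2)" using c by (auto simp: B2_def)
        have ca: "card (A \<union> B2) + card (A \<inter> B2) = card (A + B) + card H"
          using card_Un_Int[of A B2] c s(6) by (simp add: B2_def)
        have "card (A \<union> B2) + card (A \<inter> B2) \<le> card D' + card H"
          using kneser[of "A \<union> B2" "A \<inter> B2"] fA' ne True by (simp add: D'_def)
        \<comment> \<open>With the stabilizer unchanged, Kneser's bound already forces the full sum;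
          so the transformed pair attains equality and is critical again.\<close>
        then have "card (A + B) \<le> card D'" using ca by linarith
        then have De: "D' = e +o (A + B)" using card_seteq[OF _ D'] c by simp
        have "critical_pair (A \<union> B2) (A \<inter> B2)"
          using critical_pair_if_card_eq[of "A \<union> B2" "A \<inter> B2"] fA' ne ca True De by (simp add: D'_def[symmetric])
        from critical_pair_translate[OF this, of 0 "- e"] have crS: "critical_pair (A \<union> B2) S" by (simp add: S[symmetric])
        have sumS: "(A \<union> B2) + S = A + B"
        proof -
          have "(A \<union> B2) + (e +o S) = e +o (A + B)" using De by (simp add: D'_def S)
          then show ?thesis by (simp add: set_plus_rearrange4)
        qed
        have "S \<subset> B" using e(3) by (auto simp: S_def)
        then have lt: "card S < card B" using c(2) psubset_card_mono by blast
        have B2G: "A \<union> B2 \<subseteq> G" using less.prems(1,2) eG subgroupD(2)[OF G(1)] 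
          by (auto simp: B2_def elt_set_plus_def)
        show ?thesis
          using less.hyps[OF lt B2G _ crS] sumS H DG generating_mono[OF less.prems(6)] e(2) less.prems(2)
          by (auto simp: S_def)
      qed
    qed
  qed
qed

section \<open>Progressions and quasi-periodic pairs\<close>

text \<open>Defined by iterated addition, in the manner of \<open>add_coset\<close>.\<close>

definition nmult :: "nat \<Rightarrow> 'a::ab_group_add \<Rightarrow> 'a" where
  "nmult n d = ((+) d ^^ n) 0"

lemma nmult_simps [simp]: "nmult 0 d = 0" "nmult (Suc n) d = d + nmult n d"
  by (simp_all add: nmult_def)

lemma nmult_uminus: "nmult n (- d) = - nmult n d"
  by (induction n) auto

lemma nmult_add: "nmult (m + n) d = nmult m d + nmult n d"
  by (induction m) (auto simp: ac_simps)

text \<open>For \<open>H \<subseteq> G\<close> this says that the class of \<open>d\<close>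
  generates \<open>G/H\<close>. It is phrased by subgroups because it is applied to
  stabilizers.\<close>

definition generates_mod :: "'a::ab_group_add set \<Rightarrow> 'a set \<Rightarrow> 'a \<Rightarrow> bool" where
  "generates_mod G H d \<longleftrightarrow> d \<in> G \<and>
     (\<forall>K. add_subgroup K \<longrightarrow> K \<subseteq> G \<longrightarrow> H \<subseteq> K \<longrightarrow> d \<in> K \<longrightarrow> K = G)"

lemma generates_mod_periodic_full:
  assumes G: "add_subgroup G" and d: "generates_mod G H d"
    and S: "finite S" "S \<noteq> {}" "S \<subseteq> G" "periodic H S" "\<And>s. s \<in> S \<Longrightarrow> s + d \<in> S"
  shows "S = G"
proof -
  have "stab S = G"
    using d add_subgroup_stab[of S] stab_subset_subgroup[OF G S(3,2)] 
      periodic_imp_subset_stab[OF S(1,4)] in_stab_iff[OF S(1), of d] S(5)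
    unfolding generates_mod_def by blast
  then show ?thesis using periodic_full[OF G _ S(3,2)] periodic_stab[of S] by simp
qed

lemma card_Un_Diff: "finite S \<Longrightarrow> finite T \<Longrightarrow> card (S \<union> T) = card S + card (T - S)"
  using card_Un_disjoint[of S "T - S"] by simp

lemma translate_Un: "d +o (S \<union> T) = (d +o S) \<union> (d +o (T::'a::ab_group_add set))"
  by (auto simp: in_translate)

lemma translate_Diff: "(d +o S) - (d +o T) = d +o (S - (T::'a::ab_group_add set))"
  by (auto simp: in_translate)

lemma periodic_Un: "periodic K S \<Longrightarrow> periodic K T \<Longrightarrow> periodic K (S \<union> T)"
  unfolding periodic_def by blast

text \<open>The elements of \<open>S\<close> whose predecessor \<open>s - d\<close> is missing form
  at most one \<open>H\<close>-coset by the size bound, and at least one because \<open>S\<close> is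
  not \<open>G\<close>. All of \<open>S\<close> is a single run starting there.\<close>

lemma progression_structure:
  assumes G: "add_subgroup G" and H: "add_subgroup H" and d: "generates_mod G H d"
    and S: "finite S" "S \<noteq> {}" "S \<subseteq> G" "periodic H S" "S \<noteq> G"
    and le: "card (S \<union> (d +o S)) \<le> card S + card H"
  obtains q k where "S = (\<Union>i\<in>{0..k}. (q + nmult i d) +o H)" "q \<in> S" "q - d \<notin> S"
proof -
  define F where "F = S - (d +o S)"
  have full: "T = G" if "T \<subseteq> S" "T \<noteq> {}" "periodic H T" "\<And>s. s \<in> T \<Longrightarrow> s + d \<in> T" for T
    using generates_mod_periodic_full[OF G d] that S finite_subset[of T S] by blast
  have "F \<noteq> {}"
  proof
    assume "F = {}"
    then have "S \<subseteq> d +o S" by (auto simp: F_def)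
    then have "S = d +o S" using card_subset_eq[of "d +o S" S] S by simp
    then have "s + d \<in> S" if "s \<in> S" for s using that by (metis add.commute set_plus_intro2)
    then show False using full[OF _ S(2,4)] S(5) by blast
  qed
  then obtain q where q: "q \<in> F" by blast
  have perF: "periodic H F" unfolding F_def by (rule periodic_Diff[OF H S(4)]) (simp add: S(4))
  have finF: "finite F" using S by (simp add: F_def)
  have "card ((d +o S) \<union> S) = card S + card F" using card_Un_Diff[of "d +o S" S] S by (simp add: F_def)
  then have "card F \<le> card H" using le by (simp add: Un_commute)
  then have F: "F = q +o H" using periodic_subset_eq_coset[OF perF finF q] by blast
  \<comment> \<open>The run from \<open>q\<close> stays in \<open>S\<close> up to step
    \<open>i\<close>. Stopping at the first exit matters, since in a finite quotient the multiples
    of \<open>d\<close> come back to \<open>S\<close> later.\<close>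
  define good where "good i \<longleftrightarrow> (\<forall>j\<le>i. q + nmult j d \<in> S)" for i
  define T where "T = {s \<in> S. \<exists>i. good i \<and> s \<in> (q + nmult i d) +o H}"
  have cos: "y \<in> S" if "s \<in> S" "s \<in> y +o H" for s y
  proof -
    have "y - s \<in> H" using that(2) subgroup_diff_comm[OF H] by (auto simp: in_translate)
    from periodicD[OF that(1) this S(4)] show ?thesis by simp
  qed
  have good0: "good 0" using q by (simp add: good_def F_def)
  have goodSuc: "good (Suc i)" if "good i" "q + nmult (Suc i) d \<in> S" for i
    using that by (auto simp: good_def le_Suc_eq)
  have perT: "periodic H T" unfolding periodic_def
  proof (intro ballI)
    fix s h assume s: "s \<in> T" and h: "h \<in> H"
    then obtain i where i: "good i" "s \<in> (q + nmult i d) +o H" by (auto simp: T_def)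
    have "s + h \<in> (q + nmult i d) +o H" using periodicD[OF i(2) h] periodic_coset[OF H] by blast
    moreover have "s + h \<in> S" using periodicD[OF _ h S(4)] s by (auto simp: T_def)
    ultimately show "s + h \<in> T" using i by (auto simp: T_def)
  qed
  \<comment> \<open>Subtracting \<open>d\<close> does not leave \<open>S - T\<close>, so for this
    finite set \<open>d\<close> is a period; if nonempty, it would be all of
    \<open>G\<close>.\<close>
  have "S - T = {}"
  proof (rule ccontr)
    assume ne: "S - T \<noteq> {}"
    have "s - d \<in> S - T" if s: "s \<in> S - T" for s
    proof -
      have "s \<notin> F"
      proof
        assume "s \<in> F"
        then have "s \<in> (q + nmult 0 d) +o H" using F by simp
        then show False using s good0 by (auto simp: T_def)
      qed
      then have sd: "s - d \<in> S" using s by (simp add: F_def in_translate)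
      have "s - d \<notin> T"
      proof
        assume "s - d \<in> T"
        then obtain i where i: "good i" "s - d \<in> (q + nmult i d) +o H" by (auto simp: T_def)
        then have "s \<in> (q + nmult (Suc i) d) +o H" by (simp add: in_translate algebra_simps)
        moreover from this have "good (Suc i)" using goodSuc[OF i(1)] cos s by blast
        ultimately show False using s by (auto simp: T_def)
      qed
      then show ?thesis using sd by blast
    qed
    then have "- d \<in> stab (S - T)" using S(1) by (simp add: in_stab_iff)
    then have "d \<in> stab (S - T)" using subgroupD(3)[OF add_subgroup_stab, of "- d" "S - T"] by simp
    then have "s + d \<in> S - T" if "s \<in> S - T" for s using that S(1) by (simp add: in_stab_iff)
    then have "S - T = G" using full[OF _ ne periodic_Diff[OF H S(4) perT]] by blast
    then show False using S by blast
  qed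
  then have ST: "S = T" by (auto simp: T_def)
  have "\<exists>i. \<not> good i"
  proof (rule ccontr)
    assume "\<not> ?thesis"
    then have allgood: "good i" for i by blast
    have "s + d \<in> S" if "s \<in> S" for s
    proof -
      have "s \<in> T" using that ST by blast
      then obtain i where i: "s \<in> (q + nmult i d) +o H" by (auto simp: T_def)
      then have "s + d - (q + nmult (Suc i) d) \<in> H" by (simp add: in_translate algebra_simps)
      moreover have "q + nmult (Suc i) d \<in> S" using allgood[of "Suc i"] unfolding good_def by blast
      ultimately have "(q + nmult (Suc i) d) + (s + d - (q + nmult (Suc i) d)) \<in> S"
        using periodicD[OF _ _ S(4)] by blast
      then show ?thesis by (simp add: add.commute)
    qed
    then show False using full[OF _ S(2,4)] S(5) by blast
  qed
  then obtain m where m: "\<not> good m" "\<And>i. i < m \<Longrightarrow> good i" 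
    using exists_least_iff[of "\<lambda>i. \<not> good i"] by blast
  then obtain k where k: "m = Suc k" using good0 by (cases m) auto
  have goodle: "good i \<longleftrightarrow> i \<le> k" for i
  proof
    assume "good i"
    show "i \<le> k"
    proof (rule ccontr)
      assume "\<not> i \<le> k"
      then have "Suc k \<le> i" by simp
      then have "good (Suc k)" using \<open>good i\<close> unfolding good_def by (meson le_trans)
      then show False using m(1) k by simp
    qed
  qed (use m(2) k in auto)
  have "S = (\<Union>i\<in>{0..k}. (q + nmult i d) +o H)"
  proof
    show "S \<subseteq> (\<Union>i\<in>{0..k}. (q + nmult i d) +o H)" 
      by (subst ST) (auto simp: T_def goodle)
    show "(\<Union>i\<in>{0..k}. (q + nmult i d) +o H) \<subseteq> S"
    proof (rule UN_least)
      fix i assume "i \<in> {0..k}"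
      then have "q + nmult i d \<in> S" using goodle[of i] by (simp add: good_def)
      then show "(q + nmult i d) +o H \<subseteq> S" by (rule periodic_coset_subset[OF S(4)])
    qed
  qed
  then show ?thesis using that q by (simp add: F_def in_translate)
qed

text \<open>Shifting by \<open>d\<close> adds at most \<open>card H\<close> elements to
  \<open>A + B\<close>, and again to \<open>D2\<close>. What the second shift adds is nonempty and
  periodic under the stabilizer of \<open>D2\<close>, so this stabilizer has at most
  \<open>card H\<close> elements. Kneser's theorem for \<open>(A \<union> (d +o A)) + B = D2\<close>
  then gives the bound.\<close>

lemma progression_summand:
  assumes G: "add_subgroup G" "A \<subseteq> G" "B \<subseteq> G" and cr: "critical_pair A B" and H: "H = stab (A + B)"
    and d: "generates_mod G H d"
    and D: "A + B = A' \<union> (d +o A')" "card (A + B) = card A' + card H"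
    and ne: "(A + B) \<union> (d +o (A + B)) \<noteq> G"
  shows "card (A \<union> (d +o A)) \<le> card A + card H"
proof -
  define D2 where "D2 = (A + B) \<union> (d +o (A + B))"
  note c = critical_pairD[OF cr]
  note s = critical_pair_stab[OF cr H]
  have step: "card ((d +o (S \<union> (d +o S))) - (S \<union> (d +o S))) \<le> card ((d +o S) - S)" if "finite S" for S
  proof -
    have "(d +o (S \<union> (d +o S))) - (S \<union> (d +o S)) \<subseteq> (d +o (d +o S)) - (d +o S)"
      unfolding translate_Un by blast
    also have "\<dots> = d +o ((d +o S) - S)" by (simp add: translate_Diff)
    finally show ?thesis using card_mono[of "d +o ((d +o S) - S)"] that by simp
  qed
  have finA': "finite A'" using c(6) D(1) by simp
  have "card ((d +o A') - A') = card H" using card_Un_Diff[of A' "d +o A'"] finA' D by simp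
  then have s1: "card ((d +o (A + B)) - (A + B)) \<le> card H" using step[OF finA'] by (simp only: D(1))
  then have cD2: "card D2 \<le> card (A + B) + card H" using card_Un_Diff[of "A + B" "d +o (A + B)"] c(6) by (simp add: D2_def)
  have s2: "card ((d +o D2) - D2) \<le> card H" using step[OF c(6)] s1 by (simp add: D2_def)
  have finD2: "finite D2" "D2 \<noteq> {}" using c by (auto simp: D2_def)
  have dG: "d \<in> G" using d by (simp add: generates_mod_def)
  have DG: "A + B \<subseteq> G" using sumset_subset_subgroup[OF G] .
  have D2G: "D2 \<subseteq> G" using DG dG subgroupD(2)[OF G(1)] by (auto simp: D2_def elt_set_plus_def)
  have sum: "(A \<union> (d +o A)) + B = D2" by (simp add: D2_def Un_set_plus set_plus_rearrange3)
  define L where "L = stab D2"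
  have L: "add_subgroup L" "periodic L D2" by (auto simp: L_def add_subgroup_stab periodic_stab)
  have HD2: "periodic H D2" unfolding D2_def by (rule periodic_Un) (simp_all add: s(5))
  have "(d +o D2) - D2 \<noteq> {}"
  proof
    assume "(d +o D2) - D2 = {}"
    then have "s + d \<in> D2" if "s \<in> D2" for s using that set_plus_intro2[of s D2 d] by (auto simp: add.commute)
    then have "D2 = G" using generates_mod_periodic_full[OF G(1) d finD2 D2G HD2] by blast
    then show False using ne by (simp add: D2_def)
  qed
  moreover have "periodic L ((d +o D2) - D2)" by (rule periodic_Diff[OF L(1)]) (simp_all add: L(2))
  ultimately have "card L \<le> card ((d +o D2) - D2)"
    using card_le_periodic(1)[of L "(d +o D2) - D2"] finD2 by simp
  then have "card L \<le> card H" using s2 by simp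
  moreover have "card (A \<union> (d +o A)) + card B \<le> card D2 + card L"
    using kneser[of "A \<union> (d +o A)" B] c by (simp add: sum L_def)
  ultimately show ?thesis using cD2 s(6) by linarith
qed

text \<open>The exceptional coset of the sum arises from one pair of cosets only, those of
  \<open>x\<close> and \<open>y\<close>. The last two conditions say that \<open>A + L\<close> and
  \<open>B + L\<close> attain equality in Kneser's theorem with stabilizer \<open>L\<close>.\<close>

definition quasi_split :: "'a::ab_group_add set \<Rightarrow> 'a set \<Rightarrow> 'a set \<Rightarrow> 'a \<Rightarrow> 'a \<Rightarrow> bool" where
  "quasi_split A B L x y \<longleftrightarrow> add_subgroup L \<and> finite L \<and> x \<in> A \<and> y \<in> B \<and>
     periodic L (A - (x +o L)) \<and> periodic L (B - (y +o L)) \<and>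
     (\<forall>a\<in>A. \<forall>b\<in>B. a + b \<in> (x + y) +o L \<longrightarrow> a \<in> x +o L \<and> b \<in> y +o L) \<and>
     quasi_periodic L (x + y) (A + B) \<and> stab ((A + B) + L) = L \<and>
     card (A + L) + card (B + L) = card ((A + B) + L) + card L"

lemma plus_subgroup_plus_subgroup:
  assumes "add_subgroup L"
  shows "(A + L) + (B + L) = (A + B) + L"
proof -
  have "(A + L) + (B + L) = (A + B) + (L + L)" by (simp add: ac_simps)
  then show ?thesis using plus_subgroup_eq[OF assms periodic_subgroup[OF assms]] by simp
qed

text \<open>\<open>L\<close> is the stabilizer of the sum with its exceptional coset filled. A
  missing element limits how much the summands can contain in cosets that contribute to the
  exceptional one, so these have many holes; Kneser's theorem for \<open>A + L\<close> and
  \<open>B + L\<close> leaves room for the holes of one such pair only.\<close>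

lemma quasi_split_exists:
  assumes G: "add_subgroup G" "A \<subseteq> G" "B \<subseteq> G" and cr: "critical_pair A B"
    and q: "quasi_periodic K p (A + B)" "K \<subseteq> G" and ne: "(A + B) \<union> (p +o K) \<noteq> G"
  obtains L x y where "quasi_split A B L x y" "K \<subseteq> L" "L \<subset> G" "p \<in> (x + y) +o L"
    "(A + B) + L = (A + B) \<union> (p +o K)"
proof -
  note c = critical_pairD[OF cr]
  note s = critical_pair_stab[OF cr HOL.refl]
  define D P F where "D = A + B" and "P = p +o K" and "F = D \<union> P"
  define L where "L = stab F"
  have K: "add_subgroup K" "finite K" "periodic K (D - P)" "D \<inter> P \<noteq> {}" "\<not> P \<subseteq> D"
    using q unfolding quasi_periodic_def D_def P_def by auto
  have fin: "finite D" "finite F" "F \<noteq> {}" using c K by (auto simp: D_def F_def P_def)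
  have L: "add_subgroup L" "finite L" "periodic L F"
    using fin by (auto simp: L_def add_subgroup_stab finite_stab periodic_stab)
  have "periodic K F"
  proof -
    have "F = (D - P) \<union> P" by (auto simp: F_def)
    moreover have "periodic K P" unfolding P_def by (rule periodic_coset[OF K(1)])
    ultimately show ?thesis using periodic_Un[OF K(3)] by metis
  qed
  then have KL: "K \<subseteq> L" unfolding L_def using periodic_imp_subset_stab fin by blast
  obtain d where d: "d \<in> D" "d \<in> P" using K(4) by blast
  have PK: "P = d +o K" using coset_eqI[OF K(1)] d by (auto simp: P_def)
  obtain x y where xy: "d = x + y" "x \<in> A" "y \<in> B" using d(1) by (auto simp: D_def elim: set_plus_elim)
  define PL where "PL = (x + y) +o L"
  have DG: "D \<subseteq> G" unfolding D_def using sumset_subset_subgroup[OF G] .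
  have "P \<subseteq> G" using PK q(2) d DG subgroupD(2)[OF G(1)] by (auto simp: elt_set_plus_def)
  then have FG: "F \<subseteq> G" using DG by (simp add: F_def)
  have LG: "L \<subset> G"
    using stab_subset_subgroup[OF G(1) FG fin(3)] periodic_full[OF G(1) _ FG fin(3)] L(3) ne
    by (auto simp: L_def F_def D_def P_def)
  have PPL: "P \<subseteq> PL" using PK KL xy by (simp add: PL_def)
  have PLF: "PL \<subseteq> F" unfolding PL_def using d xy by (intro periodic_coset_subset[OF L(3)]) (simp add: F_def)
  have DL: "D + L = F"
  proof
    have "F + L = F" using plus_subgroup_eq[OF L(1,3)] .
    moreover have "D + L \<subseteq> F + L" by (rule set_plus_mono2) (auto simp: F_def)
    ultimately show "D + L \<subseteq> F" by simp
    have "d +o L \<subseteq> D + L" using d(1) by (rule set_plus_mono3)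
    then show "F \<subseteq> D + L" using subset_plus_subgroup[OF L(1), of D] PPL xy(1) by (auto simp: F_def PL_def)
  qed
  obtain c0 where c0: "c0 \<in> PL" "c0 \<notin> D" using K(5) PPL by blast
  have quasiL: "quasi_periodic L (x + y) D"
  proof -
    have "D - PL = F - PL" using PPL by (auto simp: F_def)
    moreover have "periodic L (F - PL)" unfolding PL_def by (rule periodic_Diff[OF L(1,3) periodic_coset[OF L(1)]])
    ultimately have "periodic L (D - ((x + y) +o L))" by (simp add: PL_def)
    then show ?thesis using L c0 d xy coset_self[OF L(1)] by (auto simp: quasi_periodic_def PL_def)
  qed
  \<comment> \<open>Reflection at the missing element \<open>c0\<close> carries
    \<open>B \<inter> (b +o L)\<close> into \<open>a +o L\<close> and off \<open>A\<close>.\<close>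
  have bad: "card (A \<inter> (a +o L)) + card (B \<inter> (b +o L)) \<le> card L" 
    if "a \<in> A" "b \<in> B" "a + b \<in> PL" for a b
  proof -
    let ?M = "(\<lambda>w. c0 - w) ` (B \<inter> (b +o L))"
    have "PL = (a + b) +o L" using coset_eqI[OF L(1)] that(3) by (simp add: PL_def)
    then have c0': "c0 - (a + b) \<in> L" using c0(1) by (simp add: in_translate)
    have "?M \<subseteq> a +o L"
    proof
      fix z assume "z \<in> ?M"
      then obtain w where w: "z = c0 - w" "w - b \<in> L" by (auto simp: in_translate)
      then have "(c0 - (a + b)) - (w - b) \<in> L" using subgroupD(4)[OF L(1) c0'] by blast
      moreover have "(c0 - (a + b)) - (w - b) = z - a" using w(1) by (simp add: algebra_simps)
      ultimately show "z \<in> a +o L" by (simp add: in_translate)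
    qed
    moreover have "(A \<inter> (a +o L)) \<inter> ?M = {}"
    proof (rule ccontr)
      assume "\<not> ?thesis"
      then obtain w where "c0 - w \<in> A" "w \<in> B" by auto
      then have "(c0 - w) + w \<in> D" unfolding D_def by (rule set_plus_intro)
      then show False using c0 by simp
    qed
    moreover have "card ?M = card (B \<inter> (b +o L))" by (rule card_image) (auto simp: inj_on_def)
    moreover have "finite (A \<inter> (a +o L))" "finite ?M" using c by auto
    ultimately have "card (A \<inter> (a +o L)) + card (B \<inter> (b +o L)) = card ((A \<inter> (a +o L)) \<union> ?M)"
      by (simp add: card_Un_disjoint)
    also have "\<dots> \<le> card (a +o L)" using \<open>?M \<subseteq> a +o L\<close> L(2) by (intro card_mono) auto
    finally show ?thesis by simp
  qed
  have hole1: "card S + card L \<le> card (S + L) + card (S \<inter> (a +o L))" if "a \<in> S" "finite S" for S a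
  proof -
    have "finite (S + L)" using finite_sumset that L by blast
    moreover have "S \<union> (a +o L) \<subseteq> S + L" using subset_plus_subgroup[OF L(1)] that(1) by (auto intro: set_plus_mono3[THEN subsetD])
    ultimately have "card (S \<union> (a +o L)) \<le> card (S + L)" by (rule card_mono)
    then show ?thesis using card_Un_Int[of S "a +o L"] that L by simp
  qed
  have hole2: "card S + 2 * card L \<le> card (S + L) + card (S \<inter> (a +o L)) + card (S \<inter> (a' +o L))"
    if "a \<in> S" "a' \<in> S" "finite S" "a - a' \<notin> L" for S a a'
  proof -
    have "finite (S + L)" using finite_sumset that L by blast
    moreover have "(S \<union> (a +o L)) \<union> (a' +o L) \<subseteq> S + L" 
      using subset_plus_subgroup[OF L(1)] that by (auto intro: set_plus_mono3[THEN subsetD])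
    ultimately have "card ((S \<union> (a +o L)) \<union> (a' +o L)) \<le> card (S + L)" by (rule card_mono)
    moreover have "(S \<union> (a +o L)) \<inter> (a' +o L) = S \<inter> (a' +o L)" using coset_disjoint[OF L(1) that(4)] by blast
    ultimately show ?thesis using card_Un_Int[of S "a +o L"] card_Un_Int[of "S \<union> (a +o L)" "a' +o L"] that L by simp
  qed
  have fs: "finite (A + L)" "finite (B + L)" "A + L \<noteq> {}" "B + L \<noteq> {}" 
    using finite_sumset[OF c(1) L(2)] finite_sumset[OF c(2) L(2)] c(3,4)
      subset_plus_subgroup[OF L(1), of A] subset_plus_subgroup[OF L(1), of B] by auto
  have sumL: "(A + L) + (B + L) = F" using plus_subgroup_plus_subgroup[OF L(1)] DL by (simp add: D_def)
  have kn: "card (A + L) + card (B + L) \<le> card F + card L"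
    using kneser[OF fs] unfolding sumL L_def[symmetric] .
  have cF: "card F < card D + card L"
  proof -
    have "card F = card D + card (PL - D)" 
    proof -
      have "F = D \<union> PL" using PLF PPL by (auto simp: F_def)
      then show ?thesis using card_Un_Diff[of D PL] fin L by (simp add: PL_def)
    qed
    moreover have "d \<in> PL" "d \<notin> PL - D" using d PPL by auto
    then have "PL - D \<subset> PL" by blast
    then have "card (PL - D) < card PL" using L(2) by (intro psubset_card_mono) (auto simp: PL_def)
    ultimately show ?thesis by (simp add: PL_def)
  qed
  have uniq: "a \<in> x +o L \<and> b \<in> y +o L" if ab: "a \<in> A" "b \<in> B" "a + b \<in> (x + y) +o L" for a b
  proof -
    have eq: "(x + y) - (a + b) \<in> L" using ab(3) subgroup_diff_comm[OF L(1)] by (simp add: in_translate)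
    have *: "x - a \<notin> L \<longleftrightarrow> y - b \<notin> L"
      using subgroupD(4)[OF L(1) eq, of "x - a"] subgroupD(4)[OF L(1) eq, of "y - b"] 
      by (auto simp: algebra_simps)
    have "x - a \<in> L"
    proof (rule ccontr)
      assume n: "x - a \<notin> L"
      have "card A + 2 * card L \<le> card (A + L) + card (A \<inter> (x +o L)) + card (A \<inter> (a +o L))"
        using hole2[OF xy(2) ab(1) c(1) n] .
      moreover have "card B + 2 * card L \<le> card (B + L) + card (B \<inter> (y +o L)) + card (B \<inter> (b +o L))"
        using hole2[OF xy(3) ab(2) c(2)] n * by blast
      moreover have "card (A \<inter> (x +o L)) + card (B \<inter> (y +o L)) \<le> card L"
        using bad[OF xy(2,3)] coset_self[OF L(1)] by (simp add: PL_def)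
      moreover have "card (A \<inter> (a +o L)) + card (B \<inter> (b +o L)) \<le> card L"
        using bad[OF ab(1,2)] ab(3) by (simp add: PL_def)
      ultimately show False using kn cF s(6)[folded D_def] by linarith
    qed
    then show ?thesis using * subgroup_diff_comm[OF L(1)] by (auto simp: in_translate)
  qed
  have eqc: "card (A + L) + card (B + L) = card F + card L"
  proof -
    have "card A + card L \<le> card (A + L) + card (A \<inter> (x +o L))" using hole1[OF xy(2) c(1)] .
    moreover have "card B + card L \<le> card (B + L) + card (B \<inter> (y +o L))" using hole1[OF xy(3) c(2)] .
    moreover have "card (A \<inter> (x +o L)) + card (B \<inter> (y +o L)) \<le> card L"
      using bad[OF xy(2,3)] coset_self[OF L(1)] by (simp add: PL_def)
    ultimately have gt: "card F < card (A + L) + card (B + L)" using cF s(6)[folded D_def] by linarith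
    \<comment> \<open>All three sizes are multiples of \<open>card L\<close>, so the positive excess
      is at least \<open>card L\<close>.\<close>
    have "card L dvd card (A + L) + card (B + L) - card F"
      using card_dvd_periodic[OF L(1)] periodic_plus_subgroup[OF L(1)] fs fin L(3)
      by (intro dvd_diff_nat dvd_add) auto
    then have "card L \<le> card (A + L) + card (B + L) - card F" using gt by (intro dvd_imp_le) auto
    then show ?thesis using kn gt by linarith
  qed
  \<comment> \<open>Adding \<open>l\<close> moves \<open>a + b\<close> inside the periodic filled
    sum and, because \<open>a\<close> is not in \<open>u +o L\<close>, never into the exceptional
    coset. Maximality then keeps \<open>a + l\<close> in \<open>S\<close>, which stands for
    \<open>A\<close> and afterwards for \<open>B\<close>.\<close>
  have perA: "periodic L (S - (u +o L))"
    if max: "\<And>w. (\<And>b. b \<in> T \<Longrightarrow> w + b \<in> D) \<Longrightarrow> w \<in> S" 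
      and un: "\<And>a b. a \<in> S \<Longrightarrow> b \<in> T \<Longrightarrow> a + b \<in> (x + y) +o L \<Longrightarrow> a \<in> u +o L" 
      and sm: "\<And>a b. a \<in> S \<Longrightarrow> b \<in> T \<Longrightarrow> a + b \<in> D" for S T u
    unfolding periodic_def
  proof (intro ballI)
    fix a l assume a: "a \<in> S - (u +o L)" and l: "l \<in> L"
    have "a + l \<in> S"
    proof (rule max)
      fix b assume b: "b \<in> T"
      have "a + b \<in> F" using sm a b by (auto simp: F_def)
      then have "(a + b) + l \<in> F" by (rule periodicD[OF _ l L(3)])
      moreover have "(a + b) + l \<notin> PL"
      proof
        assume "(a + b) + l \<in> PL"
        then have "a + b \<in> (x + y) +o L" using periodicD_rev[OF _ l periodic_coset[OF L(1)] L(1)] by (auto simp: PL_def)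
        then show False using un a b by blast
      qed
      ultimately show "a + l + b \<in> D" using PPL by (auto simp: F_def ac_simps)
    qed
    moreover have "a + l \<notin> u +o L" using a periodicD_rev[OF _ l periodic_coset[OF L(1)] L(1)] by blast
    ultimately show "a + l \<in> S - (u +o L)" by blast
  qed
  have "periodic L (A - (x +o L))"
  proof (rule perA[of B])
    show "w \<in> A" if "\<And>b. b \<in> B \<Longrightarrow> w + b \<in> D" for w using critical_pair_max1[OF cr] that D_def by blast
  qed (use uniq in \<open>auto simp: D_def\<close>)
  moreover have "periodic L (B - (y +o L))"
  proof (rule perA[of A])
    show "w \<in> B" if "\<And>b. b \<in> A \<Longrightarrow> w + b \<in> D" for w using critical_pair_max2[OF cr, of w] that by (simp add: D_def add.commute)
    show "a + b \<in> D" if "a \<in> B" "b \<in> A" for a b using set_plus_intro[OF that(2,1)] by (simp add: D_def add.commute)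
    show "a \<in> y +o L" if "a \<in> B" "b \<in> A" "a + b \<in> (x + y) +o L" for a b 
      using uniq[OF that(2,1)] that(3) by (simp add: add.commute)
  qed
  ultimately have "quasi_split A B L x y"
    using L xy(2,3) uniq quasiL eqc DL unfolding quasi_split_def D_def[symmetric] by (simp add: L_def[symmetric])
  moreover have "p \<in> (x + y) +o L" using PPL coset_self[OF K(1)] by (auto simp: P_def PL_def)
  ultimately show ?thesis using that KL LG DL by (simp add: D_def F_def P_def)
qed

text \<open>Since \<open>B4\<close> lies in one coset of the stabilizer of \<open>A + B3\<close>,
  each translate \<open>a +o B4\<close> is either absorbed by \<open>A + B3\<close> or disjoint from
  it. If the elements of the second kind met two cosets of \<open>L\<close>, the sum would reach the
  size \<open>card A + card B\<close>.\<close>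

lemma peel_quasi_periodic:
  assumes cr: "critical_pair A B" and B: "B = B3 \<union> B4" "B3 \<inter> B4 = {}" "B3 \<noteq> {}" "B4 \<noteq> {}"
    and L: "L = stab (A + B3)" "B4 \<subseteq> y +o L" "L \<noteq> stab (A + B)"
  shows "\<exists>p. quasi_periodic L p (A + B)"
proof -
  define H D3 where "H = stab (A + B)" and "D3 = A + B3"
  note c = critical_pairD[OF cr]
  note s = critical_pair_stab[OF cr H_def]
  have fin: "finite B3" "finite B4" "finite D3" "D3 \<noteq> {}" using c B finite_sumset by (auto simp: D3_def)
  have Ls: "add_subgroup L" "finite L" "periodic L D3" 
    using L(1) fin by (auto simp: D3_def add_subgroup_stab finite_stab periodic_stab)
  define AU where "AU = {a \<in> A. a + y \<notin> D3}"
  have iff: "a + b \<in> D3 \<longleftrightarrow> a + y \<in> D3" if "b \<in> B4" for a b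
  proof -
    have "b - y \<in> L" using that L(2) by (auto simp: in_translate)
    from periodicD[OF _ this Ls(3), of "a + y"] periodicD_rev[OF _ this Ls(3,1), of "a + y"] show ?thesis by auto
  qed
  have finAU: "finite AU" "AU \<subseteq> A" using c by (auto simp: AU_def)
  have D: "A + B = D3 \<union> (AU + B4)"
  proof
    show "D3 \<union> (AU + B4) \<subseteq> A + B" unfolding D3_def using B finAU by (intro Un_least set_plus_mono2) auto
    show "A + B \<subseteq> D3 \<union> (AU + B4)"
    proof
      fix w assume "w \<in> A + B"
      then obtain a b where w: "w = a + b" "a \<in> A" "b \<in> B" by (auto elim: set_plus_elim)
      show "w \<in> D3 \<union> (AU + B4)"
      proof (cases "b \<in> B3")
        case True
        then show ?thesis using w set_plus_intro[of a A b B3] by (simp add: D3_def)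
      next
        case False
        then have b4: "b \<in> B4" using w B by blast
        show ?thesis
        proof (cases "a + y \<in> D3")
          case True
          then show ?thesis using iff[OF b4] w by simp
        next
          case False
          then have "a \<in> AU" using w by (simp add: AU_def)
          then show ?thesis using w(1) b4 by blast
        qed
      qed
    qed
  qed
  have disj: "D3 \<inter> (AU + B4) = {}"
  proof (rule ccontr)
    assume "\<not> ?thesis"
    then obtain w where "w \<in> D3" "w \<in> AU + B4" by blast
    then obtain a b where "a + b \<in> D3" "a \<in> AU" "b \<in> B4" by (auto elim: set_plus_elim)
    then show False using iff by (auto simp: AU_def)
  qed
  have "AU \<noteq> {}"
  proof
    assume "AU = {}"
    then show False using D L by (simp add: D3_def)
  qed
  then obtain x0 where x0: "x0 \<in> AU" by blast
  have AUL: "AU \<subseteq> x0 +o L"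
  proof (rule ccontr)
    assume "\<not> ?thesis"
    then obtain x1 where x1: "x1 \<in> AU" "x1 - x0 \<notin> L" unfolding subset_iff in_translate by blast
    have fAUL: "finite (AU + L)" "finite (A + L)" using finite_sumset finAU Ls c by blast+
    have AUin: "AU \<subseteq> AU + L" "A \<subseteq> A + L" using subset_plus_subgroup[OF Ls(1)] by blast+
    have "2 * card L \<le> card (AU + L)"
      using two_cosets_card[OF Ls(1) periodic_plus_subgroup[OF Ls(1)] fAUL(1), of x1 x0] x1 x0 AUin by blast
    moreover have "card (AU + L) + card A \<le> card (A + L) + card AU"
    proof -
      \<comment> \<open>Within \<open>A\<close>, membership in \<open>AU\<close> is constant on
        cosets of \<open>L\<close>, so holes of \<open>AU\<close> are holes of
        \<open>A\<close>.\<close>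
      have "(AU + L) - AU \<subseteq> (A + L) - A"
      proof
        fix z assume z: "z \<in> (AU + L) - AU"
        then obtain a l where al: "z = a + l" "a \<in> AU" "l \<in> L" by (auto elim: set_plus_elim)
        have "z + y \<notin> D3"
          using periodicD_rev[OF _ al(3) Ls(3,1), of "a + y"] al by (auto simp: AU_def ac_simps)
        then have "z \<notin> A" using z by (auto simp: AU_def)
        moreover have "z \<in> A + L" using al finAU by auto
        ultimately show "z \<in> (A + L) - A" by blast
      qed
      then have "card ((AU + L) - AU) \<le> card ((A + L) - A)" using fAUL by (intro card_mono) auto
      moreover have "card ((AU + L) - AU) = card (AU + L) - card AU" "card ((A + L) - A) = card (A + L) - card A"
        using AUin finAU c by (simp_all add: card_Diff_subset)
      ultimately show ?thesis using card_mono[OF fAUL(1) AUin(1)] card_mono[OF fAUL(2) AUin(2)] by linarith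
    qed
    moreover have "card (A + L) + card B3 \<le> card D3 + card L"
      using kneser_plus[OF c(1) fin(1) c(3) B(3) L(1)] by (simp add: D3_def)
    moreover have "card (A + B) = card D3 + card (AU + B4)"
      unfolding D using disj fin finAU finite_sumset by (intro card_Un_disjoint) auto
    moreover have "card AU \<le> card (AU + B4)" using card_le_sumset_left finAU fin B by blast
    moreover have "card B = card B3 + card B4" unfolding B(1) using fin B(2) by (intro card_Un_disjoint)
    moreover have "card B4 \<le> card L" using card_mono[OF _ L(2)] Ls by simp
    ultimately show False using s(6,9) by linarith
  qed
  define P where "P = (x0 + y) +o L"
  have AUP: "AU + B4 \<subseteq> P" unfolding P_def
    using coset_add_mem[OF Ls(1)] AUL L(2) by (fastforce elim!: set_plus_elim)
  have D3P: "D3 \<inter> P = {}"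
  proof (rule ccontr)
    assume "\<not> ?thesis"
    then obtain w where w: "w \<in> D3" "w \<in> P" by blast
    then have "(x0 + y) - w \<in> L" using subgroup_diff_comm[OF Ls(1)] by (auto simp: P_def in_translate)
    from periodicD[OF w(1) this Ls(3)] have "x0 + y \<in> D3" by simp
    then show False using x0 by (simp add: AU_def)
  qed
  have DP: "(A + B) - P = D3" "(A + B) \<inter> P = AU + B4" using D AUP D3P by blast+
  have "AU + B4 \<noteq> {}" using x0 B by auto
  moreover have "\<not> P \<subseteq> A + B"
  proof
    assume "P \<subseteq> A + B"
    then have "A + B = D3 \<union> P" using DP by blast
    moreover have "periodic L P" unfolding P_def by (rule periodic_coset[OF Ls(1)])
    ultimately have "periodic L (A + B)" using periodic_Un[OF Ls(3)] by metis
    then have "L \<subseteq> H" unfolding H_def using periodic_imp_subset_stab c(6) by blast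
    moreover have "H \<subseteq> L" unfolding L(1) 
      using periodic_imp_subset_stab[OF fin(3), of H] periodic_plus_left[OF s(3), of B3] by (simp add: D3_def)
    ultimately show False using L(3) by (simp add: H_def)
  qed
  ultimately show ?thesis using Ls DP unfolding quasi_periodic_def P_def by (intro exI[of _ "x0 + y"]) auto
qed

section \<open>Progressions of cosets and sums with a unique representation\<close>

definition progression :: "'a::ab_group_add set \<Rightarrow> 'a \<Rightarrow> 'a \<Rightarrow> nat \<Rightarrow> 'a set \<Rightarrow> bool" where
  "progression K d q k S \<longleftrightarrow> S = (\<Union>i\<in>{0..k}. (q + nmult i d) +o K)"

text \<open>A period outside \<open>K\<close> would carry the exceptional coset into the periodic
  part, where every coset it meets is full; going back, the exceptional coset would be full
  too.\<close>

lemma quasi_periodic_stab_subset: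
  assumes "quasi_periodic K p D" "finite D"
  shows "stab D \<subseteq> K"
proof (rule subsetI, rule ccontr)
  fix h assume h: "h \<in> stab D" "h \<notin> K"
  have K: "add_subgroup K" "periodic K (D - (p +o K))" using assms by (auto simp: quasi_periodic_def)
  obtain d where d: "d \<in> D" "d \<in> p +o K" using assms by (auto simp: quasi_periodic_def)
  have dh: "d + h \<in> D" using d(1) h(1) assms(2) by (simp add: in_stab_iff)
  have "d + h \<notin> p +o K"
  proof
    assume "d + h \<in> p +o K"
    then have "(d + h - p) - (d - p) \<in> K" using d(2) subgroupD(4)[OF K(1)] by (simp only: in_translate)
    then show False using h(2) by simp
  qed
  then have *: "(d + h) +o K \<subseteq> D" using periodic_coset_subset[OF K(2), of "d + h"] dh by blast
  have "p +o K \<subseteq> D"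
  proof
    fix z assume "z \<in> p +o K"
    then have "z \<in> d +o K" using coset_eqI[OF K(1) d(2)] by simp
    then have "z + h \<in> (d + h) +o K" by (simp add: in_translate)
    then have "z + h \<in> D" using * by blast
    then show "z \<in> D" using periodicD_rev[OF _ h(1) periodic_stab add_subgroup_stab] by blast
  qed
  then show False using assms by (simp add: quasi_periodic_def)
qed

lemma quasi_split_commute:
  assumes "quasi_split A B L x y"
  shows "quasi_split B A L y x"
  using assms unfolding quasi_split_def by (simp add: add.commute[of B A] add.commute[of y x]) 
    (metis add.commute)

lemma progression_shift:
  assumes "add_subgroup K" "progression K d q k S" "x \<in> q +o K"
  shows "progression K d x k S"
proof -
  have "(q + z) +o K = (x + z) +o K" for z
    using coset_eqI[OF assms(1), of "x + z" "q + z"] assms(3) by (simp add: in_translate)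
  then show ?thesis using assms(2) by (simp add: progression_def)
qed

lemma progression_reverse:
  assumes K: "add_subgroup K" and p: "progression K d q k S" and x: "x \<in> (q + nmult k d) +o K"
  shows "progression K (- d) x k S"
proof -
  have e: "(q + nmult (k - i) d) +o K = (x + nmult i (- d)) +o K" if "i \<le> k" for i
  proof -
    have "nmult k d = nmult i d + nmult (k - i) d" using nmult_add[of i "k - i" d] that by simp
    then have "x + nmult i (- d) - (q + nmult (k - i) d) = x - (q + nmult k d)"
      by (simp add: nmult_uminus)
    then have "x + nmult i (- d) \<in> (q + nmult (k - i) d) +o K" using x by (simp only: in_translate)
    then show ?thesis by (rule coset_eqI[OF K])
  qed
  have "S = (\<Union>i\<in>{0..k}. (q + nmult (k - i) d) +o K)"
  proof -
    have "(\<lambda>i. k - i) ` {0..k} = {0..k}" 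
    proof
      show "{0..k} \<subseteq> (\<lambda>i. k - i) ` {0..k}"
      proof
        fix i assume "i \<in> {0..k}"
        then show "i \<in> (\<lambda>i. k - i) ` {0..k}" by (intro image_eqI[of _ _ "k - i"]) auto
      qed
    qed auto
    then have "(\<Union>i\<in>(\<lambda>i. k - i) ` {0..k}. (q + nmult i d) +o K) = S" using p by (simp add: progression_def)
    then show ?thesis by simp
  qed
  also have "\<dots> = (\<Union>i\<in>{0..k}. (x + nmult i (- d)) +o K)" using e by simp
  finally show ?thesis by (simp add: progression_def)
qed

lemma progression_mem:
  assumes "add_subgroup K" "progression K d q k S" "i \<le> k"
  shows "q + nmult i d \<in> S"
  using assms coset_self[OF assms(1), of "q + nmult i d"] unfolding progression_def by auto

lemma generates_mod_uminus:
  assumes G: "add_subgroup G" and "generates_mod G K d"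
  shows "generates_mod G K (- d)"
  unfolding generates_mod_def
proof (intro conjI allI impI)
  show "- d \<in> G" using assms subgroupD(3) by (auto simp: generates_mod_def)
  fix L assume "add_subgroup L" "L \<subseteq> G" "K \<subseteq> L" "- d \<in> L"
  moreover from this have "d \<in> L" using subgroupD(3)[of L "- d"] by simp
  ultimately show "L = G" using assms by (auto simp: generates_mod_def)
qed

text \<open>Moving one step forward in one progression and back in the other preserves the sum but
  changes the coset. As both have at least two terms, this is impossible only if \<open>x\<close>
  and \<open>y\<close> are both first or both last; in the latter case the progressions are read
  backwards.\<close>

lemma progressions_unique_sum:
  assumes G: "add_subgroup G" and K: "add_subgroup K" "K \<subset> G" and d: "generates_mod G K d"
    and A: "progression K d q k A" "k \<ge> 1" and B: "progression K d q' l B" "l \<ge> 1"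
    and xy: "x \<in> A" "y \<in> B"
    and uniq: "\<And>a b. a \<in> A \<Longrightarrow> b \<in> B \<Longrightarrow> a + b \<in> (x + y) +o K \<Longrightarrow> a \<in> x +o K"
  obtains d' where "generates_mod G K d'" "progression K d' x k A" "progression K d' y l B"
proof -
  have dK: "d \<notin> K" using d K unfolding generates_mod_def by blast
  obtain i where i: "i \<le> k" "x \<in> (q + nmult i d) +o K" using A(1) xy(1) by (auto simp: progression_def)
  obtain j where j: "j \<le> l" "y \<in> (q' + nmult j d) +o K" using B(1) xy(2) by (auto simp: progression_def)
  have "q + nmult i d \<in> x +o K" using i(2) subgroup_diff_comm[OF K(1)] by (simp add: in_translate)
  have sum: "x + y \<in> (q + nmult i d + (q' + nmult j d)) +o K" using coset_add_mem[OF K(1) i(2) j(2)] .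
  have no: False if ij: "i' \<le> k" "j' \<le> l" "i' + j' = i + j" "q + nmult i' d - (q + nmult i d) = d \<or> q + nmult i' d - (q + nmult i d) = - d" for i' j'
  proof -
    have "nmult i' d + nmult j' d = nmult i d + nmult j d" using ij(3) nmult_add by metis
    then have "q + nmult i' d + (q' + nmult j' d) = q + nmult i d + (q' + nmult j d)" by (simp add: algebra_simps)
    then have "(x + y) - (q + nmult i' d + (q' + nmult j' d)) \<in> K"
      using sum by (simp only: in_translate)
    then have "q + nmult i' d + (q' + nmult j' d) \<in> (x + y) +o K" 
      unfolding in_translate subgroup_diff_comm[OF K(1), of "x + y"] .
    then have "q + nmult i' d \<in> x +o K"
      using uniq[OF progression_mem[OF K(1) A(1) ij(1)] progression_mem[OF K(1) B(1) ij(2)]] by blast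
    then have "q + nmult i' d \<in> (q + nmult i d) +o K" using coset_eqI[OF K(1) i(2)] by simp
    then have "d \<in> K \<or> - d \<in> K" using ij(4) unfolding in_translate by auto
    then show False using dK subgroupD(3)[OF K(1), of "- d"] by auto
  qed
  have 1: "i = 0 \<or> j = l"
  proof (rule ccontr)
    assume n: "\<not> ?thesis"
    then obtain i' where "i = Suc i'" by (cases i) auto
    then show False using no[of i' "Suc j"] n i j by simp
  qed
  have 2: "i = k \<or> j = 0"
  proof (rule ccontr)
    assume n: "\<not> ?thesis"
    then obtain j' where "j = Suc j'" by (cases j) auto
    then show False using no[of "Suc i" j'] n i j by simp
  qed
  show ?thesis
  proof (cases "i = 0")
    case True
    then have "j = 0" using 2 A(2) by simp
    then show ?thesis using that[OF d] True i j progression_shift[OF K(1) A(1), of x] progression_shift[OF K(1) B(1), of y] by simp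
  next
    case False
    then have "j = l" "i = k" using 1 2 B(2) by auto
    then show ?thesis using that[OF generates_mod_uminus[OF G d]] 
        progression_reverse[OF K(1) A(1), of x] progression_reverse[OF K(1) B(1), of y] i j by simp
  qed
qed

lemma generating_not_coset:
  assumes "generating G A" "add_subgroup K" "K \<subset> G"
  shows "A \<noteq> x +o K" "\<not> A \<subseteq> x +o K"
  using assms unfolding generating_def by blast+

lemma stab_sumset_psubset:
  assumes G: "add_subgroup G" "A \<subseteq> G" "B \<subseteq> G" and cr: "critical_pair A B" and DG: "A + B \<noteq> G"
  shows "stab (A + B) \<subset> G"
proof -
  note c = critical_pairD[OF cr]
  have D: "A + B \<subseteq> G" using sumset_subset_subgroup[OF G] .
  then have "stab (A + B) \<subseteq> G" using stab_subset_subgroup[OF G(1) D c(7)] by blast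
  moreover have "stab (A + B) \<noteq> G" using periodic_full[OF G(1) _ D c(7)] periodic_stab[of "A + B"] DG by metis
  ultimately show ?thesis by blast
qed

text \<open>The progression passes from the sum to both summands. The obstruction is that
  \<open>A + B\<close> and its shift by \<open>d\<close> may cover \<open>G\<close>; the complement
  of \<open>A + B\<close> would then be a single \<open>H\<close>-coset, which does not
  generate.\<close>

lemma quasi_periodic_or_chord:
  assumes G: "add_subgroup G" "A \<subseteq> G" "B \<subseteq> G" and cr: "critical_pair A B" and H: "H = stab (A + B)"
    and DG: "A + B \<noteq> G" and generating: "generating G A" "generating G B" "generating G (G - (A + B))"
  shows "(\<exists>K p. quasi_periodic K p (A + B) \<and> K \<subset> G) \<or>
    (\<exists>d q k q' l. generates_mod G H d \<and> progression H d q k A \<and> k \<ge> 1 \<and> progression H d q' l B \<and> l \<ge> 1)"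
proof -
  note c = critical_pairD[OF cr]
  note s = critical_pair_stab[OF cr H]
  have HG: "H \<subset> G" unfolding H by (rule stab_sumset_psubset[OF G cr DG])
  have D: "A + B \<subseteq> G" using sumset_subset_subgroup[OF G] .
  consider "\<exists>K p. quasi_periodic K p (A + B) \<and> K \<subset> G" | 
    A' d where "A + B = A' \<union> (d +o A')" "card (A + B) = card A' + card H" "generates_mod G H d"
    using quasi_periodic_or_progression[OF G cr H DG generating(1) generating_not_coset(1)[OF generating(2) s(1) HG]]
    unfolding generates_mod_def by blast
  then show ?thesis
  proof cases
    case 2
    have ne: "(A + B) \<union> (d +o (A + B)) \<noteq> G"
    proof
      assume e: "(A + B) \<union> (d +o (A + B)) = G"
      have finA': "finite A'" using c(6) 2(1) by simp
      have finG: "finite G" using e c by (metis finite_Un finite_translate)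
      have "G - (A + B) \<subseteq> (d +o (d +o A')) - (d +o A')"
      proof
        fix z assume z: "z \<in> G - (A + B)"
        then have "z \<in> d +o (A + B)" using e by blast
        then have "z \<in> (d +o A') \<union> (d +o (d +o A'))" unfolding 2(1) translate_Un .
        moreover have "z \<notin> d +o A'" using z 2(1) by blast
        ultimately show "z \<in> (d +o (d +o A')) - (d +o A')" by blast
      qed
      then have "G - (A + B) \<subseteq> d +o ((d +o A') - A')" by (simp add: translate_Diff)
      then have "card (G - (A + B)) \<le> card ((d +o A') - A')" using card_mono[of "d +o ((d +o A') - A')"] finA' by simp
      also have "\<dots> = card H" using card_Un_Diff[of A' "d +o A'"] finA' 2 by simp
      finally have le: "card (G - (A + B)) \<le> card H" .
      obtain g where g: "g \<in> G - (A + B)" using D DG by blast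
      have "periodic H G" using periodic_subgroup[OF G(1)] periodic_mono HG by blast
      then have "periodic H (G - (A + B))" using periodic_Diff[OF s(1) _ s(5)] by blast
      then have "G - (A + B) = g +o H" using periodic_subset_eq_coset[OF _ _ g le] finG by blast
      then show False using generating_not_coset(1)[OF generating(3) s(1) HG] by blast
    qed
    have len: "k \<ge> 1" if "generating G S" "progression H d q k S" for S q k
    proof (rule ccontr)
      assume "\<not> ?thesis"
      then have "k = 0" by simp
      then have "S = q +o H" using that(2) by (simp add: progression_def)
      then show False using generating_not_coset(1)[OF that(1) s(1) HG] by blast
    qed
    have nG: "A \<noteq> G" "B \<noteq> G"
    proof -
      show "A \<noteq> G" using card_le_sumset_left[of A B] c D DG card_seteq[of G "A + B"] by metis
      show "B \<noteq> G" using card_le_sumset_right[of A B] c D DG card_seteq[of G "A + B"] by metis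
    qed
    have a: "card (A \<union> (d +o A)) \<le> card A + card H"
      by (rule progression_summand[OF G cr H 2(3,1,2) ne])
    have b: "card (B \<union> (d +o B)) \<le> card B + card H"
      by (rule progression_summand[OF G(1,3,2) critical_pair_commute[OF cr]]) (use H 2 ne in \<open>simp_all add: add.commute\<close>)
    obtain q k where pA: "progression H d q k A"
      using progression_structure[OF G(1) s(1) 2(3) c(1,3) G(2) s(3) nG(1) a] unfolding progression_def by metis
    obtain q' l where pB: "progression H d q' l B"
      using progression_structure[OF G(1) s(1) 2(3) c(2,4) G(3) s(4) nG(2) b] unfolding progression_def by metis
    show ?thesis
      using 2(3) pA pB len[OF generating(1) pA] len[OF generating(2) pB] by (intro disjI2 exI conjI)
  qed blast
qed

text \<open>Equality in Kneser's theorem is part of \<open>quasi_split\<close>, so the pair filled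
  by \<open>K\<close> is critical, and the results on chords apply to it with \<open>K\<close> as
  the stabilizer. Filling affects only the exceptional cosets.\<close>

lemma quasi_split_critical_pair:
  assumes cr: "critical_pair A B" and q: "quasi_split A B K x y"
  shows "critical_pair (A + K) (B + K)" "(A + K) + (B + K) = (A + B) + K" "stab ((A + K) + (B + K)) = K"
    "a \<in> A + K \<Longrightarrow> b \<in> B + K \<Longrightarrow> a + b \<in> (x + y) +o K \<Longrightarrow> a \<in> x +o K \<and> b \<in> y +o K"
    "(A + B) + K = (A + B) \<union> ((x + y) +o K)" 
    "B + K - (y +o K) = B - (y +o K)"
proof -
  note c = critical_pairD[OF cr]
  have K: "add_subgroup K" "finite K" "periodic K (B - (y +o K))" "y \<in> B" "x \<in> A"
    and u: "\<And>a b. a \<in> A \<Longrightarrow> b \<in> B \<Longrightarrow> a + b \<in> (x + y) +o K \<Longrightarrow> a \<in> x +o K \<and> b \<in> y +o K"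
    and D: "periodic K (A + B - ((x + y) +o K))"
    and st: "stab ((A + B) + K) = K" "card (A + K) + card (B + K) = card ((A + B) + K) + card K"
    using q unfolding quasi_split_def quasi_periodic_def by blast+
  show sum: "(A + K) + (B + K) = (A + B) + K" by (rule plus_subgroup_plus_subgroup[OF K(1)])
  then show "stab ((A + K) + (B + K)) = K" using st by simp
  have ne: "A + K \<noteq> {}" "B + K \<noteq> {}" using subset_plus_subgroup[OF K(1), of A] subset_plus_subgroup[OF K(1), of B] c by auto
  show "critical_pair (A + K) (B + K)"
    using finite_sumset[OF c(1) K(2)] finite_sumset[OF c(2) K(2)] ne st sum by (intro critical_pair_if_card_eq) simp_all
  show "a \<in> x +o K \<and> b \<in> y +o K" if ab: "a \<in> A + K" "b \<in> B + K" "a + b \<in> (x + y) +o K"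
  proof -
    obtain a0 k where a: "a = a0 + k" "a0 \<in> A" "k \<in> K" using ab(1) by (auto elim: set_plus_elim)
    obtain b0 l where b: "b = b0 + l" "b0 \<in> B" "l \<in> K" using ab(2) by (auto elim: set_plus_elim)
    have "k + l \<in> K" using a b subgroupD(2)[OF K(1)] by blast
    moreover have "(a0 + b0) + (k + l) \<in> (x + y) +o K" using ab(3) a b by (simp add: ac_simps)
    ultimately have "a0 + b0 \<in> (x + y) +o K" using periodicD_rev[OF _ _ periodic_coset[OF K(1)] K(1)] by blast
    then have "a0 \<in> x +o K" "b0 \<in> y +o K" using u a b by blast+
    then show ?thesis using periodicD[OF _ a(3) periodic_coset[OF K(1)]] periodicD[OF _ b(3) periodic_coset[OF K(1)]] a b by simp
  qed
  have fill: "S + K = S \<union> (z +o K)" if "periodic K (S - (z +o K))" "z \<in> S" for S z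
  proof
    have "z +o K \<subseteq> S + K" using that(2) by (rule set_plus_mono3)
    then show "S \<union> (z +o K) \<subseteq> S + K" using subset_plus_subgroup[OF K(1)] by blast
    have "periodic K (S \<union> (z +o K))" using periodic_Un[OF that(1) periodic_coset[OF K(1), of z]] by simp
    then have "(S \<union> (z +o K)) + K = S \<union> (z +o K)" by (rule plus_subgroup_eq[OF K(1)])
    moreover have "S + K \<subseteq> (S \<union> (z +o K)) + K" by (rule set_plus_mono2) auto
    ultimately show "S + K \<subseteq> S \<union> (z +o K)" by simp
  qed
  show "(A + B) + K = (A + B) \<union> ((x + y) +o K)" using fill[OF D] K by blast
  show "B + K - (y +o K) = B - (y +o K)" using fill[OF K(3,4)] by blast
qed

text \<open>The exceptional coset of the filled sum is away from that of \<open>A + B\<close>, so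
  \<open>M\<close> cannot be used directly. As \<open>x +o M\<close> is full in
  \<open>A + K\<close>, the unique representation of \<open>x + y\<close> leaves
  \<open>B + K\<close> nothing of \<open>y +o M\<close> except \<open>y +o K\<close>. So
  \<open>y +o M\<close> is the exceptional coset of the second summand; peeling it off yields a sum
  whose stabilizer contains \<open>M\<close>.\<close>

lemma quasi_periodic_enlarge_aux:
  assumes G: "add_subgroup G" "A \<subseteq> G" "B \<subseteq> G" and cr: "critical_pair A B" and DG: "A + B \<noteq> G"
    and generating: "generating G B"
    and q: "quasi_split A B K x y" and q': "quasi_split (A + K) (B + K) M x' y'"
    and M: "M \<subset> G" "K \<subset> M" and out: "x + y \<notin> (x' + y') +o M" "x \<notin> x' +o M"
  shows "\<exists>L p. quasi_periodic L p (A + B) \<and> L \<subset> G \<and> card K < card L"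
proof -
  note c = critical_pairD[OF cr]
  note qs = quasi_split_critical_pair[OF cr q]
  define A' B' where "A' = A + K" and "B' = B + K"
  have K: "add_subgroup K" "finite K" "x \<in> A" "y \<in> B" using q unfolding quasi_split_def by blast+
  have Ms: "add_subgroup M" "finite M" "x' \<in> A'" "y' \<in> B'" "periodic M (A' - (x' +o M))" "periodic M (B' - (y' +o M))"
    and u': "\<And>a b. a \<in> A' \<Longrightarrow> b \<in> B' \<Longrightarrow> a + b \<in> (x' + y') +o M \<Longrightarrow> b \<in> y' +o M"
    and ce: "card (A' + M) + card (B' + M) = card ((A' + B') + M) + card M"
    using q' unfolding quasi_split_def A'_def B'_def by blast+
  have AA': "A \<subseteq> A'" "B \<subseteq> B'" using subset_plus_subgroup[OF K(1)] by (auto simp: A'_def B'_def)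
  have u: "b \<in> y +o K" if "a \<in> A'" "b \<in> B'" "a + b = x + y" for a b
    using qs(4)[of a b] that coset_self[OF K(1), of "x + y"] by (simp add: A'_def B'_def)
  have xM: "x +o M \<subseteq> A'" using periodic_coset_subset[OF Ms(5), of x] K(3) AA' out(2) by blast
  have yM: "b \<in> y +o K" if "b \<in> B'" "b \<in> y +o M" for b
  proof (rule u)
    have "x + y - b \<in> x +o M" using that(2) subgroup_diff_comm[OF Ms(1)] by (simp add: in_translate algebra_simps)
    then show "x + y - b \<in> A'" using xM by blast
  qed (use that in auto)
  have ltKM: "card K < card M" using psubset_card_mono[OF Ms(2) M(2)] .
  have yy': "y \<in> y' +o M"
  proof (rule ccontr)
    assume "y \<notin> y' +o M"
    then have "y +o M \<subseteq> B'" using periodic_coset_subset[OF Ms(6), of y] K(4) AA' by blast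
    have "y +o M \<subseteq> y +o K"
    proof (rule subsetI)
      fix z assume z: "z \<in> y +o M"
      then show "z \<in> y +o K" using yM[OF subsetD[OF \<open>y +o M \<subseteq> B'\<close> z]] by blast
    qed
    then show False using M(2) by simp
  qed
  define Y where "Y = y' +o M"
  have Yy: "Y = y +o M" using coset_eqI[OF Ms(1) yy'] by (simp add: Y_def)
  have KY: "y +o K \<subseteq> Y" using M(2) by (simp add: Yy)
  define B3 B4 where "B3 = B - Y" and "B4 = B \<inter> Y"
  have B3': "B3 = B' - Y" using qs(6) KY AA' by (auto simp: B3_def B'_def)
  have perB3: "periodic M B3" using Ms(6) by (simp add: B3' Y_def)
  have "B3 \<noteq> {}" using generating_not_coset(2)[OF generating Ms(1) M(1)] by (auto simp: B3_def Y_def)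
  have "y \<in> B4" using K(4) yy' by (simp add: B4_def Y_def)
  have fin3: "finite B3" "finite (A + B3)" "A + B3 \<noteq> {}" using c finite_sumset[OF c(1), of B3] \<open>B3 \<noteq> {}\<close> by (auto simp: B3_def)
  define L where "L = stab (A + B3)"
  have L: "add_subgroup L" "finite L" using fin3 by (auto simp: L_def add_subgroup_stab finite_stab)
  have MsubL: "M \<subseteq> L" unfolding L_def using periodic_imp_subset_stab[OF fin3(2)] periodic_plus[OF perB3] by blast
  have B3M: "B3 + M = B3" by (rule plus_subgroup_eq[OF Ms(1) perB3])
  have e1: "(A + M) + B3 = A + B3" 
  proof -
    have "(A + M) + B3 = A + (B3 + M)" by (simp add: ac_simps)
    then show ?thesis using B3M by simp
  qed
  have finS: "finite ((A' + B') + M)"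
    by (rule finite_sumset[OF critical_pairD(6)[OF qs(1), folded A'_def B'_def] Ms(2)])
  have n1: "z \<notin> (x' + y') +o M" if zAB: "z \<in> A + B3" for z
  proof
    assume z: "z \<in> (x' + y') +o M"
    obtain a b where "z = a + b" "a \<in> A" "b \<in> B3" using zAB by (auto elim: set_plus_elim)
    then show False using u'[of a b] z AA' by (auto simp: B3' Y_def)
  qed
  have n2: "z \<notin> (x + y) +o M" if zAB: "z \<in> A + B3" for z
  proof
    assume z: "z \<in> (x + y) +o M"
    obtain a b where ab: "z = a + b" "a \<in> A" "b \<in> B3" using zAB by (auto elim: set_plus_elim)
    have m: "(x + y) - (a + b) \<in> M" using z ab subgroup_diff_comm[OF Ms(1)] by (simp add: in_translate)
    have b': "b + ((x + y) - (a + b)) \<in> B3" using periodicD[OF ab(3) m perB3] .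
    have "b + ((x + y) - (a + b)) \<in> y +o K" using u[of a "b + ((x + y) - (a + b))"] ab b' AA' by (auto simp: B3')
    then show False using b' KY by (auto simp: B3')
  qed
  \<comment> \<open>Two cosets of \<open>M\<close> disappear together with \<open>B4\<close>: the
    exceptional one of the filled sum and the one through \<open>x + y\<close>.\<close>
  have "card (A + B3) + 2 * card M \<le> card ((A' + B') + M)"
  proof -
    have "card (((x' + y') +o M) \<union> ((x + y) +o M)) = 2 * card M"
      using coset_disjoint[OF Ms(1), of "x + y" "x' + y'"] out(1) Ms(2) 
      by (subst card_Un_disjoint) (auto simp: in_translate Int_commute)
    moreover have "card ((A + B3) \<union> (((x' + y') +o M) \<union> ((x + y) +o M))) = card (A + B3) + card (((x' + y') +o M) \<union> ((x + y) +o M))"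
      using n1 n2 fin3 Ms(2) by (intro card_Un_disjoint) auto
    moreover have "(A + B3) \<union> (((x' + y') +o M) \<union> ((x + y) +o M)) \<subseteq> (A' + B') + M"
    proof -
      have "A + B3 \<subseteq> A' + B'" using AA' by (intro set_plus_mono2) (auto simp: B3')
      then have "A + B3 \<subseteq> (A' + B') + M" using subset_plus_subgroup[OF Ms(1)] by blast
      moreover have "(x' + y') +o M \<subseteq> (A' + B') + M" using Ms by (intro set_plus_mono3 set_plus_intro)
      moreover have "(x + y) +o M \<subseteq> (A' + B') + M" using K(3,4) AA' by (intro set_plus_mono3 set_plus_intro) auto
      ultimately show ?thesis by blast
    qed
    ultimately show ?thesis using card_mono[OF finS] by metis
  qed
  moreover have "card (A' + M) = card (A + M)"
  proof -
    have "K + M = M"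
    proof
      show "K + M \<subseteq> M" using M(2) subgroupD(2)[OF Ms(1)] by (auto elim!: set_plus_elim)
      show "M \<subseteq> K + M" using subset_plus_subgroup[OF K(1), of M] by (simp add: add.commute)
    qed
    then show ?thesis by (simp add: A'_def add.assoc)
  qed
  moreover have "card (B' + M) \<le> card B3 + card M"
  proof -
    have "B' + M \<subseteq> B3 \<union> Y"
    proof -
      have "periodic M (B3 \<union> Y)" unfolding Y_def by (rule periodic_Un[OF perB3 periodic_coset[OF Ms(1)]])
      then have "(B3 \<union> Y) + M = B3 \<union> Y" by (rule plus_subgroup_eq[OF Ms(1)])
      moreover have "B' + M \<subseteq> (B3 \<union> Y) + M" by (rule set_plus_mono2) (auto simp: B3')
      ultimately show ?thesis by simp
    qed
    then have "card (B' + M) \<le> card (B3 \<union> Y)" using fin3 Ms by (intro card_mono) (auto simp: Y_def)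
    also have "\<dots> \<le> card B3 + card Y" by (rule card_Un_le)
    finally show ?thesis by (simp add: Y_def)
  qed
  moreover have "card (A + M) + card B3 \<le> card (A + B3) + card L"
    using kneser[of "A + M" B3] finite_sumset[OF c(1) Ms(2)] fin3 \<open>B3 \<noteq> {}\<close> c(3) subset_plus_subgroup[OF Ms(1), of A]
    unfolding e1 L_def by auto
  ultimately have "2 * card M \<le> card L" using ce by linarith
  then have KL: "card K < card L" using ltKM by linarith
  have AB3: "A + B3 \<subseteq> A + B" by (rule set_plus_mono2) (auto simp: B3_def)
  have D: "A + B \<subseteq> G" using sumset_subset_subgroup[OF G] .
  have LG: "L \<subset> G"
    using stab_subset_subgroup[OF G(1), of "A + B3"] periodic_full[OF G(1), of "A + B3"] AB3 D DG fin3 periodic_stab[of "A + B3"]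
    unfolding L_def by blast
  have "stab (A + B) \<subseteq> K" using quasi_periodic_stab_subset[of K "x + y" "A + B"] q c by (simp add: quasi_split_def)
  from card_mono[OF K(2) this] have "L \<noteq> stab (A + B)" using KL by (metis not_le)
  moreover have "B4 \<subseteq> y +o L" using MsubL Yy by (auto simp: B4_def in_translate)
  ultimately obtain p where "quasi_periodic L p (A + B)"
    using peel_quasi_periodic[OF cr, of B3 B4 L y] \<open>B3 \<noteq> {}\<close> \<open>y \<in> B4\<close> L_def by (auto simp: B3_def B4_def)
  then show ?thesis using LG KL by blast
qed

text \<open>If the exceptional coset of the filled sum contains \<open>x + y\<close>, its subgroup
  \<open>N\<close> serves for \<open>A + B\<close> itself. Otherwise \<open>x\<close> or
  \<open>y\<close> is outside the exceptional coset of its summand, and peeling applies, if need be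
  with the summands exchanged.\<close>

lemma quasi_periodic_enlarge:
  assumes G: "add_subgroup G" "A \<subseteq> G" "B \<subseteq> G" and cr: "critical_pair A B" and DG: "A + B \<noteq> G"
    and generating: "generating G A" "generating G B" "generating G (G - ((A + B) + K))"
    and q: "quasi_split A B K x y" and KG: "K \<subset> G"
    and q': "quasi_periodic M p ((A + B) + K)" "M \<subset> G"
  shows "\<exists>L p. quasi_periodic L p (A + B) \<and> L \<subset> G \<and> card K < card L"
proof -
  note c = critical_pairD[OF cr]
  note qs = quasi_split_critical_pair[OF cr q]
  have K: "add_subgroup K" "finite K" "x \<in> A" "y \<in> B" "quasi_periodic K (x + y) (A + B)"
    using q unfolding quasi_split_def by blast+
  have M: "add_subgroup M" using q' by (simp add: quasi_periodic_def)
  have sub: "A + K \<subseteq> G" "B + K \<subseteq> G" using sumset_subset_subgroup[OF G(1)] G KG by blast+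
  have ne: "(A + K) + (B + K) \<union> (p +o M) \<noteq> G"
    using generating_not_coset(2)[OF generating(3) M q'(2), of p] unfolding qs(2) by blast
  have q'': "quasi_periodic M p ((A + K) + (B + K))" "M \<subseteq> G" using q' qs(2) by auto
  obtain N u v where N: "quasi_split (A + K) (B + K) N u v" "M \<subseteq> N" "N \<subset> G"
    using quasi_split_exists[OF G(1) sub qs(1) q'' ne] by metis
  have Ns: "add_subgroup N" "finite N" "quasi_periodic N (u + v) ((A + B) + K)"
    using N(1) unfolding quasi_split_def qs(2) by auto
  have finD': "finite ((A + B) + K)" using finite_sumset c K by blast
  have "K \<subseteq> N" using quasi_periodic_stab_subset[OF Ns(3) finD'] qs(3) unfolding qs(2) by simp
  moreover have "K \<noteq> N"
  proof
    assume "K = N"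
    then have "periodic N ((A + B) + K)" using periodic_plus_subgroup[OF Ns(1)] by simp
    then show False using Ns(3) coset_eqI[OF Ns(1)] periodic_coset_subset unfolding quasi_periodic_def
      by (metis IntE all_not_in_conv)
  qed
  ultimately have KN: "K \<subset> N" by blast
  show ?thesis
  proof (cases "x + y \<in> (u + v) +o N")
    case True
    have e: "(u + v) +o N = (x + y) +o N" using coset_eqI[OF Ns(1) True] .
    have PP: "(x + y) +o K \<subseteq> (x + y) +o N" using KN by simp
    then have "(A + B) - ((x + y) +o N) = ((A + B) + K) - ((u + v) +o N)" using qs(5) unfolding e by blast
    then have "periodic N ((A + B) - ((x + y) +o N))" using Ns(3) by (simp add: quasi_periodic_def)
    moreover have "\<not> (x + y) +o N \<subseteq> A + B" using PP K(5) unfolding quasi_periodic_def by blast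
    moreover have "x + y \<in> (A + B) \<inter> ((x + y) +o N)"
      using set_plus_intro[OF K(3,4)] coset_self[OF Ns(1)] by blast
    ultimately have "quasi_periodic N (x + y) (A + B)"
      using Ns(1,2) unfolding quasi_periodic_def by blast
    then show ?thesis using N(3) psubset_card_mono[OF Ns(2) KN] by blast
  next
    case False
    show ?thesis
    proof (cases "x \<in> u +o N")
      case True
      then have "y \<notin> v +o N" using coset_add_mem[OF Ns(1)] False by blast
      then show ?thesis
        using quasi_periodic_enlarge_aux[OF G(1,3,2) critical_pair_commute[OF cr] _ generating(1) quasi_split_commute[OF q] quasi_split_commute[OF N(1)] N(3) KN]
          DG False by (simp add: add.commute)
    next
      case f: False
      show ?thesis by (rule quasi_periodic_enlarge_aux[OF G cr DG generating(2) q N(1,3) KN False f])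
    qed
  qed
qed

section \<open>Generating pairs\<close>

lemma in_uminus_image: "x \<in> uminus ` S \<longleftrightarrow> - x \<in> (S::'a::ab_group_add set)"
  by (metis image_iff minus_minus)

lemma card_uminus_image [simp]: "card (uminus ` S) = card (S::'a::ab_group_add set)"
  by (rule card_image) (auto simp: inj_on_def)

lemma coset_subset_subgroup: "add_subgroup G \<Longrightarrow> x \<in> G \<Longrightarrow> M \<subseteq> G \<Longrightarrow> x +o M \<subseteq> G"
  using subgroupD(2)[of G x] unfolding translate_subset_iff by blast

text \<open>By maximality an element of \<open>G\<close> is outside \<open>B\<close> exactly if some
  \<open>a\<close> carries it out of \<open>A + B\<close>. This is what allows the third set of a
  trio to take part as a summand.\<close>

lemma complement_sumset:
  assumes G: "add_subgroup G" "A \<subseteq> G" "B \<subseteq> G" and cr: "critical_pair A B"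
  shows "uminus ` (G - (A + B)) + A = uminus ` (G - B)"
proof (rule set_eqI)
  fix z
  show "z \<in> uminus ` (G - (A + B)) + A \<longleftrightarrow> z \<in> uminus ` (G - B)"
  proof
    assume "z \<in> uminus ` (G - (A + B)) + A"
    then obtain c a where z: "z = c + a" "c \<in> uminus ` (G - (A + B))" "a \<in> A"
      by (elim set_plus_elim) blast
    then have c: "- c \<in> G" "- c \<notin> A + B" by (auto simp: in_uminus_image)
    have "- z \<in> G" using subgroupD(4)[OF G(1) c(1), of a] z G(2) by auto
    moreover have "- z \<notin> B"
    proof
      assume "- z \<in> B"
      from set_plus_intro[OF z(3) this] show False using c z(1) by simp
    qed
    ultimately show "z \<in> uminus ` (G - B)" by (simp add: in_uminus_image)
  next
    assume "z \<in> uminus ` (G - B)"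
    then have z: "- z \<in> G" "- z \<notin> B" by (auto simp: in_uminus_image)
    then obtain a where a: "a \<in> A" "a + - z \<notin> A + B" using critical_pair_max2[OF cr, of "- z"] by blast
    have "a + - z \<in> G" using subgroupD(2)[OF G(1) _ z(1)] a G(2) by blast
    then have "z - a \<in> uminus ` (G - (A + B))" using a by (simp add: in_uminus_image)
    from set_plus_intro[OF this a(1)] show "z \<in> uminus ` (G - (A + B)) + A" by simp
  qed
qed

text \<open>In a finite group the third set is finite, and
  \<open>card (A + B) < card A + card B\<close> says the same about each pair of the three
  sets.\<close>

lemma complement_critical_pair:
  assumes G: "add_subgroup G" "A \<subseteq> G" "B \<subseteq> G" "finite G" and cr: "critical_pair A B" and DG: "A + B \<noteq> G"
  shows "critical_pair (uminus ` (G - (A + B))) A"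
proof -
  note c = critical_pairD[OF cr]
  let ?C = "uminus ` (G - (A + B))"
  have D: "A + B \<subseteq> G" using sumset_subset_subgroup[OF G(1-3)] .
  note sum = complement_sumset[OF G(1-3) cr]
  have cC: "card ?C = card G - card (A + B)" using card_Diff_subset[OF c(6) D] by simp
  have "card (?C + A) = card G - card B" using card_Diff_subset[OF c(2) G(3)] by (simp add: sum)
  then have "card (?C + A) < card ?C + card A" 
    using cC c(5) card_mono[OF G(4) D] card_mono[OF G(4,3)] by linarith
  moreover have "x \<in> ?C" if x: "x +o A \<subseteq> ?C + A" for x
  proof -
    have *: "- (x + a) \<in> G \<and> - (x + a) \<notin> B" if "a \<in> A" for a
    proof -
      have "x + a \<in> uminus ` (G - B)" using x that unfolding sum by blast
      then show ?thesis unfolding in_uminus_image Diff_iff .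
    qed
    obtain a where a: "a \<in> A" using c by blast
    have "- x \<in> G" using subgroupD(2)[OF G(1), of "- (x + a)" a] *[OF a] a G(2) by auto
    moreover have "- x \<notin> A + B"
    proof
      assume "- x \<in> A + B"
      then obtain a' b where "- x = a' + b" "a' \<in> A" "b \<in> B" by (auto elim: set_plus_elim)
      then have "- (x + a') = b" by (simp add: algebra_simps)
      then show False using *[OF \<open>a' \<in> A\<close>] \<open>b \<in> B\<close> by simp
    qed
    ultimately show ?thesis by (simp add: in_uminus_image)
  qed
  moreover have "x \<in> A" if x: "x +o ?C \<subseteq> ?C + A" for x
  proof (rule critical_pair_max1[OF cr], rule ccontr)
    have *: "- (x + z) \<in> G \<and> - (x + z) \<notin> B" if "z \<in> ?C" for z
    proof -
      have "x + z \<in> uminus ` (G - B)" using x that unfolding sum by blast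
      then show ?thesis unfolding in_uminus_image Diff_iff .
    qed
    obtain g where g: "g \<in> G - (A + B)" using D DG by blast
    then have "- g \<in> ?C" by blast
    then have "- (x + - g) \<in> G" using * by blast
    then have "g - (- (x + - g)) \<in> G" using g subgroupD(4)[OF G(1)] by blast
    then have xG: "x \<in> G" by simp
    fix b assume b: "b \<in> B" "x + b \<notin> A + B"
    have "x + b \<in> G" using xG b G(3) subgroupD(2)[OF G(1)] by blast
    then have "- (x + b) \<in> ?C" using b by blast
    then have "- (x + - (x + b)) \<notin> B" using * by blast
    then show False using b by simp
  qed
  ultimately show ?thesis using c D DG G(4) unfolding critical_pair_def by auto
qed

lemma generating_uminus: "generating G (uminus ` S) \<longleftrightarrow> generating G S"
proof -
  have "generating G (uminus ` S)" if "generating G S" for S :: "'a set"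
    unfolding generating_def
  proof (intro allI impI notI)
    fix K g assume K: "add_subgroup K" "K \<subset> G" "uminus ` S \<subseteq> g +o K"
    have "S \<subseteq> (- g) +o K"
    proof
      fix s assume "s \<in> S"
      then have "- s - g \<in> K" using K(3) by (auto simp: in_translate)
      then have "- (- s - g) \<in> K" by (rule subgroupD(3)[OF K(1)])
      then show "s \<in> (- g) +o K" by (simp add: in_translate algebra_simps)
    qed
    then show False using generating_not_coset(2)[OF that K(1,2)] by blast
  qed
  from this[of S] this[of "uminus ` S"] show ?thesis by (auto simp: image_image)
qed

text \<open>Only \<open>v +o M\<close> and \<open>v' +o M\<close> may be partially filled, and
  \<open>e +o M\<close> is the coset of the complement. The set \<open>A + M\<close> turns out to be
  closed under subtracting \<open>x + y - e\<close>, a generator modulo \<open>M\<close>, and is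
  therefore \<open>G\<close>. Then an element of \<open>B\<close> outside \<open>v' +o M\<close>
  would have a sum in \<open>e +o M\<close>.\<close>

lemma two_coset_complement_aux:
  assumes G: "add_subgroup G" "A \<subseteq> G" "B \<subseteq> G" "finite A" and M: "add_subgroup M" "M \<subseteq> G"
    and S1: "\<And>a. a \<in> A \<Longrightarrow> a \<notin> v +o M \<Longrightarrow> a +o M \<subseteq> A"
    and S2: "\<And>b. b \<in> B \<Longrightarrow> b \<notin> v' +o M \<Longrightarrow> b +o M \<subseteq> B"
    and v: "v \<in> A" "v + v' \<in> e +o M"
    and F3: "\<And>b. b \<in> G \<Longrightarrow> A \<inter> ((e - b) +o M) = {} \<Longrightarrow> b \<in> B"
    and F2: "\<And>a b. b \<in> B \<Longrightarrow> b \<notin> v' +o M \<Longrightarrow> a \<in> A \<Longrightarrow> a + b \<notin> e +o M"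
    and u: "\<And>a b. a \<in> A \<Longrightarrow> b \<in> B \<Longrightarrow> a + b = x + y \<Longrightarrow> a \<in> x +o K \<and> b \<in> y +o K"
    and xy: "x \<in> A" "y \<in> B" "x + y \<notin> e +o M" "x \<notin> v +o M"
    and K: "K \<subset> M" and gm: "generates_mod G M (x + y - e)"
  shows "B \<subseteq> v' +o M"
proof
  have KM: "z +o K \<subseteq> z +o M" for z using K by simp
  have xM: "x +o M \<subseteq> A" using S1 xy by blast
  \<comment> \<open>If \<open>x +o M\<close> and \<open>y +o M\<close> were both full, the
    representations of \<open>x + y\<close> would spread over \<open>M\<close>, beyond
    \<open>K\<close>.\<close>
  have yv': "y \<in> v' +o M"
  proof (rule ccontr)
    assume "y \<notin> v' +o M"
    then have yM: "y +o M \<subseteq> B" using S2 xy by blast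
    have "M \<subseteq> K"
    proof
      fix m assume m: "m \<in> M"
      have "x - m \<in> A" using xM subgroupD(3)[OF M(1) m] by (auto simp: translate_subset_iff)
      moreover have "y + m \<in> B" using yM m by (auto simp: translate_subset_iff)
      ultimately have "y + m \<in> y +o K" using u[of "x - m" "y + m"] by simp
      then show "m \<in> K" by (simp add: in_translate)
    qed
    then show False using K by blast
  qed
  define w where "w = x + y - e"
  define A2 where "A2 = A + M"
  have A2: "A \<subseteq> A2" "periodic M A2" using subset_plus_subgroup[OF M(1)] periodic_plus_subgroup[OF M(1)] by (auto simp: A2_def)
  have A2I: "z \<in> A2" if "a \<in> A" "z \<in> a +o M" for z a
    using that set_plus_mono3[of a A M] unfolding A2_def by blast
  have step: "a - w \<in> A2" if a: "a \<in> A" for a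
  proof (cases "a \<in> x +o M")
    case True
    \<comment> \<open>Modulo \<open>M\<close>, \<open>a - w\<close> is \<open>e - y\<close>, which
      is congruent to \<open>e - v'\<close> and so to \<open>v\<close>.\<close>
    have "(a - x) + (v' - y) + ((e - (v + v'))) \<in> M"
      using True yv' v(2) subgroupD(2)[OF M(1)] subgroup_diff_comm[OF M(1)] by (simp only: in_translate)
    moreover have "(a - x) + (v' - y) + ((e - (v + v'))) = a - w - v" by (simp add: w_def algebra_simps)
    ultimately show ?thesis using A2I[OF v(1)] by (simp add: in_translate)
  next
    case False
    define b where "b = x + y - a"
    have aG: "a \<in> G" "x \<in> G" "y \<in> G" using a xy G by auto
    have bG: "b \<in> G" unfolding b_def using aG subgroupD(2,4)[OF G(1)] by blast
    \<comment> \<open>An element of \<open>B\<close> in this coset would yield a representation of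
      \<open>x + y\<close> with first summand in the coset of \<open>a\<close>: by changing
      \<open>a\<close> if \<open>a +o M\<close> is full, and by changing \<open>b1\<close>
      otherwise. But \<open>a\<close> is not in \<open>x +o M\<close>.\<close>
    have no: "b1 \<notin> b +o M" if b1: "b1 \<in> B" for b1
    proof
      assume b1b: "b1 \<in> b +o M"
      have ab1: "a + b1 \<in> (x + y) +o M" using b1b by (simp add: b_def in_translate algebra_simps)
      show False
      proof (cases "a \<in> v +o M")
        case False': False
        then have "a +o M \<subseteq> A" using S1 a by blast
        moreover have "x + y - b1 \<in> a +o M" using ab1 subgroup_diff_comm[OF M(1)] by (simp add: in_translate algebra_simps)
        ultimately have "x + y - b1 \<in> x +o K" using u[of "x + y - b1" b1] b1 by auto
        then have "x + y - b1 \<in> x +o M" using KM by blast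
        then have "(x + y - b1 - x) - (x + y - b1 - a) \<in> M" 
          using \<open>x + y - b1 \<in> a +o M\<close> subgroupD(4)[OF M(1)] by (simp only: in_translate)
        then show False using False by (simp add: in_translate)
      next
        case True
        have "b1 \<notin> v' +o M"
        proof
          assume "b1 \<in> v' +o M"
          then have "a + b1 \<in> (v + v') +o M" using coset_add_mem[OF M(1) True] by blast
          then have "a + b1 \<in> e +o M" using coset_eqI[OF M(1) v(2)] by simp
          then have "(x + y) +o M = e +o M" using coset_eqI[OF M(1) ab1] coset_eqI[OF M(1), of "a + b1" e] by simp
          then show False using xy(3) coset_self[OF M(1), of "x + y"] by simp
        qed
        then have "b1 +o M \<subseteq> B" using S2 b1 by blast
        moreover have "b \<in> b1 +o M" using b1b subgroup_diff_comm[OF M(1)] by (simp add: in_translate)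
        ultimately have "b \<in> B" by blast
        then have "a \<in> x +o K" using u[of a b] a by (simp add: b_def)
        then show False using False KM by blast
      qed
    qed
    have "b \<notin> B" using no coset_self[OF M(1)] by blast
    then obtain a1 where a1: "a1 \<in> A" "a1 \<in> (e - b) +o M" using F3[OF bG] by blast
    have "e - b = a - w" by (simp add: b_def w_def algebra_simps)
    then have "a - w \<in> a1 +o M" using a1(2) subgroup_diff_comm[OF M(1)] by (simp add: in_translate)
    then show ?thesis using A2I[OF a1(1)] by blast
  qed
  have A2G: "A2 \<subseteq> G" unfolding A2_def using sumset_subset_subgroup[OF G(1,2) M(2)] .
  have fin: "finite A2"
  proof -
    have "x +o M \<subseteq> A" by fact
    then have "finite M" using finite_subset G(4) by fastforce
    then show ?thesis unfolding A2_def using finite_sumset G(4) by blast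
  qed
  have "z + (- w) \<in> A2" if z: "z \<in> A2" for z
  proof -
    obtain a m where am: "z = a + m" "a \<in> A" "m \<in> M" using z by (auto simp: A2_def elim: set_plus_elim)
    have "(a - w) + m \<in> A2" using periodicD[OF step[OF am(2)] am(3) A2(2)] .
    then show ?thesis using am by (simp add: algebra_simps)
  qed
  then have "- w \<in> stab A2" using in_stab_iff[OF fin] by blast
  then have "w \<in> stab A2" using subgroupD(3)[OF add_subgroup_stab, of "- w" A2] by simp
  then have "A2 = G"
    using generates_mod_periodic_full[OF G(1) gm fin _ A2G A2(2)] xy(1) A2(1) in_stab_iff[OF fin] by (auto simp: w_def)
  fix b assume b: "b \<in> B"
  show "b \<in> v' +o M"
  proof (rule ccontr)
    assume n: "b \<notin> v' +o M"
    have eG: "e \<in> G"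
    proof -
      have "(x + y) - (x + y - e) \<in> G" using gm xy G subgroupD(2)[OF G(1), of x y] 
        subgroupD(4)[OF G(1), of "x + y" "x + y - e"] by (auto simp: generates_mod_def)
      then show ?thesis by simp
    qed
    then have "e - b \<in> A2" using b G(3) subgroupD(4)[OF G(1)] \<open>A2 = G\<close> by blast
    then obtain a m where am: "e - b = a + m" "a \<in> A" "m \<in> M" by (auto simp: A2_def elim: set_plus_elim)
    then have "a + b - e = - m" by (simp add: algebra_simps)
    then have "a + b \<in> e +o M" using subgroupD(3)[OF M(1) am(3)] by (simp add: in_translate)
    then show False using F2[OF b n am(2)] by blast
  qed
qed

text \<open>Filling removes the exceptional coset from the complement; the rest \<open>E\<close>
  lies in a coset of the proper subgroup \<open>M\<close>. If \<open>M = K\<close>, then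
  \<open>E\<close> is one coset, and maximality allows a step back by \<open>w\<close> from every
  element outside the coset of \<open>x\<close> or of \<open>y\<close>, which makes these the first
  terms. If \<open>M\<close> is larger, the beat formed by \<open>E\<close> and \<open>A + K\<close>
  ends with a summand inside a single coset of \<open>M\<close>, which is impossible.\<close>

lemma nongenerating_complement_chord:
  assumes G: "add_subgroup G" "A \<subseteq> G" "B \<subseteq> G" and cr: "critical_pair A B"
    and generating: "generating G A" "generating G B" "generating G (G - (A + B))" "\<not> generating G (G - ((A + B) + K))"
    and q: "quasi_split A B K x y" and KG: "K \<subset> G" and D'G: "(A + B) + K \<noteq> G"
  shows "\<exists>d k l. generates_mod G K d \<and> progression K d x k (A + K) \<and> progression K d y l (B + K)"
proof -
  note c = critical_pairD[OF cr]
  note qs = quasi_split_critical_pair[OF cr q]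
  define A' B' E where "A' = A + K" and "B' = B + K" and "E = G - ((A + B) + K)"
  have K: "add_subgroup K" "finite K" "x \<in> A" "y \<in> B" "quasi_periodic K (x + y) (A + B)"
    using q unfolding quasi_split_def by blast+
  have cr': "critical_pair A' B'" using qs(1) by (simp add: A'_def B'_def)
  note c' = critical_pairD[OF cr']
  have sum': "A' + B' = (A + B) + K" "stab (A' + B') = K" using qs(2,3) by (auto simp: A'_def B'_def)
  note s' = critical_pair_stab[OF cr' sum'(2)[symmetric]]
  have sub: "A' \<subseteq> G" "B' \<subseteq> G" unfolding A'_def B'_def using sumset_subset_subgroup[OF G(1)] G KG by blast+
  have D': "A' + B' \<subseteq> G" using sumset_subset_subgroup[OF G(1) sub] .
  have E: "E = G - (A' + B')" by (simp add: E_def sum')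
  have AA': "A \<subseteq> A'" "B \<subseteq> B'" using subset_plus_subgroup[OF K(1)] by (auto simp: A'_def B'_def)
  have gen': "generating G A'" "generating G B'" using generating_mono generating AA' by blast+
  obtain e where e: "e \<in> E" using D' D'G by (auto simp: E sum')
  obtain M where M: "add_subgroup M" "M \<subseteq> G" "E \<subseteq> e +o M"
    and least: "\<And>L z. add_subgroup L \<Longrightarrow> E \<subseteq> z +o L \<Longrightarrow> M \<subseteq> L"
    using closure_exists[OF G(1) _ e] by (metis Diff_subset E_def)
  have MG: "M \<subset> G" using generating(4) least M(2) unfolding generating_def E_def by blast
  have perG: "periodic K G" using periodic_subgroup[OF G(1)] periodic_mono KG by blast
  have perE: "periodic K E" unfolding E by (rule periodic_Diff[OF K(1) perG s'(5)])
  have KM: "K \<subseteq> M"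
  proof
    fix k assume "k \<in> K"
    then have "e + k \<in> E" using periodicD[OF e _ perE] by blast
    then have "e + k \<in> e +o M" using M(3) by blast
    then show "k \<in> M" by (simp add: in_translate)
  qed
  have ED: "G - (A + B) \<subseteq> E \<union> ((x + y) +o K)" using qs(5) by (auto simp: E_def)
  have xyG: "x \<in> G" "y \<in> G" "e \<in> G" using K G e by (auto simp: E_def)
  have pKL: "(x + y) +o K \<subseteq> e +o L" if "add_subgroup L" "x + y \<in> e +o L" "K \<subseteq> L" for L
  proof -
    have "(x + y) +o K \<subseteq> (x + y) +o L" using that(3) by simp
    then show ?thesis using coset_eqI[OF that(1,2)] by simp
  qed
  have out: "x + y \<notin> e +o M"
  proof
    assume "x + y \<in> e +o M"
    then have "G - (A + B) \<subseteq> e +o M" using ED M(3) pKL[OF M(1) _ KM] by blast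
    then show False using generating_not_coset(2)[OF generating(3) M(1) MG] by blast
  qed
  define w where "w = x + y - e"
  \<comment> \<open>\<open>E\<close> and the coset of \<open>x + y\<close> together contain the
    complement of \<open>A + B\<close>, which generates \<open>G\<close>; so the difference of their
    positions generates \<open>G\<close> modulo \<open>M\<close>.\<close>
  have gm: "generates_mod G M w"
    unfolding generates_mod_def
  proof (intro conjI allI impI)
    show "w \<in> G" unfolding w_def using xyG subgroupD(2,4)[OF G(1)] by blast
    fix L assume L: "add_subgroup L" "L \<subseteq> G" "M \<subseteq> L" "w \<in> L"
    have "e +o M \<subseteq> e +o L" using L(3) by simp
    moreover have "x + y \<in> e +o L" using L(4) by (simp add: w_def in_translate)
    ultimately have "G - (A + B) \<subseteq> e +o L" using ED M(3) pKL[OF L(1)] KM L(3) by blast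
    then show "L = G" using generating_cosetD[OF generating(3) L(1,2)] by blast
  qed
  have u: "a \<in> x +o K \<and> b \<in> y +o K" if "a \<in> A'" "b \<in> B'" "a + b = x + y" for a b
    using qs(4)[of a b] that coset_self[OF K(1), of "x + y"] by (simp add: A'_def B'_def)
  have inE: "a + b \<notin> E" if "a \<in> A'" "b \<in> B'" for a b
    using set_plus_intro[OF that] by (simp add: E)
  have max2: "b \<in> B'" if "b \<in> G" "\<And>a. a \<in> A' \<Longrightarrow> a + b \<notin> E" for b
  proof (rule critical_pair_max2[OF cr'])
    fix a assume "a \<in> A'"
    then show "a + b \<in> A' + B'" using that sub subgroupD(2)[OF G(1), of a b] by (auto simp: E)
  qed
  have max1: "a \<in> A'" if "a \<in> G" "\<And>b. b \<in> B' \<Longrightarrow> a + b \<notin> E" for a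
  proof (rule critical_pair_max1[OF cr'])
    fix b assume "b \<in> B'"
    then show "a + b \<in> A' + B'" using that sub subgroupD(2)[OF G(1), of a b] by (auto simp: E)
  qed
  have nG: "A' \<noteq> G" "B' \<noteq> G"
    using card_le_sumset_left[OF c'(1,2,4)] card_le_sumset_right[OF c'(1,2,3)] c' D' D'G card_seteq[of G "A' + B'"]
    by (metis sum'(1))+
  show ?thesis
  proof (cases "M = K")
    case True
    have EK: "E = e +o K" using M(3) True periodic_coset_subset[OF perE e] by blast
    have one: "\<exists>k. progression K w z k S"
      if S: "finite S" "S \<noteq> {}" "S \<subseteq> G" "periodic K S" "S \<noteq> G" 
        and backward: "\<And>s. s \<in> S \<Longrightarrow> s \<notin> z +o K \<Longrightarrow> s - w \<in> S" for S z
    proof -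
      have F: "S - (w +o S) \<subseteq> z +o K" using backward unfolding subset_iff in_translate Diff_iff by blast
      then have "card (S - (w +o S)) \<le> card K" using card_mono[of "z +o K" "S - (w +o S)"] K(2) by simp
      then have "card (S \<union> (w +o S)) \<le> card S + card K" using card_Un_Diff[of "w +o S" S] S(1) by (simp add: Un_commute)
      then obtain q k where Sq: "S = (\<Union>i\<in>{0..k}. (q + nmult i w) +o K)" "q \<in> S" "q - w \<notin> S"
        using progression_structure[OF G(1) K(1) gm[unfolded True] S] by metis
      have "q \<in> z +o K" using F Sq(2,3) unfolding subset_iff in_translate Diff_iff by blast
      then have "z \<in> q +o K" using subgroup_diff_comm[OF K(1)] by (simp add: in_translate)
      then show ?thesis using progression_shift[OF K(1), of w q k S z] Sq(1) unfolding progression_def by blast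
    qed
    \<comment> \<open>By unique representation \<open>x + y - s\<close> is not in \<open>B'\<close>,
      so by maximality some \<open>a \<in> A'\<close> carries it into \<open>E = e +o K\<close>.
      This \<open>a\<close> is \<open>s - w\<close> modulo \<open>K\<close>.\<close>
    have backA: "s - w \<in> A'" if s: "s \<in> A'" "s \<notin> x +o K" for s
    proof -
      define b where "b = x + y - s"
      have "b \<in> G" using xyG s sub subgroupD(2,4)[OF G(1)] unfolding b_def by blast
      moreover have "b \<notin> B'" using u[of s b] s by (auto simp: b_def)
      ultimately obtain a where a: "a \<in> A'" "a + b \<in> E" using max2 by blast
      have eq: "(s - w) - a = e - (a + b)" by (simp add: w_def b_def algebra_simps)
      have "(s - w) - a \<in> K"
        unfolding eq using a(2)[unfolded EK in_translate] subgroup_diff_comm[OF K(1), of e "a + b"] by blast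
      from periodicD[OF a(1) this s'(3)] show ?thesis by simp
    qed
    have backB: "s - w \<in> B'" if s: "s \<in> B'" "s \<notin> y +o K" for s
    proof -
      define a where "a = x + y - s"
      have "a \<in> G" using xyG s sub subgroupD(2,4)[OF G(1)] unfolding a_def by blast
      moreover have "a \<notin> A'" using u[of a s] s by (auto simp: a_def)
      ultimately obtain b where b: "b \<in> B'" "a + b \<in> E" using max1 by blast
      have eq: "(s - w) - b = e - (a + b)" by (simp add: w_def a_def algebra_simps)
      have "(s - w) - b \<in> K"
        unfolding eq using b(2)[unfolded EK in_translate] subgroup_diff_comm[OF K(1), of e "a + b"] by blast
      from periodicD[OF b(1) this s'(4)] show ?thesis by simp
    qed
    show ?thesis
      using one[OF c'(1,3) sub(1) s'(3) nG(1) backA] one[OF c'(2,4) sub(2) s'(4) nG(2) backB] gm True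
      unfolding A'_def B'_def by blast
  next
    case MK: False
    then have KM': "K \<subset> M" using KM by blast
    have finG: "finite G"
    proof -
      have "(x + y) +o M \<subseteq> A' + B'"
      proof
        fix z assume z: "z \<in> (x + y) +o M"
        have "z \<in> G" using z M(2) xyG subgroupD(2)[OF G(1)] by (auto simp: elt_set_plus_def)
        moreover have "z \<notin> e +o M" using z coset_disjoint[OF M(1), of "x + y" e] out by (auto simp: in_translate)
        ultimately show "z \<in> A' + B'" using M(3) by (auto simp: E)
      qed
      then have "finite ((x + y) +o M)" using c'(6) finite_subset by blast
      then have "finite E" using M(3) finite_subset by (metis finite_translate)
      moreover have "G = E \<union> (A' + B')" using D' by (auto simp: E)
      ultimately show ?thesis using c'(6) by simp
    qed
    let ?C = "uminus ` E"
    \<comment> \<open>The trio is rotated: the negative of \<open>E\<close>, moved by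
      \<open>e\<close>, lies in \<open>M\<close> and generates it, so the beat with closure
      \<open>M\<close> can be applied to it and \<open>A'\<close>.\<close>
    have crC: "critical_pair (e +o ?C) A'"
      using critical_pair_translate[OF complement_critical_pair[OF G(1) sub finG cr'], of e 0] D'G by (simp add: E sum')
    have sumC: "(e +o ?C) + A' = e +o uminus ` (G - B')"
      using complement_sumset[OF G(1) sub cr'] by (simp add: set_plus_rearrange3 E)
    have eC: "e +o ?C = uminus ` (- e +o E)"
    proof (rule set_eqI)
      show "z \<in> e +o ?C \<longleftrightarrow> z \<in> uminus ` (- e +o E)" for z
        by (simp add: in_translate in_uminus_image)
    qed
    have CM: "e +o ?C \<subseteq> M"
    proof
      fix z assume "z \<in> e +o ?C"
      then have "e - z \<in> E" by (simp add: in_translate in_uminus_image)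
      then have "- z \<in> M" using M(3) by (auto simp: in_translate)
      then show "z \<in> M" using subgroupD(3)[OF M(1), of "- z"] by simp
    qed
    have genC: "generating M (e +o ?C)" unfolding eC generating_uminus generating_translate using least unfolding generating_def by blast
    have "e +o ?C \<noteq> M"
    proof
      assume CM': "e +o ?C = M"
      have "M \<subseteq> stab (A' + B')"
      proof
        fix m assume m: "m \<in> M"
        show "m \<in> stab (A' + B')" unfolding in_stab_iff[OF c'(6)]
        proof (intro ballI, rule ccontr)
          fix z assume z: "z \<in> A' + B'" "z + m \<notin> A' + B'"
          have "z + m \<in> G" using z D' m M(2) subgroupD(2)[OF G(1)] by blast
          then have "z + m \<in> e +o M" using z M(3) by (auto simp: E)
          then have "(z + m - e) - m \<in> M" using m subgroupD(4)[OF M(1)] unfolding in_translate by blast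
          moreover have "(z + m - e) - m = z - e" by simp
          ultimately have "e - z \<in> M" using subgroup_diff_comm[OF M(1), of z e] by simp
          then have "e - z \<in> e +o ?C" using CM' by simp
          then have "z \<in> E" by (simp add: in_translate in_uminus_image)
          then show False using z by (simp add: E)
        qed
      qed
      then show False using KM' sum'(2) by simp
    qed
    then obtain v where v: "v \<in> A'" "periodic M (A' - (v +o M))" "\<not> v +o M \<subseteq> (e +o ?C) + A'"
      using subgroup_beat[OF crC M(1) CM genC] by metis
    obtain z where z: "z \<in> v +o M" "z \<notin> (e +o ?C) + A'" using v(3) by blast
    define v' where "v' = e - z"
    have zG: "z \<in> G" using z(1) v(1) sub coset_subset_subgroup[OF G(1) _ M(2), of v] by blast
    have v': "v' \<in> B'"
    proof (rule ccontr)
      assume n: "v' \<notin> B'"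
      have "v' \<in> G" using zG xyG subgroupD(4)[OF G(1)] by (simp add: v'_def)
      then have "z \<in> e +o uminus ` (G - B')" using n by (simp add: in_translate in_uminus_image v'_def)
      then show False using z(2) sumC by simp
    qed
    have vv': "v + v' \<in> e +o M" using z(1) subgroup_diff_comm[OF M(1)] by (simp add: v'_def in_translate algebra_simps)
    have S1: "a +o M \<subseteq> A'" if "a \<in> A'" "a \<notin> v +o M" for a
      using periodic_coset_subset[OF v(2), of a] that by blast
    have F2: "a + b \<notin> e +o M" if ab: "a \<in> A'" "a \<notin> v +o M" "b \<in> B'" for a b
    proof
      assume "a + b \<in> e +o M"
      then have "e \<in> (a + b) +o M" using subgroup_diff_comm[OF M(1)] by (simp add: in_translate)
      then have "e - b \<in> a +o M" by (simp add: in_translate algebra_simps)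
      then have "e - b \<in> A'" using S1[OF ab(1,2)] by blast
      from inE[OF this ab(3)] show False using e by simp
    qed
    have F3: "b \<in> B'" if b: "b \<in> G" "A' \<inter> ((e - b) +o M) = {}" for b
    proof (rule max2[OF b(1)])
      fix a assume "a \<in> A'"
      then have "a \<notin> (e - b) +o M" using b(2) by blast
      then have "a + b \<notin> e +o M" by (simp add: in_translate algebra_simps)
      then show "a + b \<notin> E" using M(3) by blast
    qed
    have F3': "a \<in> A'" if a: "a \<in> G" "B' \<inter> ((e - a) +o M) = {}" for a
    proof (rule max1[OF a(1)])
      fix b assume "b \<in> B'"
      then have "b \<notin> (e - a) +o M" using a(2) by blast
      then have "a + b \<notin> e +o M" by (simp add: in_translate algebra_simps)
      then show "a + b \<notin> E" using M(3) by blast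
    qed
    have F2': "a + b \<notin> e +o M" if ab: "b \<in> B'" "b \<notin> v' +o M" "a \<in> A'" for a b
    proof (cases "a \<in> v +o M")
      case True
      show ?thesis
      proof
        assume "a + b \<in> e +o M"
        then have "(a + b - e) - (a - v) - (v + v' - e) \<in> M"
          using True vv' subgroupD(4)[OF M(1)] by (simp only: in_translate)
        then have "b \<in> v' +o M" by (simp add: in_translate algebra_simps)
        then show False using ab(2) by blast
      qed
    qed (use F2 ab in blast)
    have S2: "b +o M \<subseteq> B'" if b: "b \<in> B'" "b \<notin> v' +o M" for b
    proof
      fix b1 assume b1: "b1 \<in> b +o M"
      have "b1 \<in> G" using b1 b sub coset_subset_subgroup[OF G(1) _ M(2), of b] by blast
      moreover have "a \<notin> (e - b1) +o M" if "a \<in> A'" for a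
      proof
        assume "a \<in> (e - b1) +o M"
        then have "(a - (e - b1)) - (b1 - b) \<in> M" using b1 subgroupD(4)[OF M(1)] by (simp only: in_translate)
        then have "a + b \<in> e +o M" by (simp add: in_translate algebra_simps)
        then show False using F2'[OF b that] by blast
      qed
      ultimately show "b1 \<in> B'" using F3 by blast
    qed
    have xy': "x \<in> A'" "y \<in> B'" using K AA' by auto
    show ?thesis
    proof (cases "x \<in> v +o M")
      case False
      have "B' \<subseteq> v' +o M"
        by (rule two_coset_complement_aux[OF G(1) sub c'(1) M(1,2) S1 S2 v(1) vv' F3 F2' u xy' out False KM' gm[unfolded w_def]])
      then show ?thesis using generating_not_coset(2)[OF gen'(2) M(1) MG] by blast
    next
      case True
      have ny: "y \<notin> v' +o M"
      proof
        assume "y \<in> v' +o M"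
        then have "x + y \<in> (v + v') +o M" using coset_add_mem[OF M(1) True] by blast
        then show False using out coset_eqI[OF M(1) vv'] by simp
      qed
      have F2s: "b + a \<notin> e +o M" if "a \<in> A'" "a \<notin> v +o M" "b \<in> B'" for a b
        using F2[OF that] by (simp add: add.commute)
      have us: "b \<in> y +o K \<and> a \<in> x +o K" if "b \<in> B'" "a \<in> A'" "b + a = y + x" for a b
        using u[OF that(2,1)] that(3) by (simp add: add.commute)
      have vv2: "v' + v \<in> e +o M" and out2: "y + x \<notin> e +o M" and gm2: "generates_mod G M (y + x - e)"
        using vv' out gm by (simp_all add: w_def add.commute)
      have "A' \<subseteq> v +o M"
        by (rule two_coset_complement_aux[OF G(1) sub(2,1) c'(2) M(1,2) S2 S1 v' vv2 F3' F2s us xy'(2,1) out2 ny KM' gm2])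
      then show ?thesis using generating_not_coset(2)[OF gen'(1) M(1) MG] by blast
    qed
  qed
qed

theorem kemperman_generating:
  assumes G: "add_subgroup G" "A \<subseteq> G" "B \<subseteq> G" and cr: "critical_pair A B" and DG: "A + B \<noteq> G"
    and generating: "generating G A" "generating G B" "generating G (G - (A + B))"
  obtains (pure) d q k q' l where "generates_mod G (stab (A + B)) d"
      "progression (stab (A + B)) d q k A" "k \<ge> 1" "progression (stab (A + B)) d q' l B" "l \<ge> 1"
  | (impure) K x y d k l where "quasi_split A B K x y" "K \<subset> G" "(A + B) + K \<noteq> G" "generates_mod G K d"
      "progression K d x k (A + K)" "k \<ge> 1" "progression K d y l (B + K)" "l \<ge> 1"
proof (cases "\<exists>K p. quasi_periodic K p (A + B) \<and> K \<subset> G")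
  case False
  then show ?thesis using quasi_periodic_or_chord[OF G cr HOL.refl DG generating] pure by blast
next
  case True
  note c = critical_pairD[OF cr]
  define P where "P n \<longleftrightarrow> (\<exists>K p. quasi_periodic K p (A + B) \<and> K \<subset> G \<and> card K = n)" for n
  \<comment> \<open>The sum generates \<open>G\<close> and so leaves the exceptional coset; its
    nonempty periodic part bounds the subgroup.\<close>
  have bound: "n \<le> card (A + B)" if "P n" for n
  proof -
    obtain K p where K: "quasi_periodic K p (A + B)" "K \<subset> G" "card K = n" using \<open>P n\<close> P_def by blast
    have Ks: "add_subgroup K" "periodic K (A + B - (p +o K))" using K by (auto simp: quasi_periodic_def)
    obtain b where b: "b \<in> B" using c by blast
    have "generating G (A + B)" using generating_mono[of G "b +o A" "A + B"] generating(1) set_plus_mono4[OF b, of A] by simp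
    then have "A + B - (p +o K) \<noteq> {}" using generating_not_coset(2)[OF _ Ks(1) K(2), of "A + B" p] by blast
    then have "card K \<le> card (A + B - (p +o K))" using card_le_periodic(1)[OF Ks(2)] c by blast
    also have "\<dots> \<le> card (A + B)" using c by (intro card_mono) auto
    finally show ?thesis using K by simp
  qed
  have "\<exists>n. P n" using True unfolding P_def by blast
  then obtain n where n: "P n" "\<And>m. P m \<Longrightarrow> m \<le> n" using bound ex_has_greatest_nat[of P _ "\<lambda>x. x" "Suc (card (A + B))"]
    by (metis le_imp_less_Suc)
  obtain K0 p where K0: "quasi_periodic K0 p (A + B)" "K0 \<subset> G" "card K0 = n" using n(1) P_def by blast
  have sK0: "add_subgroup K0" using K0 by (simp add: quasi_periodic_def)
  have ne: "(A + B) \<union> (p +o K0) \<noteq> G" using generating_not_coset(2)[OF generating(3) sK0 K0(2), of p] by blast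
  obtain K x y where q: "quasi_split A B K x y" "K0 \<subseteq> K" "K \<subset> G" "A + B + K = (A + B) \<union> (p +o K0)"
    using quasi_split_exists[OF G cr K0(1) _ ne] K0(2) by (metis psubset_imp_subset)
  \<comment> \<open>\<open>K\<close> contains \<open>K0\<close>, so it is of largest size as
    well.\<close>
  have max: "\<not> (\<exists>L p. quasi_periodic L p (A + B) \<and> L \<subset> G \<and> card K < card L)"
  proof
    assume "\<exists>L p. quasi_periodic L p (A + B) \<and> L \<subset> G \<and> card K < card L"
    then obtain L r where L: "quasi_periodic L r (A + B)" "L \<subset> G" "card K < card L" by blast
    then have "P (card L)" unfolding P_def by blast
    moreover have "card K0 \<le> card K" using card_mono[OF _ q(2)] q(1) unfolding quasi_split_def by blast
    ultimately show False using n(2)[of "card L"] K0(3) L(3) by simp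
  qed
  have D'G: "A + B + K \<noteq> G" using q(4) ne by simp
  note qs = quasi_split_critical_pair[OF cr q(1)]
  have Ks: "add_subgroup K" "x \<in> A" "y \<in> B" using q(1) unfolding quasi_split_def by blast+
  have sub: "A + K \<subseteq> G" "B + K \<subseteq> G" using sumset_subset_subgroup[OF G(1)] G q(3) by blast+
  have AA': "A \<subseteq> A + K" "B \<subseteq> B + K" using subset_plus_subgroup[OF Ks(1)] by blast+
  have gen': "generating G (A + K)" "generating G (B + K)" using generating_mono[OF generating(1) AA'(1)] generating_mono[OF generating(2) AA'(2)] by blast+
  have len: "k \<ge> 1" if "generating G S" "progression K d z k S" for S d z k
  proof (rule ccontr)
    assume "\<not> ?thesis"
    then have "k = 0" by simp
    then have "S = z +o K" using that(2) by (simp add: progression_def)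
    then show False using generating_not_coset(1)[OF that(1) Ks(1) q(3)] by blast
  qed
  have "\<exists>d k l. generates_mod G K d \<and> progression K d x k (A + K) \<and> progression K d y l (B + K)"
  proof (cases "generating G (G - (A + B + K))")
    case False
    then show ?thesis using nongenerating_complement_chord[OF G cr generating _ q(1,3) D'G] by blast
  next
    case genE: True
    have "\<not> (\<exists>M p. quasi_periodic M p (A + B + K) \<and> M \<subset> G)"
      using quasi_periodic_enlarge[OF G cr DG generating(1,2) genE q(1,3)] max by blast
    then obtain d r k r' l where p: "generates_mod G K d" "progression K d r k (A + K)" "k \<ge> 1" 
        "progression K d r' l (B + K)" "l \<ge> 1"
      using quasi_periodic_or_chord[OF G(1) sub qs(1) qs(3)[symmetric]] genE gen' D'G unfolding qs(2) by blast
    have xy: "x \<in> A + K" "y \<in> B + K" using Ks AA' by blast+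
    have un: "a \<in> x +o K" if "a \<in> A + K" "b \<in> B + K" "a + b \<in> (x + y) +o K" for a b
      using qs(4)[OF that] by blast
    show ?thesis
      by (rule progressions_unique_sum[OF G(1) Ks(1) q(3) p xy un]) blast+
  qed
  then show ?thesis using impure[OF q(1,3) D'G] len[OF gen'(1)] len[OF gen'(2)] by blast
qed

section \<open>Impure trios and the recursion\<close>

definition critical_pair_in :: "'a::ab_group_add set \<Rightarrow> 'a set \<Rightarrow> 'a set \<Rightarrow> bool" where
  "critical_pair_in G A B \<longleftrightarrow> add_subgroup G \<and> A \<subseteq> G \<and> B \<subseteq> G \<and> critical_pair A B \<and> A + B \<noteq> G"

lemma critical_pair_in_commute: "critical_pair_in G A B \<Longrightarrow> critical_pair_in G B A"
  unfolding critical_pair_in_def using critical_pair_commute[of A B] by (simp add: add.commute)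

lemma neg_sum_compl_commute: "neg_sum_compl G A B = neg_sum_compl G B A"
  by (simp add: neg_sum_compl_def add.commute)

lemma in_neg_sum_compl: "z \<in> neg_sum_compl G A B \<longleftrightarrow> z \<in> G \<and> - z \<notin> A + B"
  by (simp add: neg_sum_compl_def in_uminus_image)

lemma neg_sum_compl_eq:
  assumes "add_subgroup G"
  shows "neg_sum_compl G A B = uminus ` (G - (A + B))"
proof (rule set_eqI)
  show "z \<in> neg_sum_compl G A B \<longleftrightarrow> z \<in> uminus ` (G - (A + B))" for z
    using subgroupD(3)[OF assms, of z] subgroupD(3)[OF assms, of "- z"]
    by (auto simp: in_neg_sum_compl in_uminus_image)
qed

lemma neg_sum_compl_translate:
  assumes "add_subgroup G" "g \<in> G"
  shows "neg_sum_compl G A (g +o B) = (- g) +o neg_sum_compl G A B"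
proof (rule set_eqI)
  fix z
  have "z + g \<in> G \<longleftrightarrow> z \<in> G" using subgroup_add_iff(1)[OF assms] .
  moreover have "A + (g +o B) = g +o (A + B)" by (simp add: set_plus_rearrange4)
  ultimately show "z \<in> neg_sum_compl G A (g +o B) \<longleftrightarrow> z \<in> (- g) +o neg_sum_compl G A B"
    by (simp add: in_translate in_neg_sum_compl)
qed

lemma critical_pair_trio:
  assumes "critical_pair_in G A B"
  shows "trio G (A, B, neg_sum_compl G A B)" "neg_sum_compl G A B \<noteq> {}"
proof -
  have G: "add_subgroup G" "A \<subseteq> G" "B \<subseteq> G" "critical_pair A B" "A + B \<noteq> G"
    using assms by (auto simp: critical_pair_in_def)
  note c = critical_pairD[OF G(4)]
  have "0 \<notin> A + B + neg_sum_compl G A B"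
  proof
    assume "0 \<in> A + B + neg_sum_compl G A B"
    then obtain d z where "0 = d + z" "d \<in> A + B" "z \<in> neg_sum_compl G A B" by (elim set_plus_elim) blast
    then show False by (simp add: in_neg_sum_compl eq_neg_iff_add_eq_0[symmetric])
  qed
  moreover have "finite (G - neg_sum_compl G A B)"
  proof -
    have "G - neg_sum_compl G A B \<subseteq> uminus ` (A + B)" by (auto simp: neg_sum_compl_def)
    then show ?thesis using c(6) finite_subset by blast
  qed
  moreover have "neg_sum_compl G A B \<subseteq> G" by (auto simp: neg_sum_compl_def)
  ultimately show "trio G (A, B, neg_sum_compl G A B)" using G c by simp
  show "neg_sum_compl G A B \<noteq> {}"
    using G(5) sumset_subset_subgroup[OF G(1-3)] unfolding neg_sum_compl_eq[OF G(1)] by blast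
qed

text \<open>
  A beat can leave the cardinalities of \<open>A\<close> and \<open>B\<close> unchanged. In that case fewer of the two sets lie
  in proper cosets of the new group.
\<close>

definition nongen_count :: "'a::ab_group_add set \<Rightarrow> 'a set \<Rightarrow> nat" where
  "nongen_count G A = (if generating G A then 0 else 1)"

text \<open>The two counts add up to at most \<open>2\<close>, so with the factor \<open>3\<close>
  the loss of one element outweighs any change in them.\<close>

definition pair_measure :: "'a::ab_group_add set \<Rightarrow> 'a set \<Rightarrow> 'a set \<Rightarrow> nat" where
  "pair_measure G A B = 3 * (card A + card B) + nongen_count G A + nongen_count G B"

text \<open>The measure is controlled only for infinite \<open>G\<close>: bringing in the third set
  may increase it, but this is done in finite groups, where the proper subgroup \<open>K\<close> has
  smaller order.\<close>

definition reducible :: "'a::ab_group_add set \<Rightarrow> 'a trio \<Rightarrow> nat \<Rightarrow> bool" where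
  "reducible G Y n \<longleftrightarrow> (\<exists>K A B. K \<subset> G \<and> critical_pair_in K A B \<and> (infinite G \<longrightarrow> pair_measure K A B < n) \<and>
     (impure_beat G K Y (A, B, neg_sum_compl K A B) \<or> impure_chord G K Y (A, B, neg_sum_compl K A B)))"

lemma similar_rotate: "similar G T (A, B, C) \<Longrightarrow> similar G T (B, C, A)" "similar G T (A, B, C) \<Longrightarrow> similar G T (C, A, B)"
  using swap12 swap23 by metis+

lemma similar_shift2:
  assumes "similar G T (A, B, C)" "g \<in> G"
  shows "similar G T (A, g +o B, (- g) +o C)"
  using similar_rotate(2)[OF shift[OF similar_rotate(1)[OF assms(1)] assms(2)]] .

lemma closure_is_closure:
  assumes "add_subgroup G" "add_subgroup K" "K \<subseteq> G" "A \<subseteq> K" "A \<noteq> {}"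
    and least: "\<And>L z. add_subgroup L \<Longrightarrow> A \<subseteq> z +o L \<Longrightarrow> K \<subseteq> L"
  shows "is_closure G A K"
proof -
  have "K \<in> cosets G K" using subgroupD(1)[OF assms(1)] unfolding cosets_def by (auto intro: exI[of _ 0])
  then show ?thesis using assms unfolding is_closure_def subgroup_of_def cosets_def by blast
qed

text \<open>Shifting by \<open>- a\<close> makes the closure a subgroup. If \<open>A0\<close> fills
  it, the beat is pure. Otherwise the single partial coset of \<open>B0\<close> is moved onto
  \<open>K\<close>, with the opposite shift on the third set.\<close>

lemma beat_step:
  assumes cp: "critical_pair_in G A B" and Y: "trio G Y" "similar G Y (A, B, neg_sum_compl G A B)"
    and ng: "\<not> generating G A"
  shows "pure_beat G Y \<or> reducible G Y (pair_measure G A B)"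
proof -
  have G: "add_subgroup G" "A \<subseteq> G" "B \<subseteq> G" and cr: "critical_pair A B" and DG: "A + B \<noteq> G"
    using cp by (auto simp: critical_pair_in_def)
  note c = critical_pairD[OF cr]
  obtain a where a: "a \<in> A" using c by blast
  have aG: "a \<in> G" "- a \<in> G" using a G subgroupD(3) by blast+
  define A0 B0 C0 where "A0 = (- a) +o A" and "B0 = a +o B" and "C0 = neg_sum_compl G A B"
  have sim0: "similar G Y (A0, B0, C0)" using shift[OF Y(2) aG(2)] by (simp add: A0_def B0_def C0_def)
  have cr0: "critical_pair A0 B0" using critical_pair_translate[OF cr] by (simp add: A0_def B0_def)
  note c0 = critical_pairD[OF cr0]
  have sum0: "A0 + B0 = A + B" by (simp add: A0_def B0_def translate_plus)
  have C0: "C0 = neg_sum_compl G A0 B0" by (simp add: C0_def neg_sum_compl_def sum0)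
  have C0ne: "C0 \<noteq> {}" using critical_pair_trio(2)[OF cp] by (simp add: C0_def)
  have subG: "A0 \<subseteq> G" "B0 \<subseteq> G" unfolding A0_def B0_def using G aG by (blast intro: coset_subset_subgroup[THEN subsetD])+
  have "0 \<in> A0" using a by (simp add: A0_def in_translate)
  then obtain K where K: "add_subgroup K" "K \<subseteq> G" "A0 \<subseteq> 0 +o K"
    and least: "\<And>L z. add_subgroup L \<Longrightarrow> A0 \<subseteq> z +o L \<Longrightarrow> K \<subseteq> L"
    using closure_exists[OF G(1) subG(1)] by metis
  have A0K: "A0 \<subseteq> K" using K(3) by simp
  have ng0: "\<not> generating G A0" using ng by (simp add: A0_def)
  then have KG: "K \<subset> G" using least K(2) unfolding generating_def by blast
  have genK: "generating K A0" using least unfolding generating_def by blast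
  have propK: "proper_subgroup_of K G" using KG G(1) K(1) by (simp add: proper_subgroup_of_def)
  show ?thesis
  proof (cases "A0 = K")
    case True
    have "stab K = K" 
      using periodic_imp_subset_stab[OF _ periodic_subgroup[OF K(1)]] stab_subset_coset[OF K(1), of K 0]
        subgroupD(1)[OF K(1)] True c0(1) by auto
    then have sB: "stab B0 = K" using critical_pair_stab(7,8)[OF cr0 HOL.refl] True by simp
    have "stabilizer G B0 = K"
    proof -
      have "stabilizer G B0 = G \<inter> stab B0" by (auto simp: stabilizer_def stab_def)
      then show ?thesis using sB K(2) by blast
    qed
    then have "pure_beat_rel G K Y"
      unfolding pure_beat_rel_def using propK True c0(1) Y(1) sim0 C0 C0ne by blast
    then show ?thesis by (auto simp: pure_beat_def)
  next
    case False
    obtain y where y: "y \<in> B0" "periodic K (B0 - (y +o K))" "\<not> y +o K \<subseteq> A0 + B0" "critical_pair A0 (B0 \<inter> (y +o K))"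
      using subgroup_beat[OF cr0 K(1) A0K genK False] by metis
    have yG: "y \<in> G" "- y \<in> G" using y(1) subG subgroupD(3)[OF G(1)] by blast+
    define B1 C1 where "B1 = (- y) +o B0" and "C1 = y +o C0"
    have sim1: "similar G Y (A0, B1, C1)" using similar_shift2[OF sim0 yG(2)] by (simp add: B1_def C1_def)
    have C1: "C1 = neg_sum_compl G A0 B1"
      using neg_sum_compl_translate[OF G(1) yG(2), of A0 B0] by (simp add: B1_def C1_def C0)
    have B1K: "B1 \<inter> K = (- y) +o (B0 \<inter> (y +o K))" 
      by (rule set_eqI) (auto simp: B1_def in_translate)
    have "B1 - K = (- y) +o (B0 - (y +o K))" 
      by (rule set_eqI) (auto simp: B1_def in_translate)
    then have "periodic K (B1 - K)" using y(2) by simp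
    then have stB: "stable K (B1 - K)" unfolding stable_def by (rule plus_subgroup_eq[OF K(1)])
    have crK: "critical_pair A0 (B1 \<inter> K)" using critical_pair_translate[OF y(4), of 0 "- y"] by (simp add: B1K)
    have sum1: "A0 + B1 = (- y) +o (A0 + B0)" by (simp add: B1_def set_plus_rearrange4)
    have nK: "\<not> K \<subseteq> A0 + B1"
    proof
      assume "K \<subseteq> A0 + B1"
      then have "y +o K \<subseteq> y +o (A0 + B1)" by simp
      then show False using y(3) by (simp add: sum1)
    qed
    have split: "z \<in> A0 + (B1 \<inter> K)" if z: "z \<in> A0 + B1" "z \<in> K" for z
    proof -
      obtain u v where uv: "z = u + v" "u \<in> A0" "v \<in> B1" using z(1) by (elim set_plus_elim) blast
      then have "v \<in> K" using z(2) A0K subgroup_add_iff(2)[OF K(1), of u v] by blast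
      then show ?thesis using uv by auto
    qed
    have mono: "A0 + (B1 \<inter> K) \<subseteq> A0 + B1" by (rule set_plus_mono2) auto
    have C1K: "C1 \<inter> K = neg_sum_compl K A0 (B1 \<inter> K)"
    proof (rule set_eqI)
      fix z
      have "- z \<in> K" if "z \<in> K" using subgroupD(3)[OF K(1) that] .
      then show "z \<in> C1 \<inter> K \<longleftrightarrow> z \<in> neg_sum_compl K A0 (B1 \<inter> K)"
        using split[of "- z"] mono K(2) unfolding C1 Int_iff in_neg_sum_compl by blast
    qed
    have ne: "B1 \<inter> K \<noteq> {}" "C1 \<inter> K \<noteq> {}"
    proof -
      show "B1 \<inter> K \<noteq> {}" using critical_pairD(4)[OF crK] .
      obtain k where k: "k \<in> K" "k \<notin> A0 + B1" using nK by blast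
      then have "- k \<in> C1 \<inter> K" using subgroupD(3)[OF K(1) k(1)] K(2) unfolding C1 Int_iff in_neg_sum_compl by auto
      then show "C1 \<inter> K \<noteq> {}" by blast
    qed
    have cpK: "critical_pair_in K A0 (B1 \<inter> K)"
      unfolding critical_pair_in_def using K(1) A0K crK nK mono by blast
    have "is_closure G A0 K" using closure_is_closure[OF G(1) K(1,2) A0K c0(3) least] .
    then have "impure_beat G K Y (A0, B1 \<inter> K, neg_sum_compl K A0 (B1 \<inter> K))"
      unfolding impure_beat_def using propK Y(1) sim1 stB C1 ne C1K by blast
    \<comment> \<open>\<open>A0\<close> generates its new group, so its count drops. If
      \<open>B1\<close> loses no element, it was already non-generating in \<open>G\<close>, so its
      count does not rise.\<close>
    moreover have "pair_measure K A0 (B1 \<inter> K) < pair_measure G A B"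
    proof -
      have cB: "card B1 = card B" "finite B1" using c by (simp_all add: B1_def B0_def)
      have cA: "card A0 = card A" by (simp add: A0_def)
      show ?thesis
      proof (cases "B1 \<subseteq> K")
        case True
        then have "\<not> generating G B1" using K(1) KG generating_not_coset(2)[of G B1 K 0] by auto
        then have "\<not> generating G B" by (simp add: B1_def B0_def)
        moreover have "B1 \<inter> K = B1" using True by blast
        ultimately show ?thesis using genK ng cA cB by (simp add: pair_measure_def nongen_count_def)
      next
        case False
        then have "B1 \<inter> K \<subset> B1" by blast
        then have "card (B1 \<inter> K) < card B" using psubset_card_mono[OF cB(2)] cB(1) by metis
        then show ?thesis using genK ng cA by (simp add: pair_measure_def nongen_count_def)
      qed
    qed
    ultimately show ?thesis unfolding reducible_def using KG cpK by blast
  qed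
qed

section \<open>From progressions to impure chords\<close>

lemma add_coset_eq:
  assumes "add_subgroup H"
  shows "add_coset (d +o H) i (q +o H) = (q + nmult i d) +o H"
proof (induction i)
  case (Suc i)
  have "(d +o H) + ((q + nmult i d) +o H) = (d + (q + nmult i d)) +o (H + H)" by (rule translate_plus)
  then show ?case using Suc plus_subgroup_eq[OF assms periodic_subgroup[OF assms]]
    by (simp add: add_coset_def ac_simps)
qed (simp add: add_coset_def)

lemma generates_mod_quotient:
  assumes G: "add_subgroup G" and H: "add_subgroup H" "H \<subseteq> G" and d: "generates_mod G H d"
  shows "generates_quotient G H (d +o H)"
proof -
  \<comment> \<open>Integer multiples of \<open>d\<close> modulo \<open>H\<close>, written as
    differences of natural multiples; they form a subgroup containing \<open>H\<close> and
    \<open>d\<close>.\<close>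
  define L where "L = {g \<in> G. \<exists>m n. g - (nmult m d - nmult n d) \<in> H}"
  have dG: "d \<in> G" using d by (simp add: generates_mod_def)
  have "add_subgroup L" unfolding add_subgroup_def
  proof (intro conjI ballI)
    show "0 \<in> L" using subgroupD(1) G H by (auto simp: L_def intro!: exI[of _ 0])
    fix x assume "x \<in> L"
    then obtain m n where x: "x \<in> G" "x - (nmult m d - nmult n d) \<in> H" by (auto simp: L_def)
    have "- x - (nmult n d - nmult m d) \<in> H" using subgroupD(3)[OF H(1) x(2)] by (simp add: algebra_simps)
    then show "- x \<in> L" using x(1) subgroupD(3)[OF G] by (auto simp: L_def)
    fix y assume "y \<in> L"
    then obtain m' n' where y: "y \<in> G" "y - (nmult m' d - nmult n' d) \<in> H" by (auto simp: L_def)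
    have "(x + y) - (nmult (m + m') d - nmult (n + n') d) \<in> H" 
      using subgroupD(2)[OF H(1) x(2) y(2)] by (simp add: nmult_add algebra_simps)
    then show "x + y \<in> L" using x(1) y(1) subgroupD(2)[OF G] by (auto simp: L_def)
  qed
  moreover have "L \<subseteq> G" by (auto simp: L_def)
  moreover have "H \<subseteq> L" using H by (auto simp: L_def intro!: exI[of _ 0])
  moreover have "d \<in> L"
  proof -
    have "d - (nmult (Suc 0) d - nmult 0 d) \<in> H" using subgroupD(1)[OF H(1)] by simp
    then show ?thesis using dG unfolding L_def by blast
  qed
  ultimately have LG: "L = G" using d by (simp add: generates_mod_def)
  have generating: "\<exists>n. g +o H = add_coset (d +o H) n H \<or> g +o H = uminus ` add_coset (d +o H) n H" if "g \<in> G" for g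
  proof -
    have "g \<in> L" using that LG by simp
    then obtain m n where mn: "g - (nmult m d - nmult n d) \<in> H" by (auto simp: L_def)
    have e: "add_coset (d +o H) i H = nmult i d +o H" for i using add_coset_eq[OF H(1), of d i 0] by simp
    have um: "uminus ` (nmult i d +o H) = (- nmult i d) +o H" for i
    proof (rule set_eqI)
      fix z
      have "- z - nmult i d \<in> H \<longleftrightarrow> z + nmult i d \<in> H"
        using subgroupD(3)[OF H(1), of "- z - nmult i d"] subgroupD(3)[OF H(1), of "z + nmult i d"] by (auto simp: algebra_simps)
      then show "z \<in> uminus ` (nmult i d +o H) \<longleftrightarrow> z \<in> (- nmult i d) +o H"
        by (simp add: in_uminus_image in_translate)
    qed
    show ?thesis
    proof (cases "n \<le> m")
      case True
      then have "nmult m d = nmult (m - n) d + nmult n d" using nmult_add[of "m - n" n d] by simp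
      then have "g - nmult (m - n) d \<in> H" using mn by simp
      then show ?thesis using coset_eq_iff[OF H(1)] e by blast
    next
      case False
      then have "nmult n d = nmult (n - m) d + nmult m d" using nmult_add[of "n - m" m d] by simp
      then have "g - (- nmult (n - m) d) \<in> H" using mn by (simp add: algebra_simps)
      then have "g +o H = (- nmult (n - m) d) +o H" using coset_eq_iff[OF H(1)] by blast
      then show ?thesis using e um by metis
    qed
  qed
  then show ?thesis using dG unfolding generates_quotient_def cosets_def by blast
qed

lemma progression_R_sequence:
  assumes "add_subgroup H" "progression H d q k S" "q \<in> G"
  shows "R_sequence_from G H (d +o H) (q +o H) k S"
  using assms unfolding R_sequence_from_def progression_def cosets_def by (auto simp: add_coset_eq)

text \<open>Filled and original sets differ exactly by the holes in the exceptional cosets. So the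
  equality for the filled pair shows that \<open>card A + card B - card (A + B)\<close> has the same
  value for the restricted pair.\<close>

lemma quasi_split_restrict:
  assumes cr: "critical_pair A B" and q: "quasi_split A B K x y"
  shows "critical_pair (A \<inter> (x +o K)) (B \<inter> (y +o K))"
    "(A + B) \<inter> ((x + y) +o K) = (A \<inter> (x +o K)) + (B \<inter> (y +o K))"
proof -
  note c = critical_pairD[OF cr]
  note qs = quasi_split_critical_pair[OF cr q]
  have K: "add_subgroup K" "finite K" "x \<in> A" "y \<in> B"
    and u: "\<And>a b. a \<in> A \<Longrightarrow> b \<in> B \<Longrightarrow> a + b \<in> (x + y) +o K \<Longrightarrow> a \<in> x +o K \<and> b \<in> y +o K"
    and card: "card (A + K) + card (B + K) = card ((A + B) + K) + card K"
    using q unfolding quasi_split_def by blast+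
  define Ax By where "Ax = A \<inter> (x +o K)" and "By = B \<inter> (y +o K)"
  have inc: "Ax + By \<subseteq> (A + B) \<inter> ((x + y) +o K)"
  proof
    fix z assume "z \<in> Ax + By"
    then obtain a b where "z = a + b" "a \<in> Ax" "b \<in> By" by (elim set_plus_elim) blast
    then show "z \<in> (A + B) \<inter> ((x + y) +o K)" using coset_add_mem[OF K(1), of a x b y] by (auto simp: Ax_def By_def)
  qed
  show sum: "(A + B) \<inter> ((x + y) +o K) = (A \<inter> (x +o K)) + (B \<inter> (y +o K))"
  proof
    show "(A + B) \<inter> ((x + y) +o K) \<subseteq> (A \<inter> (x +o K)) + (B \<inter> (y +o K))"
    proof
      fix z assume z: "z \<in> (A + B) \<inter> ((x + y) +o K)"
      then obtain a b where "z = a + b" "a \<in> A" "b \<in> B" by (blast elim: set_plus_elim)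
      then show "z \<in> (A \<inter> (x +o K)) + (B \<inter> (y +o K))" using u[of a b] z by auto
    qed
  qed (use inc in \<open>simp add: Ax_def By_def\<close>)
  have fill: "card (S + K) + card (S \<inter> (z +o K)) = card S + card K" if "S + K = S \<union> (z +o K)" "finite S" for S z
    using card_Un_Int[of S "z +o K"] that K(2) by simp
  have "card (A + B + K) + card (Ax + By) = card (A + B) + card K"
    using fill[OF qs(5) c(6)] sum by (simp add: Ax_def By_def)
  moreover have "B + K = B \<union> (y +o K)" 
    using qs(6) subset_plus_subgroup[OF K(1), of B] set_plus_mono3[OF K(4), of K] by blast
  then have "card (B + K) + card By = card B + card K" using fill[OF _ c(2)] by (simp add: By_def)
  moreover have "A + K = A \<union> (x +o K)" 
    using quasi_split_critical_pair(6)[OF critical_pair_commute[OF cr] quasi_split_commute[OF q]] 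
      subset_plus_subgroup[OF K(1), of A] set_plus_mono3[OF K(3), of K] by blast
  then have "card (A + K) + card Ax = card A + card K" using fill[OF _ c(1)] by (simp add: Ax_def)
  ultimately have lt: "card (Ax + By) < card Ax + card By" using card c(5) by linarith
  have xy: "x \<in> Ax" "y \<in> By" using K coset_self[OF K(1)] by (auto simp: Ax_def By_def)
  \<comment> \<open>Sums of \<open>t\<close> with elements of \<open>T\<close> outside
    \<open>y +o K\<close> stay in the filled sum and, by unique representation, off its exceptional
    coset; so they are in \<open>S + T\<close>, and maximality of the large pair applies.\<close>
  have max: "t \<in> S \<inter> (x +o K)"
    if St: "t +o (T \<inter> (y +o K)) \<subseteq> (S \<inter> (x +o K)) + (T \<inter> (y +o K))" "y \<in> T"
      and crS: "critical_pair S T" and qS: "quasi_split S T K x y" for S T t x y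
  proof -
    have sub: "(S \<inter> (x +o K)) + (T \<inter> (y +o K)) \<subseteq> (x + y) +o K"
    proof
      fix z assume "z \<in> (S \<inter> (x +o K)) + (T \<inter> (y +o K))"
      then show "z \<in> (x + y) +o K" using coset_add_mem[OF K(1)] by (elim set_plus_elim) blast
    qed
    have "t + y \<in> (x + y) +o K" using St sub coset_self[OF K(1), of y] unfolding translate_subset_iff by blast
    then have tx: "t \<in> x +o K" by (simp add: in_translate)
    have xS: "x \<in> S" using qS unfolding quasi_split_def by blast
    have tS: "t \<in> S + K" using set_plus_mono3[OF xS, of K] tx by blast
    have "t \<in> S"
    proof (rule critical_pair_max1[OF crS])
      fix b assume b: "b \<in> T"
      show "t + b \<in> S + T"
      proof (cases "b \<in> y +o K")
        case True
        then have "t + b \<in> (S \<inter> (x +o K)) + (T \<inter> (y +o K))" using St(1) b unfolding translate_subset_iff by blast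
        moreover have "(S \<inter> (x +o K)) + (T \<inter> (y +o K)) \<subseteq> S + T" by (rule set_plus_mono2) auto
        ultimately show ?thesis by blast
      next
        case False
        have bT: "b \<in> T + K" using subset_plus_subgroup[OF K(1), of T] b by blast
        have "t + b \<notin> (x + y) +o K" using quasi_split_critical_pair(4)[OF crS qS tS bT] False by blast
        moreover have "t + b \<in> S + T + K"
          using set_plus_intro[OF tS bT] quasi_split_critical_pair(2)[OF crS qS] by simp
        ultimately show ?thesis using quasi_split_critical_pair(5)[OF crS qS] by blast
      qed
    qed
    then show ?thesis using tx by blast
  qed
  show "critical_pair (A \<inter> (x +o K)) (B \<inter> (y +o K))"
    unfolding critical_pair_def
  proof (intro conjI allI impI)
    show "finite (A \<inter> (x +o K))" "finite (B \<inter> (y +o K))" using c by auto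
    show "A \<inter> (x +o K) \<noteq> {}" "B \<inter> (y +o K) \<noteq> {}" using xy by (auto simp: Ax_def By_def)
    show "card (A \<inter> (x +o K) + (B \<inter> (y +o K))) < card (A \<inter> (x +o K)) + card (B \<inter> (y +o K))"
      using lt by (simp add: Ax_def By_def)
    show "t \<in> A \<inter> (x +o K)" if "t +o (B \<inter> (y +o K)) \<subseteq> (A \<inter> (x +o K)) + (B \<inter> (y +o K))" for t
      using max[OF that K(4) cr q] .
    show "t \<in> B \<inter> (y +o K)" if "t +o (A \<inter> (x +o K)) \<subseteq> (A \<inter> (x +o K)) + (B \<inter> (y +o K))" for t
      using max[OF _ K(3) critical_pair_commute[OF cr] quasi_split_commute[OF q]] that by (simp add: add.commute)
  qed
qed


text \<open>Shifts by \<open>- x\<close> and \<open>- y\<close> move the exceptional cosets of the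
  summands onto \<open>K\<close> and make the sequences basic, since \<open>x\<close> and
  \<open>y\<close> are first terms; the third set is shifted by \<open>x + y\<close>.\<close>

lemma chord_step:
  assumes cp: "critical_pair_in G A B" and Y: "trio G Y" "similar G Y (A, B, neg_sum_compl G A B)"
    and generating: "generating G A" "generating G B"
    and q: "quasi_split A B K x y" "K \<subset> G" "(A + B) + K \<noteq> G" and d: "generates_mod G K d"
    and p: "progression K d x k (A + K)" "k \<ge> 1" "progression K d y l (B + K)" "l \<ge> 1"
  shows "reducible G Y (pair_measure G A B)"
proof -
  have G: "add_subgroup G" "A \<subseteq> G" "B \<subseteq> G" and cr: "critical_pair A B" and DG: "A + B \<noteq> G"
    using cp by (auto simp: critical_pair_in_def)
  note c = critical_pairD[OF cr]
  note qs = quasi_split_critical_pair[OF cr q(1)]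
  note r = quasi_split_restrict[OF cr q(1)]
  have K: "add_subgroup K" "finite K" "x \<in> A" "y \<in> B" and nP: "\<not> (x + y) +o K \<subseteq> A + B"
    using q(1) unfolding quasi_split_def quasi_periodic_def by blast+
  have xG: "x \<in> G" "- x \<in> G" "y \<in> G" "- y \<in> G" using K(3,4) G subgroupD(3)[OF G(1)] by blast+
  define A0 B0 C0 where "A0 = (- x) +o A" and "B0 = (- y) +o B" and "C0 = (x + y) +o neg_sum_compl G A B"
  have "similar G Y ((- x) +o A, (- (- x)) +o B, neg_sum_compl G A B)" using shift[OF Y(2) xG(2)] .
  from similar_shift2[OF this subgroupD(3)[OF G(1) subgroupD(2)[OF G(1) xG(1,3)]]]
  have "similar G Y ((- x) +o A, (- (x + y)) +o (x +o B), (x + y) +o neg_sum_compl G A B)"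
    by (simp only: minus_minus)
  then have sim: "similar G Y (A0, B0, C0)" by (simp add: A0_def B0_def C0_def set_plus_rearrange2)
  have sum: "A0 + B0 = (- (x + y)) +o (A + B)" by (simp add: A0_def B0_def translate_plus)
  have xyG: "x + y \<in> G" using subgroupD(2)[OF G(1) xG(1,3)] .
  have C0: "C0 = neg_sum_compl G A0 B0"
  proof (rule set_eqI)
    fix z
    have "z - (x + y) \<in> G \<longleftrightarrow> z \<in> G"
      using subgroup_add_iff(1)[OF G(1) xyG, of "z - (x + y)"] by simp
    moreover have "- z - (- (x + y)) = - (z - (x + y))" by simp
    ultimately show "z \<in> C0 \<longleftrightarrow> z \<in> neg_sum_compl G A0 B0"
      by (simp only: C0_def sum in_translate in_neg_sum_compl)
  qed
  have AK: "A0 \<inter> K = (- x) +o (A \<inter> (x +o K))" "B0 \<inter> K = (- y) +o (B \<inter> (y +o K))"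
    by (rule set_eqI, auto simp: A0_def B0_def in_translate)+
  have crK: "critical_pair (A0 \<inter> K) (B0 \<inter> K)" unfolding AK by (rule critical_pair_translate[OF r(1)])
  have sumK: "(A0 \<inter> K) + (B0 \<inter> K) = (A0 + B0) \<inter> K"
  proof -
    have "(A0 \<inter> K) + (B0 \<inter> K) = (- (x + y)) +o ((A + B) \<inter> ((x + y) +o K))"
      unfolding AK r(2) by (simp add: translate_plus)
    also have "\<dots> = (A0 + B0) \<inter> K"
      by (rule set_eqI) (auto simp: sum in_translate)
    finally show ?thesis .
  qed
  have nK: "\<not> K \<subseteq> A0 + B0"
  proof
    assume "K \<subseteq> A0 + B0"
    then have "(x + y) +o K \<subseteq> (x + y) +o (A0 + B0)" by simp
    then show False using nP by (simp add: sum set_plus_rearrange2)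
  qed
  have KG: "K \<subseteq> G" using q(2) by blast
  have C0K: "C0 \<inter> K = neg_sum_compl K (A0 \<inter> K) (B0 \<inter> K)"
    using subgroupD(3)[OF K(1)] KG unfolding C0 set_eq_iff Int_iff in_neg_sum_compl sumK by blast
  have cpK: "critical_pair_in K (A0 \<inter> K) (B0 \<inter> K)"
    unfolding critical_pair_in_def using K(1) crK nK sumK by blast
  have ne: "A0 \<inter> K \<noteq> {}" "B0 \<inter> K \<noteq> {}" "C0 \<inter> K \<noteq> {}"
    using critical_pairD(3,4)[OF crK] critical_pair_trio(2)[OF cpK] by (simp_all add: C0K)
  have "C0 - K \<noteq> {}"
  proof -
    obtain g where g: "g \<in> G" "g \<notin> A + B + K"
      using q(3) sumset_subset_subgroup[OF G(1) sumset_subset_subgroup[OF G] KG] by blast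
    then have g': "g \<notin> A + B" "g \<notin> (x + y) +o K" using qs(5) by blast+
    have "(x + y) - g \<in> G" using subgroupD(4)[OF G(1) xyG g(1)] .
    then have "(x + y) - g \<in> C0" using g'(1) by (simp add: C0 in_neg_sum_compl sum in_translate)
    moreover have "(x + y) - g \<notin> K" using g'(2) subgroup_diff_comm[OF K(1)] by (simp add: in_translate)
    ultimately show ?thesis by blast
  qed
  have basic: "nontrivial_basic_R_sequence G K (d +o K) (K \<union> ((- z) +o S))"
    if z: "z \<in> S" "z \<in> G" and pr: "progression K d z m (S + K)" "m \<ge> 1" and f: "S + K - (z +o K) = S - (z +o K)" for z S m
  proof -
    have "S + K = S \<union> (z +o K)" using f set_plus_mono3[OF z(1), of K] subset_plus_subgroup[OF K(1), of S] by blast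
    then have "K \<union> ((- z) +o S) = (- z) +o (S + K)" by (simp add: translate_Un Un_commute)
    moreover have "progression K d 0 m ((- z) +o (S + K))"
      unfolding progression_def
    proof (rule set_eqI)
      fix w
      have "w \<in> (- z) +o (S + K) \<longleftrightarrow> w + z \<in> (\<Union>i\<in>{0..m}. (z + nmult i d) +o K)"
        using pr(1) by (simp add: progression_def in_translate)
      also have "\<dots> \<longleftrightarrow> w \<in> (\<Union>i\<in>{0..m}. (0 + nmult i d) +o K)" by (simp add: in_translate algebra_simps)
      finally show "w \<in> (- z) +o (S + K) \<longleftrightarrow> w \<in> (\<Union>i\<in>{0..m}. (0 + nmult i d) +o K)" .
    qed
    ultimately have "R_sequence_from G K (d +o K) (0 +o K) m (K \<union> ((- z) +o S))"
      using progression_R_sequence[OF K(1) _ subgroupD(1)[OF G(1)]] by simp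
    then show ?thesis unfolding nontrivial_basic_R_sequence_def using pr(2) by (intro exI[of _ m]) simp
  qed
  have bA: "nontrivial_basic_R_sequence G K (d +o K) (K \<union> A0)" unfolding A0_def
    by (rule basic[OF K(3) xG(1) p(1,2) quasi_split_critical_pair(6)[OF critical_pair_commute[OF cr] quasi_split_commute[OF q(1)]]])
  have bB: "nontrivial_basic_R_sequence G K (d +o K) (K \<union> B0)" unfolding B0_def
    by (rule basic[OF K(4) xG(3) p(3,4) qs(6)])
  have gq: "generates_quotient G K (d +o K)" by (rule generates_mod_quotient[OF G(1) K(1) KG d])
  have propK: "proper_subgroup_of K G" using q(2) G(1) K(1) by (simp add: proper_subgroup_of_def)
  have "impure_chord G K Y (A0 \<inter> K, B0 \<inter> K, neg_sum_compl K (A0 \<inter> K) (B0 \<inter> K))"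
    unfolding impure_chord_def
    using propK K(2) Y(1) gq sim bA bB C0 \<open>C0 - K \<noteq> {}\<close> ne C0K by blast
  \<comment> \<open>\<open>A0\<close> generates \<open>G\<close> and so loses an element, which
    outweighs a possible rise of both counts.\<close>
  moreover have "pair_measure K (A0 \<inter> K) (B0 \<inter> K) < pair_measure G A B"
  proof -
    have fin: "finite A0" "finite B0" and ca: "card A0 = card A" "card B0 = card B" using c by (simp_all add: A0_def B0_def)
    have "generating G A0" using generating(1) by (simp add: A0_def)
    then have "\<not> A0 \<subseteq> K" using generating_not_coset(2)[of G A0 K 0] K(1) q(2) by simp
    then have "A0 \<inter> K \<subset> A0" by blast
    then have "card (A0 \<inter> K) < card A" using psubset_card_mono[OF fin(1)] ca by metis
    moreover have "card (B0 \<inter> K) \<le> card B" using card_mono[OF fin(2), of "B0 \<inter> K"] ca by simp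
    moreover have "nongen_count K (A0 \<inter> K) \<le> 1" "nongen_count K (B0 \<inter> K) \<le> 1" by (simp_all add: nongen_count_def)
    ultimately show ?thesis by (simp add: pair_measure_def)
  qed
  ultimately show ?thesis unfolding reducible_def using q(2) cpK by blast
qed

text \<open>If it is the third set that lies in a proper coset, the trio is rotated. Then
  \<open>G\<close> is finite: a further coset of \<open>M\<close> lies entirely in the finite sum,
  so \<open>M\<close> and the complement are finite.\<close>

lemma trio_step:
  assumes cp: "critical_pair_in G A B" and Y: "trio G Y" "similar G Y (A, B, neg_sum_compl G A B)"
  shows "pure_beat G Y \<or> pure_chord G Y \<or> reducible G Y (pair_measure G A B)"
proof -
  have G: "add_subgroup G" "A \<subseteq> G" "B \<subseteq> G" and cr: "critical_pair A B" and DG: "A + B \<noteq> G"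
    using cp by (auto simp: critical_pair_in_def)
  note c = critical_pairD[OF cr]
  have D: "A + B \<subseteq> G" by (rule sumset_subset_subgroup[OF G])
  let ?C = "neg_sum_compl G A B"
  consider "\<not> generating G A" | "\<not> generating G B" | "\<not> generating G (G - (A + B))" | "generating G A" "generating G B" "generating G (G - (A + B))"
    by blast
  then show ?thesis
  proof cases
    case 1
    then show ?thesis using beat_step[OF cp Y] by blast
  next
    case 2
    have "similar G Y (B, A, neg_sum_compl G B A)" using swap12[OF Y(2)] neg_sum_compl_commute by metis
    moreover have "pair_measure G B A = pair_measure G A B" by (simp add: pair_measure_def)
    ultimately show ?thesis using beat_step[OF critical_pair_in_commute[OF cp] Y(1) _ 2] by metis
  next
    case 3
    then obtain M z where M: "add_subgroup M" "M \<subset> G" "G - (A + B) \<subseteq> z +o M" unfolding generating_def by blast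
    have finG: "finite G"
    proof -
      obtain g where g: "g \<in> G" "g \<notin> A + B" using D DG by blast
      have gz: "z +o M = g +o M" using coset_eqI[OF M(1), of g z] g M(3) by blast
      have "g +o M \<subseteq> G" using coset_subset_subgroup[OF G(1) g(1)] M(2) by blast
      moreover have "g +o M \<noteq> G" 
      proof
        assume gM: "g +o M = G"
        then have "g +o M = 0 +o M" using coset_eqI[OF M(1), of 0 g] subgroupD(1)[OF G(1)] by blast
        then show False using gM M(2) by simp
      qed
      ultimately obtain h where h: "h \<in> G" "h \<notin> g +o M" by blast
      have "h +o M \<subseteq> A + B"
      proof (rule subsetI)
        fix w assume w: "w \<in> h +o M"
        then have "w \<in> G" using coset_subset_subgroup[OF G(1) h(1), of M] M(2) by blast
        moreover have "w \<notin> g +o M" using w coset_disjoint[OF M(1), of h g] h(2) by (auto simp: in_translate)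
        ultimately show "w \<in> A + B" using M(3) gz by blast
      qed
      then have "finite (h +o M)" using c(6) finite_subset by blast
      then have "finite (G - (A + B))" using finite_subset[OF M(3)] by simp
      then show ?thesis using c(6) by simp
    qed
    have Ce: "?C = uminus ` (G - (A + B))" by (rule neg_sum_compl_eq[OF G(1)])
    have crC: "critical_pair ?C A" unfolding Ce by (rule complement_critical_pair[OF G finG cr DG])
    have sumC: "?C + A = uminus ` (G - B)" unfolding Ce by (rule complement_sumset[OF G cr])
    have "neg_sum_compl G ?C A = B"
    proof (rule set_eqI)
      fix w show "w \<in> neg_sum_compl G ?C A \<longleftrightarrow> w \<in> B"
        using G(3) by (auto simp: in_neg_sum_compl sumC in_uminus_image)
    qed
    then have "similar G Y (?C, A, neg_sum_compl G ?C A)" using similar_rotate(2)[OF Y(2)] by simp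
    moreover have "critical_pair_in G ?C A"
    proof -
      obtain b where "b \<in> B" using c by blast
      then have "- b \<in> G" "- b \<notin> ?C + A" using G subgroupD(3)[OF G(1)] by (auto simp: sumC in_uminus_image)
      then have "?C + A \<noteq> G" by blast
      moreover have "?C \<subseteq> G" by (auto simp: neg_sum_compl_def)
      ultimately show ?thesis using G crC by (simp add: critical_pair_in_def)
    qed
    moreover have "\<not> generating G ?C" using 3 generating_uminus Ce by metis
    ultimately have "pure_beat G Y \<or> reducible G Y (pair_measure G ?C A)" using beat_step Y(1) by blast
    then show ?thesis using finG unfolding reducible_def by blast
  next
    case 4
    show ?thesis
    proof (rule kemperman_generating[OF G cr DG 4])
      fix d q k q' l
      assume d: "generates_mod G (stab (A + B)) d" and p: "progression (stab (A + B)) d q k A" "k \<ge> 1"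
        "progression (stab (A + B)) d q' l B" "l \<ge> 1"
      let ?H = "stab (A + B)"
      note s = critical_pair_stab[OF cr HOL.refl]
      have HG: "?H \<subset> G" by (rule stab_sumset_psubset[OF G cr DG])
      have heads: "q \<in> G" "q' \<in> G"
        using progression_mem[OF s(1) p(1), of 0] progression_mem[OF s(1) p(3), of 0] G by auto
      have "\<not> (\<exists>Q\<in>cosets G ?H. ?C \<subseteq> Q)"
      proof -
        have "generating G ?C" using 4(3) generating_uminus neg_sum_compl_eq[OF G(1)] by metis
        then show ?thesis using generating_not_coset(2)[OF _ s(1) HG] unfolding cosets_def by blast
      qed
      moreover have "nontrivial_R_sequence G ?H (d +o ?H) A" "nontrivial_R_sequence G ?H (d +o ?H) B"
        unfolding nontrivial_R_sequence_def
        using progression_R_sequence[OF s(1) p(1) heads(1)] progression_R_sequence[OF s(1) p(3) heads(2)] p(2,4)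
        by fastforce+
      moreover have "generates_quotient G ?H (d +o ?H)"
        using generates_mod_quotient[OF G(1) s(1) _ d] HG by blast
      moreover have "proper_subgroup_of ?H G" using HG s(1) G(1) by (simp add: proper_subgroup_of_def)
      ultimately have "pure_chord_rel G ?H Y" unfolding pure_chord_rel_def using s(2) Y by blast
      then show ?thesis unfolding pure_chord_def by blast
    next
      fix K x y d k l
      assume "quasi_split A B K x y" "K \<subset> G" "A + B + K \<noteq> G" "generates_mod G K d"
        "progression K d x k (A + K)" "k \<ge> 1" "progression K d y l (B + K)" "l \<ge> 1"
      from chord_step[OF cp Y 4(1,2) this] show ?thesis by blast
    qed
  qed
qed

section \<open>Descent along continuations\<close>

inductive recursive_chain :: "'a::ab_group_add set \<Rightarrow> 'a trio \<Rightarrow> bool" where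
  pure: "trio G Y \<Longrightarrow> pure_beat G Y \<or> pure_chord G Y \<Longrightarrow> recursive_chain G Y"
| continue: "trio G Y \<Longrightarrow> proper_subgroup_of K G \<Longrightarrow> impure_beat G K Y Y' \<or> impure_chord G K Y Y' \<Longrightarrow>
    recursive_chain K Y' \<Longrightarrow> recursive_chain G Y"

lemma impure_proper: "impure_beat G K Y Y' \<or> impure_chord G K Y Y' \<Longrightarrow> proper_subgroup_of K G"
  unfolding impure_beat_def impure_chord_def by blast

lemma recursive_chain_step:
  assumes cp: "critical_pair_in G A B" and Y: "trio G Y" "similar G Y (A, B, neg_sum_compl G A B)"
    and IH: "\<And>K A' B'. K \<subset> G \<Longrightarrow> critical_pair_in K A' B' \<Longrightarrow>
      (infinite G \<longrightarrow> pair_measure K A' B' < pair_measure G A B) \<Longrightarrow>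
      recursive_chain K (A', B', neg_sum_compl K A' B')"
  shows "recursive_chain G Y"
  using trio_step[OF cp Y] pure[OF Y(1)] continue[OF Y(1)] IH impure_proper unfolding reducible_def by metis

text \<open>The order of the group is the only measure here, since rotated pairs need not become
  smaller. Continuations stay in finite groups.\<close>

lemma recursive_chain_finite:
  assumes "finite G" "critical_pair_in G A B" "trio G Y" "similar G Y (A, B, neg_sum_compl G A B)"
  shows "recursive_chain G Y"
  using assms
proof (induction "card G" arbitrary: G A B Y rule: less_induct)
  case less
  show ?case
  proof (rule recursive_chain_step[OF less.prems(2-4)])
    fix K A' B' assume K: "K \<subset> G" "critical_pair_in K A' B'"
    show "recursive_chain K (A', B', neg_sum_compl K A' B')"
      using less.hyps[OF psubset_card_mono[OF less.prems(1) K(1)] _ K(2) critical_pair_trio(1)[OF K(2)] similar.refl]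
        finite_subset[of K G] K(1) less.prems(1) by blast
  qed
qed

lemma recursive_chain_exists:
  assumes "critical_pair_in G A B" "trio G Y" "similar G Y (A, B, neg_sum_compl G A B)"
  shows "recursive_chain G Y"
  using assms
proof (induction "pair_measure G A B" arbitrary: G A B Y rule: less_induct)
  case less
  show ?case
  proof (cases "finite G")
    case True
    then show ?thesis using recursive_chain_finite less.prems by blast
  next
    case False
    show ?thesis
    proof (rule recursive_chain_step[OF less.prems])
      fix K A' B'
      assume K: "K \<subset> G" "critical_pair_in K A' B'" "infinite G \<longrightarrow> pair_measure K A' B' < pair_measure G A B"
      show "recursive_chain K (A', B', neg_sum_compl K A' B')"
        using less.hyps[OF _ K(2) critical_pair_trio(1)[OF K(2)] similar.refl] K(3) False by blast
    qed
  qed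
qed

lemma recursive_chain_sequence:
  assumes "recursive_chain G1 Y1"
  shows "\<exists>(m::nat) (G :: nat \<Rightarrow> 'a::ab_group_add set) (Y :: nat \<Rightarrow> 'a trio).
    m \<ge> 1 \<and> G 1 = G1 \<and> Y 1 = Y1 \<and>
    (\<forall>i\<in>{1..<m}. proper_subgroup_of (G (i + 1)) (G i)) \<and>
    (\<forall>i\<in>{1..m}. trio (G i) (Y i)) \<and>
    (\<forall>i\<in>{1..<m}. impure_beat (G i) (G (i + 1)) (Y i) (Y (i + 1)) \<or>
                  impure_chord (G i) (G (i + 1)) (Y i) (Y (i + 1))) \<and>
    (pure_beat (G m) (Y m) \<or> pure_chord (G m) (Y m))"
  using assms
proof (induction rule: recursive_chain.induct)
  case (pure G Y)
  then show ?case by (intro exI[of _ 1] exI[of _ "\<lambda>_. G"] exI[of _ "\<lambda>_. Y"]) auto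
next
  case (continue G Y K Y')
  then obtain m :: nat and Gs Ys where IH: "m \<ge> 1" "Gs 1 = K" "Ys 1 = Y'"
    "\<forall>i\<in>{1..<m}. proper_subgroup_of (Gs (i + 1)) (Gs i)" "\<forall>i\<in>{1..m}. trio (Gs i) (Ys i)"
    "\<forall>i\<in>{1..<m}. impure_beat (Gs i) (Gs (i + 1)) (Ys i) (Ys (i + 1)) \<or> impure_chord (Gs i) (Gs (i + 1)) (Ys i) (Ys (i + 1))"
    "pure_beat (Gs m) (Ys m) \<or> pure_chord (Gs m) (Ys m)" by blast
  define G' where "G' i = (if i = 1 then G else Gs (i - 1))" for i :: nat
  define Z where "Z i = (if i = 1 then Y else Ys (i - 1))" for i :: nat
  have one: "G' 1 = G" "Z 1 = Y" "G' (1 + 1) = K" "Z (1 + 1) = Y'" using IH(2,3) by (simp_all add: G'_def Z_def)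
  have shift: "G' (j + 1) = Gs j" "Z (j + 1) = Ys j" if "j \<ge> 1" for j using that by (simp_all add: G'_def Z_def)
  have all_less: "\<forall>i\<in>{1..<m+1}. P i" if "P 1" "\<And>j. j \<in> {1..<m} \<Longrightarrow> P (j + 1)" for P :: "nat \<Rightarrow> bool"
  proof
    fix i assume i: "i \<in> {1..<m+1}"
    show "P i"
    proof (cases "i = 1")
      case False
      then have "i - 1 \<in> {1..<m}" using i unfolding atLeastLessThan_iff by arith
      from that(2)[OF this] show ?thesis using i by simp
    qed (use that in simp)
  qed
  have all_le: "\<forall>i\<in>{1..m+1}. P i" if "P 1" "\<And>j. j \<in> {1..m} \<Longrightarrow> P (j + 1)" for P :: "nat \<Rightarrow> bool"
  proof
    fix i assume i: "i \<in> {1..m+1}"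
    show "P i"
    proof (cases "i = 1")
      case False
      then have "i - 1 \<in> {1..m}" using i unfolding atLeastAtMost_iff by arith
      from that(2)[OF this] show ?thesis using i by simp
    qed (use that in simp)
  qed
  have "\<forall>i\<in>{1..<m+1}. proper_subgroup_of (G' (i + 1)) (G' i)"
    by (rule all_less) (use one continue shift IH(4) in auto)
  moreover have "\<forall>i\<in>{1..m+1}. trio (G' i) (Z i)"
    by (rule all_le) (use one continue shift IH(5) in auto)
  moreover have "\<forall>i\<in>{1..<m+1}. impure_beat (G' i) (G' (i + 1)) (Z i) (Z (i + 1)) \<or> impure_chord (G' i) (G' (i + 1)) (Z i) (Z (i + 1))"
    by (rule all_less) (use one continue shift IH(6) in auto)
  moreover have "pure_beat (G' (m + 1)) (Z (m + 1)) \<or> pure_chord (G' (m + 1)) (Z (m + 1))"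
    using IH(7) shift[OF IH(1)] by simp
  ultimately show ?case using one by (intro exI[of _ "m + 1"] exI[of _ G'] exI[of _ Z]) simp
qed

section \<open>From maximal critical trios to critical pairs\<close>

lemma trio_permute:
  assumes "trio G (A, B, C)"
  shows "trio G (B, A, C)" "trio G (A, C, B)"
proof -
  have e: "B + A + C = A + B + C" "A + C + B = A + B + C" by (simp_all add: ac_simps)
  show "trio G (B, A, C)" "trio G (A, C, B)" using assms unfolding trio.simps e by blast+
qed

lemma maximal_trio_permute:
  assumes "maximal_trio G (A, B, C)"
  shows "maximal_trio G (B, A, C)" "maximal_trio G (A, C, B)"
proof -
  have max: "(A', B', C') = (A, B, C)" if "trio G (A', B', C')" "A \<subseteq> A'" "B \<subseteq> B'" "C \<subseteq> C'" for A' B' C'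
    using assms that unfolding maximal_trio_def by (metis supertrio.simps)
  have t: "trio G (B, A, C)" "trio G (A, C, B)" 
    using assms trio_permute[of G A B C] unfolding maximal_trio_def by blast+
  show "maximal_trio G (B, A, C)" unfolding maximal_trio_def
  proof (intro conjI allI impI t(1))
    fix T' assume T': "trio G T' \<and> supertrio T' (B, A, C)"
    obtain X Y Z where T: "T' = (X, Y, Z)" by (cases T')
    show "T' = (B, A, C)" using max[of Y X Z] T' trio_permute(1)[of G X Y Z] unfolding T supertrio.simps by blast
  qed
  show "maximal_trio G (A, C, B)" unfolding maximal_trio_def
  proof (intro conjI allI impI t(2))
    fix T' assume T': "trio G T' \<and> supertrio T' (A, C, B)"
    obtain X Y Z where T: "T' = (X, Y, Z)" by (cases T')
    show "T' = (A, C, B)" using max[of X Z Y] T' trio_permute(2)[of G X Y Z] unfolding T supertrio.simps by blast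
  qed
qed

text \<open>For \<open>a \<in> A\<close> the infinite set of all \<open>- (a + b)\<close> meets the
  cofinite set \<open>C\<close>.\<close>

lemma trio_one_infinite:
  assumes "add_subgroup G" "trio G (A, B, C)" "A \<noteq> {}" "infinite B" "infinite C"
  shows False
proof -
  have t: "A \<subseteq> G" "B \<subseteq> G" "C \<subseteq> G" "0 \<notin> A + B + C" "finite (G - C)" using assms by auto
  obtain a where a: "a \<in> A" using assms by blast
  let ?f = "\<lambda>b. - (a + b)"
  have "inj_on ?f B" by (auto simp: inj_on_def)
  then have "infinite (?f ` B)" using assms(4) finite_image_iff by blast
  moreover have "?f ` B \<subseteq> G"
    using a t(1,2) subgroupD(2,3)[OF assms(1)] by blast
  ultimately obtain b where b: "b \<in> B" "- (a + b) \<in> C" using t(5) finite_subset[of "?f ` B" "G - C"] by blast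
  have "(a + b) + - (a + b) \<in> A + B + C" using a b by (intro set_plus_intro)
  then show False using t(4) by simp
qed

lemma maximal_trio_third:
  assumes G: "add_subgroup G" and m: "maximal_trio G (A, B, C)" and fin: "finite A" "finite B"
  shows "C = neg_sum_compl G A B"
proof -
  have t: "A \<subseteq> G" "B \<subseteq> G" "C \<subseteq> G" "0 \<notin> A + B + C" using m by (auto simp: maximal_trio_def)
  have "0 \<notin> A + B + neg_sum_compl G A B"
  proof
    assume "0 \<in> A + B + neg_sum_compl G A B"
    then obtain d z where "0 = d + z" "d \<in> A + B" "z \<in> neg_sum_compl G A B" by (elim set_plus_elim) blast
    then show False by (simp add: in_neg_sum_compl eq_neg_iff_add_eq_0[symmetric])
  qed
  moreover have "finite (G - neg_sum_compl G A B)"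
  proof -
    have "G - neg_sum_compl G A B \<subseteq> uminus ` (A + B)" by (auto simp: neg_sum_compl_def)
    then show ?thesis using finite_sumset[OF fin] finite_subset by blast
  qed
  moreover have "neg_sum_compl G A B \<subseteq> G" by (auto simp: neg_sum_compl_def)
  ultimately have "trio G (A, B, neg_sum_compl G A B)" using t fin by simp
  moreover have "C \<subseteq> neg_sum_compl G A B"
  proof
    fix z assume z: "z \<in> C"
    have "- z \<notin> A + B"
    proof
      assume "- z \<in> A + B"
      from set_plus_intro[OF this z] show False using t(4) by simp
    qed
    then show "z \<in> neg_sum_compl G A B" using z t(3) by (auto simp: in_neg_sum_compl)
  qed
  ultimately have "(A, B, neg_sum_compl G A B) = (A, B, C)"
    using m unfolding maximal_trio_def by (metis supertrio.simps order_refl)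
  then show ?thesis by simp
qed

lemma maximal_trio_critical_pair:
  assumes G: "add_subgroup G" and m: "maximal_trio G (A, B, C)" and fin: "finite A" "finite B"
    and ne: "A \<noteq> {}" "B \<noteq> {}" "C \<noteq> {}" and lt: "card (A + B) < card A + card B"
  shows "critical_pair_in G A B"
proof -
  note C = maximal_trio_third[OF G m fin]
  have max1: "x \<in> A" if m: "maximal_trio G (A, B, C)" and fin: "finite A" and ne: "B \<noteq> {}" 
    and x: "x +o B \<subseteq> A + B" for x and A B :: "'a set"
  proof -
    have t: "A \<subseteq> G" "B \<subseteq> G" "C \<subseteq> G" "0 \<notin> A + B + C" "\<forall>X\<in>{A, B, C}. finite X \<or> finite (G - X)" 
      using m by (auto simp: maximal_trio_def)
    have e: "insert x A + B = A + B"
    proof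
      show "insert x A + B \<subseteq> A + B"
      proof
        fix z assume "z \<in> insert x A + B"
        then obtain a b where "z = a + b" "a \<in> insert x A" "b \<in> B" by (elim set_plus_elim) blast
        then show "z \<in> A + B" using x unfolding translate_subset_iff by auto
      qed
      show "A + B \<subseteq> insert x A + B" by (rule set_plus_mono2) auto
    qed
    obtain b where b: "b \<in> B" using ne by blast
    have "x + b \<in> A + B" using x b unfolding translate_subset_iff by blast
    then have "x + b \<in> G" using sumset_subset_subgroup[OF G t(1,2)] by blast
    then have "x \<in> G" using subgroupD(4)[OF G, of "x + b" b] b t(2) by auto
    then have "trio G (insert x A, B, C)" using t fin e by simp
    then have "(insert x A, B, C) = (A, B, C)"
      using m unfolding maximal_trio_def by (metis supertrio.simps order_refl subset_insertI)
    then show ?thesis by blast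
  qed
  have "A \<subseteq> G" "B \<subseteq> G" using m by (auto simp: maximal_trio_def)
  moreover have "critical_pair A B" unfolding critical_pair_def
    using fin ne lt max1[OF m fin(1) ne(2)] max1[OF maximal_trio_permute(1)[OF m] fin(2) ne(1)]
    by (simp add: add.commute)
  moreover have "A + B \<noteq> G"
  proof
    assume e: "A + B = G"
    obtain z where "z \<in> C" using ne by blast
    then show False using subgroupD(3)[OF G, of z] unfolding C in_neg_sum_compl e by blast
  qed
  ultimately show ?thesis using G by (simp add: critical_pair_in_def)
qed

lemma card_neg_sum_compl:
  assumes G: "add_subgroup G" "A \<subseteq> G" "B \<subseteq> G"
  shows "card (G - neg_sum_compl G A B) = card (A + B)"
proof -
  have "G - neg_sum_compl G A B = uminus ` (A + B)"
    using sumset_subset_subgroup[OF G] subgroupD(3)[OF G(1)] by (auto simp: neg_sum_compl_def)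
  then show ?thesis by simp
qed

text \<open>At most one of the sets is infinite, and it takes the third place. If all are finite,
  criticality makes \<open>G\<close> finite, and then the deficiency is symmetric, so any order will
  do.\<close>

lemma normal_form_exists:
  assumes G: "add_subgroup G" and m: "maximal_trio G T" and n: "nontrivial T" and cr: "critical G T"
  shows "\<exists>A B. critical_pair_in G A B \<and> similar G T (A, B, neg_sum_compl G A B)"
proof -
  obtain A B C where T: "T = (A, B, C)" by (cases T)
  have ne: "A \<noteq> {}" "B \<noteq> {}" "C \<noteq> {}" using n by (auto simp: T)
  have m1: "maximal_trio G (A, B, C)" using m by (simp add: T)
  note m2 = maximal_trio_permute(2)[OF m1]
  have m3: "maximal_trio G (B, C, A)" by (rule maximal_trio_permute(2)[OF maximal_trio_permute(1)[OF m1]])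
  have t: "trio G (A, B, C)" using m1 by (simp add: maximal_trio_def)
  note t2 = trio_permute(1)[OF t]
  note t3 = trio_permute(1)[OF trio_permute(2)[OF t]]
  have sub: "A \<subseteq> G" "B \<subseteq> G" "C \<subseteq> G" using t by auto
  have sim: "similar G T (A, B, C)" "similar G T (A, C, B)" "similar G T (B, C, A)"
    using similar.refl[of G T] similar.swap23[of G T A B C] similar_rotate(1)[of G T A B C] by (simp_all add: T)
  have pos: "deficiency G (A, B, C) > 0" using cr by (simp add: critical_def T)
  have main: ?thesis if "maximal_trio G (X, Y, Z)" "finite X" "finite Y" "X \<noteq> {}" "Y \<noteq> {}" "Z \<noteq> {}"
    "similar G T (X, Y, Z)" "finite (G - Z) \<Longrightarrow> card (G - Z) < card X + card Y" "X \<subseteq> G" "Y \<subseteq> G" for X Y Z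
  proof -
    have Z: "Z = neg_sum_compl G X Y" by (rule maximal_trio_third[OF G that(1-3)])
    have "finite (G - Z)"
    proof -
      have "G - Z \<subseteq> uminus ` (X + Y)" unfolding Z by (auto simp: neg_sum_compl_def)
      then show ?thesis using finite_sumset[OF that(2,3)] finite_subset by blast
    qed
    then have "card (X + Y) < card X + card Y"
      using that(8) card_neg_sum_compl[OF G that(9,10)] unfolding Z by simp
    then show ?thesis using maximal_trio_critical_pair[OF G that(1-6)] that(7) Z by blast
  qed
  consider "infinite C" | "infinite B" | "infinite A" | "finite A" "finite B" "finite C" by blast
  then show ?thesis
  proof cases
    case 1
    then have f: "finite A" "finite B"
      using trio_one_infinite[OF G t ne(1)] trio_one_infinite[OF G t2 ne(2)] by blast+
    show ?thesis
      by (rule main[OF m1 f ne sim(1) _ sub(1,2)]) (use pos f 1 in \<open>simp add: ecard_def\<close>)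
  next
    case 2
    then have f: "finite A" "finite C"
      using trio_one_infinite[OF G t ne(1)] trio_one_infinite[OF G t3 ne(3)] by blast+
    show ?thesis
      by (rule main[OF m2 f ne(1,3,2) sim(2) _ sub(1,3)]) (use pos f 2 in \<open>simp add: ecard_def\<close>)
  next
    case 3
    then have f: "finite B" "finite C"
      using trio_one_infinite[OF G t2 ne(2)] trio_one_infinite[OF G t3 ne(3)] 
        trio_one_infinite[OF G trio_permute(2)[OF t3] ne(3)] trio_one_infinite[OF G trio_permute(2)[OF t2] ne(2)] by blast+
    show ?thesis
      by (rule main[OF m3 f ne(2,3,1) sim(3) _ sub(2,3)]) (use pos f 3 in \<open>simp add: ecard_def\<close>)
  next
    case 4
    have finG: "finite G"
    \<comment> \<open>In an infinite group the complement of a finite set is infinite, which makes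
      the deficiency negative.\<close>
    proof (rule ccontr)
      assume "infinite G"
      then have "infinite (G - X)" if "finite X" for X using that by simp
      then show False using pos 4 by (simp add: ecard_def split: if_splits)
    qed
    have le: "card X \<le> card G" "card (G - X) = card G - card X" if "X \<subseteq> G" for X
      using card_mono[OF finG that] card_Diff_subset[OF finite_subset[OF that finG] that] by auto
    have "card (G - C) < card A + card B"
      using pos 4 finG le[OF sub(1)] le[OF sub(2)] le[OF sub(3)] by (simp add: ecard_def of_nat_diff split: if_splits)
    then show ?thesis by (intro main[OF m1 4(1,2) ne sim(1) _ sub(1,2)])
  qed
qed

theorem theorem4p5:
  fixes G1 :: "'a::ab_group_add set" and Y1 :: "'a trio"
  assumes "add_subgroup G1"
    and "maximal_trio G1 Y1"
    and "nontrivial Y1"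
    and "critical G1 Y1"
  shows "\<exists>(m::nat) (G :: nat \<Rightarrow> 'a set) (Y :: nat \<Rightarrow> 'a trio).
    m \<ge> 1 \<and> G 1 = G1 \<and> Y 1 = Y1 \<and>
    (\<forall>i\<in>{1..<m}. proper_subgroup_of (G (i + 1)) (G i)) \<and>
    (\<forall>i\<in>{1..m}. trio (G i) (Y i)) \<and>
    (\<forall>i\<in>{1..<m}. impure_beat (G i) (G (i + 1)) (Y i) (Y (i + 1)) \<or>
                  impure_chord (G i) (G (i + 1)) (Y i) (Y (i + 1))) \<and>
    (pure_beat (G m) (Y m) \<or> pure_chord (G m) (Y m))"
proof -
  obtain A B where AB: "critical_pair_in G1 A B" "similar G1 Y1 (A, B, neg_sum_compl G1 A B)"
    using normal_form_exists[OF assms] by blast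
  have "trio G1 Y1" using assms(2) by (simp add: maximal_trio_def)
  then show ?thesis using recursive_chain_sequence[OF recursive_chain_exists[OF AB(1) _ AB(2)]] by simp
qed

end
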